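(* Let $f_c(z)=z^d+c$ for an integer $d\ge 2$. Then for all integers $n,m$ with $m\mid n$ and $m<n$, there is a polynomial $\Psi_{n,m}(t)\in\mathbb{Z}[t]$ such that $$\Delta_{n,m}(c)=\Psi_{n,m}(d^d c^{d-1}).$$ Moreover, the polynomial $(-1)^{e_{n,m}}\Psi_{n,m}(t)$ is monic, where $d_m=\sum_{k\mid m}d^k\mu\left(\frac{m}{k}\right)$, $\varphi(n)$ is Euler's totient function, and $$e_{n,m}:=\begin{cases}\varphi(n)\,\dfrac{d_m}{m} & \text{if } n\neq m,\\[2mm] \dfrac{d_n}{n}+\varphi(n)\displaystyle\sum_{m\mid n,\ m<n}\frac{d_m}{m} & \text{if } n=m.\end{cases}$$
   Context: Here $c$ is a parameter (indeterminate), $f=f_c$ is regarded as a polynomial in $z$ over $\mathbb{Z}[c]$, $f^{\circ k}$ denotes the $k$-th iterate of $f$, and $\mu$ is the Möbius function. For a positive integer $m$, the $m$-th dynatomic polynomial is $\Phi_m^*(z)=\prod_{k\mid m}(f^{\circ k}(z)-z)^{\mu(m/k)}$, a polynomial in $z$ of degree $d_m$. For a root $\alpha\in\overline{\mathbb{Q}(c)}$ of $\Phi_m^*$, its multiplier is $\omega_m(\alpha)=(f^{\circ m})'(\alpha)$. The $m$-th multiplier polynomial $\delta_m(x)\in\mathbb{Z}[c][x]$ is the monic polynomial in $x$ satisfying $\delta_m(x)^m=\prod_{\Phi_m^*(\alpha)=0}(x-\omega_m(\alpha))$, with roots counted with multiplicity. Let $\Phi^{\mathrm{cyc}}_i(x)$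 be the $i$-th cyclotomic polynomial. For positive integers $m,n$ with $m\mid n$ and $m<n$, define $\Delta_{n,m}=\mathrm{Res}_x(\Phi^{\mathrm{cyc}}_{n/m}(x),\delta_m(x))$, where for $F$ with leading coefficient $a$ one has $\mathrm{Res}_x(F,G)=a^{\deg G}\prod_{F(\alpha)=0}G(\alpha)$. The quantity $\Delta_{n,n}$ is defined by $\delta_n(1)=\Delta_{n,n}\prod_{m\mid n,\ m\neq n}\Delta_{n,m}$.
   Formalization: In the exponent e_{n,m} the factor φ(n) is replaced by φ(n/m) (inside the sum for n=m as well), because the printed sign is false: for d=2, n=4, m=2 one has Ψ(t) = -t-5 while φ(4)d_2/2 = 2 is even. *)

theory Defs
  imports
    Complex_Main
    "HOL-Computational_Algebra.Computational_Algebra"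
    "HOL-Number_Theory.Totient"
    "HOL-Algebra.Algebraic_Closure_Type"
begin

text \<open>
  Elements of \<open>\<int>[c]\<close> have type \<^typ>\<open>int poly\<close>, with \<open>c\<close> the indeterminate. Polynomials in \<open>z\<close>
  (or \<open>x\<close>) over \<open>\<int>[c]\<close> have type \<^typ>\<open>int poly poly\<close>, the outer indeterminate being \<open>z\<close> (or \<open>x\<close>).
  The field \<open>\<rat>(c)\<close> is the fraction field \<^typ>\<open>int poly fract\<close> of \<open>\<int>[c]\<close>.
\<close>

type_synonym Qc_closure = "int poly fract alg_closure"

definition emb :: "int poly \<Rightarrow> Qc_closure" where
  "emb a = to_ac (to_fract a)"

definition moebius :: "nat \<Rightarrow> int" where
  "moebius n = (if squarefree n then (- 1) ^ card (prime_factors n) else 0)"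

definition cyclotomic :: "nat \<Rightarrow> int poly" where
  "cyclotomic i = (THE P. map_poly complex_of_int P =
     (\<Prod>k\<in>totatives i. [:- cis (2 * pi * real k / real i), 1:]))"

definition unicritical :: "nat \<Rightarrow> int poly poly" where
  "unicritical d = [:0, 1:] ^ d + [:[:0, 1:]:]"

definition iterate :: "nat \<Rightarrow> nat \<Rightarrow> int poly poly" where
  "iterate d k = (pcompose (unicritical d) ^^ k) [:0, 1:]"

text \<open>
  The product, whose exponents may be negative, is formed in the fraction field of \<open>\<int>[c][z]\<close>.
\<close>

definition dynatomic :: "nat \<Rightarrow> nat \<Rightarrow> int poly poly" where
  "dynatomic d m = (THE P. to_fract P =
     (\<Prod>k | k dvd m. to_fract (iterate d k - [:0, 1:]) powi moebius (m div k)))"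

definition multiplier :: "nat \<Rightarrow> nat \<Rightarrow> Qc_closure \<Rightarrow> Qc_closure" where
  "multiplier d m \<alpha> = poly (pderiv (map_poly emb (iterate d m))) \<alpha>"

definition multiplier_poly :: "nat \<Rightarrow> nat \<Rightarrow> int poly poly" where
  "multiplier_poly d m = (THE D. lead_coeff D = 1 \<and>
     map_poly emb D ^ m =
       (\<Prod>\<alpha>\<in>#proots (map_poly emb (dynatomic d m)). [:- multiplier d m \<alpha>, 1:]))"

definition root_resultant :: "'a :: alg_closed_field poly \<Rightarrow> 'a poly \<Rightarrow> 'a" where
  "root_resultant F G = lead_coeff F ^ degree G * (\<Prod>\<alpha>\<in>#proots F. poly G \<alpha>)"

text \<open>
  The quantities \<open>\<Delta>\<^bsub>n,m\<^esub>\<close> are defined as elements of the algebraic closure of \<open>\<rat>(c)\<close>; that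
  they lie in \<open>\<int>[c]\<close> is not built into the definition.
\<close>

definition Delta_res :: "nat \<Rightarrow> nat \<Rightarrow> nat \<Rightarrow> Qc_closure" where
  "Delta_res d n m = root_resultant
     (map_poly of_int (cyclotomic (n div m))) (map_poly emb (multiplier_poly d m))"

text \<open>
  For \<open>m = n\<close> this solves \<open>\<delta>\<^sub>n(1) = \<Delta>\<^bsub>n,n\<^esub> \<Prod> \<Delta>\<^bsub>n,k\<^esub>\<close>, the product (which does not vanish) ranging
  over the proper divisors \<open>k\<close> of \<open>n\<close>.
\<close>

definition Delta :: "nat \<Rightarrow> nat \<Rightarrow> nat \<Rightarrow> Qc_closure" where
  "Delta d n m = (if m = n
     then emb (poly (multiplier_poly d n) 1) / (\<Prod>k | k dvd n \<and> k \<noteq> n. Delta_res d n k)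
     else Delta_res d n m)"

definition dyn_degree :: "nat \<Rightarrow> nat \<Rightarrow> int" where
  "dyn_degree d m = (\<Sum>k | k dvd m. int d ^ k * moebius (m div k))"

text \<open>
  The number \<open>d\<^sub>m\<close> is positive and divisible by \<open>m\<close>, so neither \<^const>\<open>nat\<close> nor \<^const>\<open>divide\<close>
  truncates below.

  The totient is taken at \<open>n/m\<close>, the degree of the cyclotomic polynomial in \<open>\<Delta>\<^bsub>n,m\<^esub>\<close>. With \<open>\<phi>(n)\<close>
  in its place, the sign would be wrong: for \<open>d = 2\<close>, \<open>n = 4\<close>, \<open>m = 2\<close> one has \<open>\<delta>\<^sub>2 = x - 4c - 4\<close>, so
  \<open>\<Delta>\<^bsub>4,2\<^esub> = \<delta>\<^sub>2(-1) = -4c - 5\<close> and \<open>\<Psi>\<^bsub>4,2\<^esub> = -t - 5\<close>, whereas \<open>\<phi>(4) d\<^sub>2/2 = 2\<close> is even.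
\<close>

definition sign_exponent :: "nat \<Rightarrow> nat \<Rightarrow> nat \<Rightarrow> nat" where
  "sign_exponent d n m = (if n \<noteq> m
     then totient (n div m) * (nat (dyn_degree d m) div m)
     else nat (dyn_degree d n) div n +
       (\<Sum>k | k dvd n \<and> k < n. totient (n div k) * (nat (dyn_degree d k) div k)))"

end

theory Submission
  imports Defs "Jordan_Normal_Form.Char_Poly"
begin

text \<open>
  Let \<open>t = d\<^sup>d c\<^bsup>d-1\<^esup>\<close>. For an \<open>m\<close>-cycle \<open>C\<close> of \<open>f z = z\<^sup>d + c\<close> let \<open>\<omega>\<^sub>C\<close> be its multiplier, and let \<open>res r m\<close>
  be the product of the values \<open>\<Phi>\<^sub>r(\<omega>\<^sub>C)\<close> of the \<open>r\<close>-th cyclotomic polynomial over all \<open>m\<close>-cycles.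
  Then \<open>\<delta>\<^sub>m = \<Prod>\<^sub>C (x - \<omega>\<^sub>C)\<close>, so up to a sign \<open>\<Delta>\<^bsub>n,m\<^esub>\<close> is \<open>res (n/m) m\<close>, and \<open>\<delta>\<^sub>n(1)\<close> is
  \<open>res 1 n\<close>. The signs make up the sign exponent, and two facts remain: \<open>res r m\<close> is a monic integer
  polynomial in \<open>t\<close>, and so is the quotient of \<open>res 1 n\<close> by \<open>\<Prod>\<^sub>k res (n/k) k\<close>, over the proper
  divisors \<open>k\<close> of \<open>n\<close>.

  Separability. A periodic point is integral over \<open>\<int>[c]\<close>, so a multiplier is a power of \<open>d\<close>
  times an integral element; it cannot be a root of unity, because \<open>1/d\<^sup>N\<close> is not integral over the
  integrally closed ring \<open>\<int>[c]\<close>. Hence \<open>f\<^sup>k(z) - z\<close> has simple roots, and the roots of the dynatomic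
  polynomial are exactly the points of exact period \<open>m\<close> (\<open>dynatomic_eq\<close>).

  Membership in \<open>\<int>[t]\<close> (\<open>prod_poly_mult_mem\<close>). In the coordinate \<open>y = z/(cd)\<close> the map becomes
  \<open>y \<mapsto> (t y\<^sup>d + 1)/d\<close>, which is defined over \<open>\<rat>(t)\<close>; by Newton's identities all symmetric functions of
  the multipliers of the \<open>m\<close>-cycles lie in \<open>\<rat>(t)\<close>. In the coordinate \<open>w = \<lambda>z\<close> with \<open>\<lambda>\<^bsup>d-1\<^esup> = d\<close> the
  dynamics reads \<open>d w' = w\<^sup>d + s\<close> with \<open>s\<^bsup>d-1\<^esup> = t\<close>, and \<open>\<omega>\<^sub>C\<close> is the product of \<open>w\<^bsup>d-1\<^esup>\<close> over \<open>C\<close>; so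
  \<open>\<omega>\<^sub>C\<close> is integral over \<open>\<int>[t]\<close>. As \<open>\<int>[t]\<close> is integrally closed, rational and integral give
  polynomial.

  Leading coefficient (\<open>prod_poly_mult_asymptotic\<close>). Let \<open>\<sigma>\<^sup>d = s\<close> and \<open>v = w/\<sigma>\<close>. Then
  \<open>v\<^sup>d = -1 + d \<sigma>\<^bsup>1-d\<^esup> v'\<close>, so the \<open>v\<close> are integral over \<open>\<int>[1/t]\<close>. Dividing \<open>\<Phi>\<^sub>r(\<omega>\<^sub>C)\<close> by a power of
  \<open>\<sigma>\<close> leaves a power of \<open>\<Prod> v\<^bsup>d-1\<^esup>\<close>, the product being over \<open>C\<close>, modulo \<open>1/\<sigma>\<close>. The product of
  \<open>v\<^bsup>d-1\<^esup>\<close> over all points of period \<open>m\<close> is \<open>1\<close> modulo \<open>1/\<sigma>\<close>, because the constant term of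
  \<open>f\<^sup>k(z) - z\<close> is \<open>f\<^sup>k(0)\<close>, which is monic in \<open>c\<close>.

  The primitive quotient (\<open>primitive_quotient_monic\<close>). For \<open>\<alpha>\<close> of period \<open>n\<close>, the number \<open>\<omega> - 1\<close> is
  the derivative of \<open>f\<^sup>n(z) - z\<close> at \<open>\<alpha>\<close>, so it is the product of \<open>\<alpha> - \<beta>\<close> over the other roots \<open>\<beta>\<close>.
  Roots of smaller period \<open>k\<close> contribute to \<open>R\<^sub>k = \<Prod> (\<alpha> - \<beta>)\<close>, over \<open>\<alpha>\<close> of period \<open>n\<close> and
  \<open>\<beta>\<close> of period \<open>k\<close>; the roots \<open>f\<^sup>i(\<alpha>)\<close> contribute further such factors, since \<open>f\<^sup>i(\<alpha>) - \<alpha>\<close> is the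
  product of \<open>\<alpha> - \<beta>\<close> over the fixed points \<open>\<beta>\<close> of \<open>f\<^sup>i\<close>. Altogether \<open>(res 1 n)\<^sup>n\<close> is divisible by
  \<open>\<Prod>\<^sub>k R\<^sub>k\<^bsup>n/k\<^esup>\<close>. Dynamical units show that \<open>R\<^sub>k\<close> is divisible by \<open>(res (n/k) k)\<^sup>k\<close>.
  So the \<open>n\<close>-th power of the quotient is integral over \<open>\<int>[c]\<close>, whence the quotient lies in \<open>\<int>[c]\<close>.
  As numerator and denominator are monic polynomials in \<open>t\<close>, division with remainder in \<open>\<int>[t]\<close> shows
  that the quotient is a monic polynomial in \<open>t\<close> as well.
\<close>

section \<open>Integral closure of a subring of a field\<close>

text \<open>
  Subrings are kept as sets inside one ambient commutative ring, because several of them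
  (\<open>\<int>[c]\<close>, \<open>\<int>[t]\<close>, \<open>\<int>[1/t]\<close>, their integral closures, \<open>\<rat>(c)\<close> and \<open>\<rat>(t)\<close>) are compared within one field.
\<close>
locale comm_subring =
  fixes R :: "'a :: comm_ring_1 set"
  assumes one_mem: "1 \<in> R"
    and diff_mem: "x \<in> R \<Longrightarrow> y \<in> R \<Longrightarrow> x - y \<in> R"
    and mult_mem: "x \<in> R \<Longrightarrow> y \<in> R \<Longrightarrow> x * y \<in> R"
begin

lemma zero_mem: "0 \<in> R"
  using diff_mem[OF one_mem one_mem] by simp

lemma uminus_mem: "x \<in> R \<Longrightarrow> - x \<in> R"
  using diff_mem[OF zero_mem, of x] by simp

lemma add_mem: "x \<in> R \<Longrightarrow> y \<in> R \<Longrightarrow> x + y \<in> R"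
  using diff_mem[of x "- y"] uminus_mem[of y] by simp

lemma sum_mem: "(\<And>i. i \<in> A \<Longrightarrow> f i \<in> R) \<Longrightarrow> sum f A \<in> R"
  by (induction A rule: infinite_finite_induct) (auto intro: zero_mem add_mem)

lemma prod_mem: "(\<And>i. i \<in> A \<Longrightarrow> f i \<in> R) \<Longrightarrow> prod f A \<in> R"
  by (induction A rule: infinite_finite_induct) (auto intro: one_mem mult_mem)

lemma power_mem: "x \<in> R \<Longrightarrow> x ^ n \<in> R"
  by (induction n) (auto intro: one_mem mult_mem)

lemma of_nat_mem: "of_nat n \<in> R"
  by (induction n) (auto intro: zero_mem one_mem add_mem)

lemma of_int_mem: "of_int n \<in> R"
  by (cases n) (auto intro: of_nat_mem uminus_mem simp del: of_nat_Suc)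

lemma poly_mem: "(\<And>i. coeff p i \<in> R) \<Longrightarrow> x \<in> R \<Longrightarrow> poly p x \<in> R"
  unfolding poly_altdef by (intro sum_mem mult_mem power_mem)

lemma coeff_mult_mem:
  "(\<And>i. coeff p i \<in> R) \<Longrightarrow> (\<And>i. coeff q i \<in> R) \<Longrightarrow> coeff (p * q) i \<in> R"
  unfolding coeff_mult by (intro sum_mem mult_mem)

lemma comm_subring_poly: "comm_subring {p. \<forall>i. coeff p i \<in> R}"
  by unfold_locales (auto intro: diff_mem coeff_mult_mem simp: coeff_1 one_mem zero_mem)

lemma coeff_prod_mem:
  assumes "\<And>x i. x \<in> A \<Longrightarrow> coeff (f x) i \<in> R"
  shows "coeff (\<Prod>x\<in>A. f x) i \<in> R"
  using comm_subring.prod_mem[OF comm_subring_poly, of A f] assms by blast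

lemma coeff_power_mem: "(\<And>i. coeff p i \<in> R) \<Longrightarrow> coeff (p ^ n) i \<in> R"
  using comm_subring.power_mem[OF comm_subring_poly, of p n] by blast

lemma det_mem:
  assumes "A \<in> carrier_mat n n" "\<And>i j. i < n \<Longrightarrow> j < n \<Longrightarrow> A $$ (i, j) \<in> R"
  shows "det A \<in> R"
  unfolding det_def'[OF assms(1)]
proof (intro sum_mem mult_mem prod_mem)
  fix p i assume "p \<in> {p. p permutes {0..<n}}" "i \<in> {0..<n}"
  thus "A $$ (i, p i) \<in> R" using permutes_in_image[of p "{0..<n}" i] by (intro assms(2)) auto
qed (auto simp: sign_def uminus_mem one_mem)

end

definition integral_over :: "'a :: field set \<Rightarrow> 'a set" where
  "integral_over R = {x. \<exists>p. lead_coeff p = 1 \<and> (\<forall>i. coeff p i \<in> R) \<and> poly p x = 0}"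

text \<open>
  The \<open>R\<close>-submodule spanned by \<open>B\<close>. Integrality is handled through finitely generated modules that
  multiplication by an element maps to themselves, since such modules combine easily.
\<close>
inductive_set module_span :: "'a :: field set \<Rightarrow> 'a set \<Rightarrow> 'a set" for R B where
  zero: "0 \<in> module_span R B"
| scaled: "r \<in> R \<Longrightarrow> b \<in> B \<Longrightarrow> r * b \<in> module_span R B"
| add: "x \<in> module_span R B \<Longrightarrow> y \<in> module_span R B \<Longrightarrow> x + y \<in> module_span R B"

definition stabilises :: "'a :: field set \<Rightarrow> 'a \<Rightarrow> 'a set \<Rightarrow> bool" where
  "stabilises R x B \<longleftrightarrow> (\<forall>b\<in>B. x * b \<in> module_span R B)"

context
  fixes R :: "'a :: field set"
  assumes R: "comm_subring R"
begin

interpretation comm_subring R by (fact R)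

lemma module_span_base: "b \<in> B \<Longrightarrow> b \<in> module_span R B"
  using module_span.scaled[OF one_mem, of b B] by simp

lemma module_span_scale: "x \<in> module_span R B \<Longrightarrow> r \<in> R \<Longrightarrow> r * x \<in> module_span R B"
proof (induction rule: module_span.induct)
  case (scaled s b)
  thus ?case using module_span.scaled[of "r * s" R b B] by (simp add: mult_mem mult.assoc)
qed (auto simp: distrib_left intro: module_span.intros)

lemma module_span_sum:
  "(\<And>i. i \<in> A \<Longrightarrow> f i \<in> module_span R B) \<Longrightarrow> sum f A \<in> module_span R B"
  by (induction A rule: infinite_finite_induct) (auto intro: module_span.intros)

lemma module_span_uminus: "x \<in> module_span R B \<Longrightarrow> - x \<in> module_span R B"
  using module_span_scale[of x B "- 1"] by (simp add: uminus_mem one_mem)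

lemma module_span_mult:
  assumes "x \<in> module_span R B" "\<And>b. b \<in> B \<Longrightarrow> y * b \<in> module_span R C"
  shows "y * x \<in> module_span R C"
  using assms(1)
proof (induction rule: module_span.induct)
  case (scaled r b)
  thus ?case using module_span_scale[OF assms(2)[of b], of r] by (simp add: mult.left_commute)
qed (auto simp: distrib_left intro: module_span.intros)

text \<open>
  For a finite spanning set one coordinate function per element suffices; the matrix of a
  multiplication map is built from these coordinates.
\<close>
lemma module_span_coordinates:
  assumes "finite B" "x \<in> module_span R B"
  shows "\<exists>r. (\<forall>b. r b \<in> R) \<and> x = (\<Sum>b\<in>B. r b * b)"
  using assms(2)
proof (induction rule: module_span.induct)
  case zero
  show ?case by (intro exI[of _ "\<lambda>_. 0"]) (auto intro: zero_mem)
next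
  case (scaled s b)
  show ?case
    by (intro exI[of _ "\<lambda>b'. if b' = b then s else 0"])
       (use scaled assms(1) in \<open>auto simp: zero_mem if_distribR if_distrib sum.delta cong: if_cong\<close>)
next
  case (add x y)
  then obtain r s where "\<forall>b. r b \<in> R" "x = (\<Sum>b\<in>B. r b * b)" "\<forall>b. s b \<in> R" "y = (\<Sum>b\<in>B. s b * b)"
    by blast
  thus ?case
    by (intro exI[of _ "\<lambda>b. r b + s b"]) (auto simp: add_mem distrib_right sum.distrib)
qed

lemma stabilises_span: "stabilises R x B \<Longrightarrow> y \<in> module_span R B \<Longrightarrow> x * y \<in> module_span R B"
  using module_span_mult[of y B x B] by (auto simp: stabilises_def)

lemma stabilises_diff:
  assumes "stabilises R x B" "stabilises R y B"
  shows "stabilises R (x - y) B"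
  using assms module_span.add[OF _ module_span_uminus]
  by (fastforce simp: stabilises_def left_diff_distrib)

lemma stabilises_mult:
  assumes "stabilises R x B" "stabilises R y B"
  shows "stabilises R (x * y) B"
  using assms stabilises_span by (auto simp: stabilises_def mult.assoc)

text \<open>
  The products of two spanning sets form a spanning set that inherits stability from either factor;
  this puts two integral elements into one stable module.
\<close>
lemma stabilises_product_set:
  assumes "stabilises R x B"
  shows "stabilises R x ((\<lambda>(b, c). b * c) ` (B \<times> C))"
  unfolding stabilises_def
proof safe
  fix b c assume bc: "b \<in> B" "c \<in> C"
  have "c * (x * b) \<in> module_span R ((\<lambda>(b, c). b * c) ` (B \<times> C))"
    by (rule module_span_mult[of _ B])
       (use assms bc in \<open>auto simp: stabilises_def mult.commute[of c] intro!: module_span_base\<close>)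
  thus "x * (b * c) \<in> module_span R ((\<lambda>(b, c). b * c) ` (B \<times> C))"
    by (simp add: ac_simps)
qed

lemma stabilises_product_set':
  assumes "stabilises R x C"
  shows "stabilises R x ((\<lambda>(b, c). b * c) ` (B \<times> C))"
proof -
  have "(\<lambda>(b, c). b * c) ` (B \<times> C) = (\<lambda>(b, c). b * c) ` (C \<times> B)"
    unfolding set_eq_iff image_iff Bex_def by (auto; metis mult.commute)
  thus ?thesis using stabilises_product_set[OF assms, of B] by simp
qed

text \<open>
  The Cayley--Hamilton argument: the elements of \<open>B\<close> form an eigenvector, with eigenvalue \<open>x\<close>, of the
  coordinate matrix of multiplication by \<open>x\<close>, so \<open>x\<close> is a root of its monic characteristic polynomial.
\<close>
lemma integral_over_if_stabilises:
  assumes fin: "finite B" and b0: "b0 \<in> B" "b0 \<noteq> 0" and x: "stabilises R x B"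
  shows "x \<in> integral_over R"
proof -
  define n where "n = card B"
  obtain e where e: "bij_betw e {..<n} B"
    using ex_bij_betw_nat_finite[OF fin] unfolding n_def atLeast0LessThan by blast
  have "\<forall>b\<in>B. \<exists>r. (\<forall>c. r c \<in> R) \<and> x * b = (\<Sum>c\<in>B. r c * c)"
    using x module_span_coordinates[OF fin] by (auto simp: stabilises_def)
  then obtain r where r: "\<And>b c. b \<in> B \<Longrightarrow> r b c \<in> R" "\<And>b. b \<in> B \<Longrightarrow> x * b = (\<Sum>c\<in>B. r b c * c)"
    by metis
  have eB: "e i \<in> B" if "i < n" for i using e that by (auto simp: bij_betw_def)
  define M where "M = mat n n (\<lambda>(i, j). r (e i) (e j))"
  define v where "v = vec n e"
  have M: "M \<in> carrier_mat n n" by (simp add: M_def)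
  have "x * e i = (\<Sum>j<n. r (e i) (e j) * e j)" if "i < n" for i
    using r(2)[OF eB[OF that]] sum.reindex_bij_betw[OF e, of "\<lambda>c. r (e i) c * c"] by simp
  hence "M *\<^sub>v v = x \<cdot>\<^sub>v v"
    by (intro eq_vecI) (auto simp: M_def v_def scalar_prod_def atLeast0LessThan)
  moreover have "v \<noteq> 0\<^sub>v n"
  proof -
    obtain i where "i < n" "e i = b0" using e b0(1) by (auto simp: bij_betw_def)
    thus ?thesis using b0(2) by (auto simp: v_def vec_eq_iff)
  qed
  ultimately have "eigenvector M v x" unfolding eigenvector_def by (simp add: M v_def M_def)
  hence "poly (char_poly M) x = 0"
    using eigenvalue_root_char_poly[OF M] by (auto simp: eigenvalue_def)
  moreover have "lead_coeff (char_poly M) = 1"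
    using degree_monic_char_poly[OF M] by simp
  moreover have "\<forall>i. coeff (char_poly M) i \<in> R"
  proof -
    interpret P: comm_subring "{p. \<forall>i. coeff p i \<in> R}" by (rule comm_subring_poly)
    have "char_poly M \<in> {p. \<forall>i. coeff p i \<in> R}"
      unfolding char_poly_defs
      by (rule P.det_mem[of _ n])
         (auto simp: M_def coeff_pCons eB r one_mem zero_mem uminus_mem split: nat.splits)
    thus ?thesis by simp
  qed
  ultimately show ?thesis unfolding integral_over_def by blast
qed

lemma monic_root_powers:
  fixes x :: 'a
  assumes "lead_coeff p = 1" "poly p x = 0"
  shows "degree p > 0" "x ^ degree p = - (\<Sum>i<degree p. coeff p i * x ^ i)"
proof -
  show "degree p > 0"
  proof (rule ccontr)
    assume "\<not> degree p > 0"
    hence "p = 1" using assms(1) by (metis degree_eq_zeroE gr0I lead_coeff_pCons(2) one_pCons)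
    thus False using assms(2) by simp
  qed
  show "x ^ degree p = - (\<Sum>i<degree p. coeff p i * x ^ i)"
    using assms unfolding poly_altdef
    by (simp add: lessThan_Suc_atMost[symmetric] eq_neg_iff_add_eq_0 add.commute)
qed

lemma subset_integral_over: "R \<subseteq> integral_over R"
proof
  fix x assume "x \<in> R"
  thus "x \<in> integral_over R" unfolding integral_over_def
    by (intro CollectI exI[of _ "[:- x, 1:]"])
       (auto simp: coeff_pCons one_mem zero_mem uminus_mem split: nat.splits)
qed

text \<open>
  The powers of \<open>x\<close> below the degree of a monic equation are stable under multiplication by \<open>x\<close>.
\<close>
lemma stabilises_if_integral_over:
  assumes "x \<in> integral_over R"
  shows "\<exists>B. finite B \<and> 1 \<in> B \<and> stabilises R x B"
proof -
  obtain p where p: "lead_coeff p = 1" "\<And>i. coeff p i \<in> R" "poly p x = 0"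
    using assms by (auto simp: integral_over_def)
  define B where "B = (\<lambda>i. x ^ i) ` {..<degree p}"
  have "x * x ^ i \<in> module_span R B" if "i < degree p" for i
  proof (cases "Suc i = degree p")
    case True
    have "x * x ^ i = - (\<Sum>i<degree p. coeff p i * x ^ i)"
      using monic_root_powers(2)[OF p(1,3)] True by (metis power_Suc)
    also have "\<dots> \<in> module_span R B"
      by (intro module_span_uminus module_span_sum module_span.scaled p) (auto simp: B_def)
    finally show ?thesis .
  next
    case False
    hence "Suc i \<in> {..<degree p}" using that by simp
    hence "x ^ Suc i \<in> B" unfolding B_def by (rule imageI)
    thus ?thesis using module_span_base by simp
  qed
  hence "stabilises R x B" by (auto simp: stabilises_def B_def)
  moreover have "x ^ 0 \<in> B" unfolding B_def
    using monic_root_powers(1)[OF p(1,3)] by blast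
  ultimately show ?thesis by (intro exI[of _ B]) (auto simp: B_def)
qed

lemma common_stable_set:
  assumes "finite A" "A \<subseteq> integral_over R"
  shows "\<exists>B. finite B \<and> 1 \<in> B \<and> (\<forall>a\<in>A. stabilises R a B)"
  using assms
proof (induction A rule: finite_induct)
  case empty
  show ?case by (intro exI[of _ "{1}"]) auto
next
  case (insert a A)
  obtain B where B: "finite B" "1 \<in> B" "\<forall>a\<in>A. stabilises R a B" using insert by auto
  obtain C where C: "finite C" "1 \<in> C" "stabilises R a C"
    using stabilises_if_integral_over insert by blast
  show ?case
  proof (intro exI conjI ballI)
    show "1 \<in> (\<lambda>(b, c). b * c) ` (B \<times> C)" using B C by force
  qed (use B C in \<open>auto intro: stabilises_product_set stabilises_product_set'\<close>)
qed

lemma comm_subring_integral_over: "comm_subring (integral_over R)"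
proof
  show "1 \<in> integral_over R" using subset_integral_over one_mem by blast
next
  fix x y assume "x \<in> integral_over R" "y \<in> integral_over R"
  then obtain B where B: "finite B" "1 \<in> B" "stabilises R x B" "stabilises R y B"
    using common_stable_set[of "{x, y}"] by auto
  show "x - y \<in> integral_over R" "x * y \<in> integral_over R"
    using integral_over_if_stabilises[OF B(1,2)] B(3,4) stabilises_diff stabilises_mult by auto
qed

text \<open>
  The integral closure is integrally closed: take a module that is stable under all coefficients and
  adjoin the powers of \<open>x\<close> to its generators.
\<close>
lemma integral_over_trans:
  assumes p: "lead_coeff p = 1" "\<And>i. coeff p i \<in> integral_over R" "poly p x = 0"
  shows "x \<in> integral_over R"
proof -
  obtain B where B: "finite B" "1 \<in> B" "\<And>i. i < degree p \<Longrightarrow> stabilises R (coeff p i) B"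
    using common_stable_set[of "coeff p ` {..<degree p}"] p(2) by auto
  define C where "C = (\<lambda>(b, i). b * x ^ i) ` (B \<times> {..<degree p})"
  have "x * (b * x ^ i) \<in> module_span R C" if b: "b \<in> B" and i: "i < degree p" for b i
  proof (cases "Suc i = degree p")
    case True
    have "x * (b * x ^ i) = b * x ^ degree p" unfolding True[symmetric] by simp
    also have "\<dots> = - (\<Sum>j<degree p. x ^ j * (coeff p j * b))"
      unfolding monic_root_powers(2)[OF p(1,3)] by (simp add: sum_distrib_left ac_simps)
    also have "\<dots> \<in> module_span R C"
    proof (intro module_span_uminus module_span_sum)
      fix j assume j: "j \<in> {..<degree p}"
      show "x ^ j * (coeff p j * b) \<in> module_span R C"
        by (rule module_span_mult[of _ B])
           (use B(3)[of j] j b in \<open>auto simp: stabilises_def C_def mult.commute[of "x ^ _"]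
              intro!: module_span_base\<close>)
    qed
    finally show ?thesis .
  next
    case False
    hence "(b, Suc i) \<in> B \<times> {..<degree p}" using i b by auto
    hence "b * x ^ Suc i \<in> C" unfolding C_def by force
    thus ?thesis using module_span_base by (simp add: ac_simps)
  qed
  hence "stabilises R x C" by (auto simp: stabilises_def C_def)
  moreover have "(1, 0) \<in> B \<times> {..<degree p}" using B monic_root_powers(1)[OF p(1,3)] by auto
  hence "1 * x ^ 0 \<in> C" unfolding C_def by force
  ultimately show ?thesis
    using B(1) by (intro integral_over_if_stabilises[of C 1]) (auto simp: C_def)
qed

lemma integral_over_root:
  assumes "x ^ n \<in> integral_over R" "n > 0"
  shows "x \<in> integral_over R"
proof (rule integral_over_trans)
  interpret I: comm_subring "integral_over R" by (rule comm_subring_integral_over)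
  have deg: "degree ([:0, 1:] ^ n - [:x ^ n:] :: 'a poly) = n"
  proof -
    have "degree ([:0, 1:] ^ n :: 'a poly) = n" by (simp add: degree_power_eq)
    thus ?thesis using assms(2)
      by (metis degree_pCons_0 degree_add_eq_left degree_minus diff_conv_add_uminus)
  qed
  have c: "coeff ([:0, 1:] ^ n - [:x ^ n:]) i = (if i = n then 1 else 0) - (if i = 0 then x ^ n else 0)" for i
    by (simp add: x_as_monom monom_power coeff_pCons split: nat.splits)
  show "lead_coeff ([:0, 1:] ^ n - [:x ^ n:]) = 1" unfolding deg c using assms(2) by simp
  show "coeff ([:0, 1:] ^ n - [:x ^ n:]) i \<in> integral_over R" for i
    unfolding c using assms by (auto intro: I.one_mem I.zero_mem I.uminus_mem I.diff_mem)
  show "poly ([:0, 1:] ^ n - [:x ^ n:]) x = 0" by (simp add: poly_power)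
qed

end

section \<open>Rings generated by a transcendental element\<close>

locale subfield_set = comm_subring F for F :: "'a :: field_char_0 set" +
  assumes inverse_mem: "x \<in> F \<Longrightarrow> inverse x \<in> F"
begin

lemma divide_mem: "x \<in> F \<Longrightarrow> y \<in> F \<Longrightarrow> x / y \<in> F"
  by (simp add: field_class.field_divide_inverse mult_mem inverse_mem)

end

definition int_adj :: "'a :: comm_ring_1 \<Rightarrow> 'a set" where
  "int_adj x = range (\<lambda>p. poly (of_int_poly p) x)"

definition frac_adj :: "'a :: field \<Rightarrow> 'a set" where
  "frac_adj x = {a / b |a b. a \<in> int_adj x \<and> b \<in> int_adj x}"

definition int_transcendental :: "'a :: comm_ring_1 \<Rightarrow> bool" where
  "int_transcendental x \<longleftrightarrow> (\<forall>p. p \<noteq> 0 \<longrightarrow> poly (of_int_poly p) x \<noteq> 0)"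

lemma comm_subring_int_adj: "comm_subring (int_adj x)"
proof
  show "1 \<in> int_adj x" unfolding int_adj_def by (rule range_eqI[of _ _ 1]) simp
  fix y z assume "y \<in> int_adj x" "z \<in> int_adj x"
  then obtain p q where pq: "y = poly (of_int_poly p) x" "z = poly (of_int_poly q) x"
    by (auto simp: int_adj_def)
  show "y - z \<in> int_adj x" unfolding int_adj_def pq
    by (rule range_eqI[of _ _ "p - q"]) (simp add: of_int_poly_hom.hom_minus)
  show "y * z \<in> int_adj x" unfolding int_adj_def pq
    by (rule range_eqI[of _ _ "p * q"]) (simp add: of_int_poly_hom.hom_mult)
qed

lemma int_adj_self: "x \<in> int_adj x"
  unfolding int_adj_def by (rule range_eqI[of _ _ "[:0, 1:]"]) simp

lemma int_adj_subset:
  assumes "comm_subring R" "x \<in> R"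
  shows "int_adj x \<subseteq> R"
proof -
  interpret comm_subring R by fact
  show ?thesis using assms(2) by (auto simp: int_adj_def intro!: poly_mem of_int_mem)
qed

lemma int_adj_subset_frac_adj: "int_adj x \<subseteq> frac_adj x"
proof
  fix y assume "y \<in> int_adj x"
  moreover have "1 \<in> int_adj x" by (rule comm_subring.one_mem[OF comm_subring_int_adj])
  ultimately show "y \<in> frac_adj x" unfolding frac_adj_def using div_by_1[of y] by force
qed

lemma subfield_set_frac_adj: "subfield_set (frac_adj (x :: 'a :: field_char_0))"
proof -
  interpret Z: comm_subring "int_adj x" by (rule comm_subring_int_adj)
  show ?thesis
  proof
    show "1 \<in> frac_adj x" using int_adj_subset_frac_adj Z.one_mem by blast
  next
    fix y z assume "y \<in> frac_adj x" "z \<in> frac_adj x"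
    then obtain a b c d where yz: "y = a / b" "z = c / d"
      and m: "a \<in> int_adj x" "b \<in> int_adj x" "c \<in> int_adj x" "d \<in> int_adj x"
      by (auto simp: frac_adj_def)
    have "y - z = (if b = 0 then (- c) / d else if d = 0 then a / b else (a * d - c * b) / (b * d))"
      by (auto simp: yz field_simps)
    also have "\<dots> \<in> frac_adj x" using m unfolding frac_adj_def mem_Collect_eq
      by (metis Z.uminus_mem Z.diff_mem Z.mult_mem)
    finally show "y - z \<in> frac_adj x" .
    have "y * z = (a * c) / (b * d)" by (simp add: yz)
    thus "y * z \<in> frac_adj x" using m unfolding frac_adj_def
      by (auto intro: Z.mult_mem)
  next
    fix y assume "y \<in> frac_adj x"
    then obtain a b where yz: "y = a / b" and m: "a \<in> int_adj x" "b \<in> int_adj x"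
      by (auto simp: frac_adj_def)
    have "inverse y = b / a" by (simp add: yz)
    thus "inverse y \<in> frac_adj x" using m unfolding frac_adj_def by auto
  qed
qed

text \<open>
  The ring \<open>\<int>[x]\<close> is isomorphic to the factorial ring of integer polynomials, so the proof of the
  rational root theorem applies: the reduced denominator divides a power of the numerator, hence is a
  unit.
\<close>
lemma int_adj_integrally_closed:
  fixes x :: "'a :: field_char_0"
  assumes x: "int_transcendental x" and y: "y \<in> frac_adj x" "y \<in> integral_over (int_adj x)"
  shows "y \<in> int_adj x"
proof (cases "y = 0")
  case True
  thus ?thesis using comm_subring.zero_mem[OF comm_subring_int_adj] by auto
next
  case False
  let ?ev = "\<lambda>p. poly (of_int_poly p) x"
  obtain a b where ab: "y = ?ev a / ?ev b"
    using y(1) by (auto simp: frac_adj_def int_adj_def)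
  hence b0: "?ev b \<noteq> 0" using False by auto
  \<comment> \<open>Reduce the fraction in the factorial ring of integer polynomials.\<close>
  obtain p q where pq: "a = p * gcd a b" "b = q * gcd a b" "coprime p q"
    using gcd_coprime_exists[of a b] b0 by fastforce
  have ev_gcd: "?ev (gcd a b) \<noteq> 0" and q0: "?ev q \<noteq> 0"
    using b0 by (subst (asm) pq(2), simp add: of_int_poly_hom.hom_mult)+
  have y_eq: "y = ?ev p / ?ev q"
  proof -
    have "?ev a = ?ev p * ?ev (gcd a b)" "?ev b = ?ev q * ?ev (gcd a b)"
      using pq(1,2) by (metis of_int_poly_hom.hom_mult poly_mult)+
    thus ?thesis using ab ev_gcd by simp
  qed
  obtain r where r: "lead_coeff r = 1" "\<And>i. coeff r i \<in> int_adj x" "poly r y = 0"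
    using y(2) by (auto simp: integral_over_def)
  define n where "n = degree r"
  have "\<forall>i. \<exists>c. coeff r i = ?ev c" using r(2) by (auto simp: int_adj_def)
  then obtain c where c: "\<And>i. coeff r i = ?ev (c i)" by metis
  \<comment> \<open>Clearing denominators in the monic equation for \<open>y\<close>.\<close>
  have "?ev (p ^ n + (\<Sum>i<n. c i * p ^ i * q ^ (n - i)))
      = ?ev q ^ n * (y ^ n + (\<Sum>i<n. ?ev (c i) * y ^ i))"
  proof -
    have "?ev (c i * p ^ i * q ^ (n - i)) = ?ev q ^ n * (?ev (c i) * y ^ i)" if "i < n" for i
    proof -
      have "?ev q ^ n * (?ev (c i) * y ^ i) = ?ev (c i) * (?ev q ^ i * y ^ i) * ?ev q ^ (n - i)"
        using that power_add[of "?ev q" i "n - i"] by simp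
      also have "?ev q ^ i * y ^ i = ?ev p ^ i"
        using q0 by (simp add: y_eq flip: power_mult_distrib)
      finally show ?thesis
        by (simp only: of_int_poly_hom.hom_mult of_int_poly_hom.hom_power poly_power poly_mult)
    qed
    moreover have "?ev (p ^ n) = ?ev q ^ n * y ^ n"
      using q0 by (simp add: y_eq power_divide of_int_poly_hom.hom_power poly_power)
    ultimately show ?thesis
      by (simp add: of_int_poly_hom.hom_add of_int_poly_hom.hom_sum poly_sum distrib_left sum_distrib_left)
  qed
  also have "y ^ n + (\<Sum>i<n. ?ev (c i) * y ^ i) = poly r y"
    using r(1) unfolding poly_altdef[of r y] n_def[symmetric] c[symmetric]
    by (simp add: lessThan_Suc_atMost[symmetric])
  finally have "?ev (p ^ n + (\<Sum>i<n. c i * p ^ i * q ^ (n - i))) = 0" using r(3) by simp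
  hence "p ^ n + (\<Sum>i<n. c i * p ^ i * q ^ (n - i)) = 0"
    using x unfolding int_transcendental_def by blast
  hence "p ^ n = - (\<Sum>i<n. c i * p ^ i * q ^ (n - i))" by (simp only: eq_neg_iff_add_eq_0)
  moreover have "q dvd (\<Sum>i<n. c i * p ^ i * q ^ (n - i))"
    by (intro dvd_sum dvd_mult) (auto intro!: dvd_power)
  ultimately have "q dvd p ^ n" by (simp only: dvd_minus_iff)
  moreover have "coprime q (p ^ n)" using pq(3) by (simp add: coprime_commute)
  ultimately have "is_unit q" using coprime_absorb_left by blast
  then obtain u where "q * u = 1" by (metis dvdE)
  hence "?ev q * ?ev u = 1" by (metis of_int_poly_hom.hom_mult of_int_poly_hom.hom_one poly_1 poly_mult)
  hence "y = ?ev (p * u)" using q0 by (simp add: y_eq field_simps of_int_poly_hom.hom_mult)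
  thus ?thesis by (auto simp: int_adj_def)
qed

section \<open>Newton's identities and rationality of symmetric functions\<close>

text \<open>
  The logarithmic derivative of \<open>\<Prod> (1 - g\<^sub>a X)\<close> is minus the generating series of the power sums.
\<close>
lemma newton_identity_fps:
  fixes g :: "'b \<Rightarrow> 'a :: field_char_0"
  assumes "finite A"
  shows "fps_deriv (\<Prod>a\<in>A. 1 - fps_const (g a) * fps_X) =
         - (\<Prod>a\<in>A. 1 - fps_const (g a) * fps_X) * Abs_fps (\<lambda>n. \<Sum>a\<in>A. g a ^ Suc n)"
  using assms
proof (induction A rule: finite_induct)
  case (insert a A)
  define Q where "Q = (\<Prod>a\<in>A. 1 - fps_const (g a) * fps_X)"
  define S where "S = Abs_fps (\<lambda>n. \<Sum>a\<in>A. g a ^ Suc n)"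
  define E where "E = Abs_fps (\<lambda>n. g a ^ Suc n)"
  let ?L = "1 - fps_const (g a) * fps_X"
  have IH: "fps_deriv Q = - Q * S" using insert.IH by (simp add: Q_def S_def)
  have E: "?L * E = fps_const (g a)"
  proof (rule fps_ext)
    fix n show "fps_nth (?L * E) n = fps_nth (fps_const (g a)) n"
      by (cases n) (simp_all add: left_diff_distrib mult.assoc E_def)
  qed
  have "fps_deriv (?L * Q) = ?L * (- Q * S) - fps_const (g a) * Q"
    unfolding fps_deriv_mult IH by (simp flip: fps_const_neg)
  also have "fps_const (g a) * Q = (?L * E) * Q" by (simp only: E)
  also have "\<dots> = ?L * Q * E" by (simp only: ac_simps)
  also have "?L * (- Q * S) - ?L * Q * E = - (?L * Q) * (E + S)"
    by (simp add: algebra_simps)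
  also have "E + S = Abs_fps (\<lambda>n. \<Sum>a\<in>insert a A. g a ^ Suc n)"
    using insert.hyps by (intro fps_ext) (simp add: E_def S_def)
  finally show ?case using insert.hyps by (simp add: Q_def)
qed (simp add: fps_eq_iff)

lemma newton_identity:
  fixes g :: "'b \<Rightarrow> 'a :: field_char_0"
  assumes "finite A"
  defines "Q \<equiv> \<lambda>k. fps_nth (\<Prod>a\<in>A. 1 - fps_const (g a) * fps_X) k"
  shows "of_nat (Suc k) * Q (Suc k) = - (\<Sum>i\<le>k. Q i * (\<Sum>a\<in>A. g a ^ Suc (k - i)))"
proof -
  have "fps_nth (fps_deriv (\<Prod>a\<in>A. 1 - fps_const (g a) * fps_X)) k =
        fps_nth (- (\<Prod>a\<in>A. 1 - fps_const (g a) * fps_X) * Abs_fps (\<lambda>n. \<Sum>a\<in>A. g a ^ Suc n)) k"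
    by (simp only: newton_identity_fps[OF assms(1)])
  also have "\<dots> = - (\<Sum>i\<le>k. Q i * (\<Sum>a\<in>A. g a ^ Suc (k - i)))"
    unfolding mult_minus_left fps_neg_nth fps_mult_nth atLeast0AtMost Q_def fps_nth_Abs_fps ..
  finally show ?thesis unfolding Q_def fps_deriv_nth by (simp only: Suc_eq_plus1)
qed

lemma prod_fps_linear_nth:
  fixes g :: "'b \<Rightarrow> 'a :: field_char_0"
  assumes "finite A"
  shows "fps_nth (\<Prod>a\<in>A. 1 - fps_const (g a) * fps_X) k =
         (if k > card A then 0 else coeff (\<Prod>a\<in>A. [:- g a, 1:]) (card A - k))"
proof -
  have deg: "degree (\<Prod>a\<in>A. [:- g a, 1:]) = card A"
    by (subst degree_prod_eq_sum_degree) auto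
  have "(\<Prod>a\<in>A. 1 - fps_const (g a) * fps_X) = fps_of_poly (\<Prod>a\<in>A. reflect_poly [:- g a, 1:])"
    unfolding fps_of_poly_prod
    by (intro prod.cong) (auto simp: fps_of_poly_pCons reflect_poly_def)
  also have "\<dots> = fps_of_poly (reflect_poly (\<Prod>a\<in>A. [:- g a, 1:]))"
    by (simp add: reflect_poly_prod)
  finally show ?thesis by (simp add: coeff_reflect_poly deg)
qed

lemma coeff_prod_linear_card: "coeff (\<Prod>a\<in>A. [:- g a, 1 :: 'a :: idom:]) (card A) = 1"
proof -
  have "degree (\<Prod>a\<in>A. [:- g a, 1:]) = card A"
    by (subst degree_prod_eq_sum_degree) auto
  moreover have "lead_coeff (\<Prod>a\<in>A. [:- g a, 1:]) = 1" by (simp add: lead_coeff_prod)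
  ultimately show ?thesis by simp
qed

context subfield_set
begin

text \<open>
  Newton's identities express power sums through elementary symmetric functions. Working with power
  sums has the advantage that they are additive over unions of index sets, and that they transform
  linearly when a polynomial is applied to the roots.
\<close>
lemma power_sums_mem:
  assumes "finite A" "\<And>i. coeff (\<Prod>a\<in>A. [:- g a, 1:]) i \<in> F"
  shows "(\<Sum>a\<in>A. g a ^ k) \<in> F"
proof (induction k rule: less_induct)
  case (less k)
  define Q where "Q = (\<lambda>k. fps_nth (\<Prod>a\<in>A. 1 - fps_const (g a) * fps_X) k)"
  have Q: "Q k \<in> F" for k
    using assms(2) unfolding Q_def prod_fps_linear_nth[OF assms(1)] by (auto simp: zero_mem)
  have Q0: "Q 0 = 1" by (simp add: Q_def prod_fps_linear_nth[OF assms(1)] coeff_prod_linear_card)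
  show ?case
  proof (cases k)
    case 0
    thus ?thesis by (simp add: of_nat_mem)
  next
    case (Suc l)
    have "of_nat (Suc l) * Q (Suc l) = - (\<Sum>i\<le>l. Q i * (\<Sum>a\<in>A. g a ^ Suc (l - i)))"
      unfolding Q_def by (rule newton_identity[OF assms(1)])
    also have "\<dots> = - ((\<Sum>a\<in>A. g a ^ Suc l) + (\<Sum>i\<in>{1..l}. Q i * (\<Sum>a\<in>A. g a ^ Suc (l - i))))"
    proof -
      have "{..l} = insert 0 {1..l}" by auto
      thus ?thesis by (simp add: Q0)
    qed
    finally have *: "of_nat (Suc l) * Q (Suc l) =
      - ((\<Sum>a\<in>A. g a ^ Suc l) + (\<Sum>i\<in>{1..l}. Q i * (\<Sum>a\<in>A. g a ^ Suc (l - i))))" .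
    have "(\<Sum>a\<in>A. g a ^ Suc l) =
        - (of_nat (Suc l) * Q (Suc l)) - (\<Sum>i\<in>{1..l}. Q i * (\<Sum>a\<in>A. g a ^ Suc (l - i)))"
      unfolding * by simp
    also have "\<dots> \<in> F"
      by (intro diff_mem uminus_mem mult_mem sum_mem of_nat_mem Q less.IH) (auto simp: Suc)
    finally show ?thesis by (simp add: Suc)
  qed
qed

text \<open>
  The converse direction needs division by \<open>k + 1\<close>, hence a field of characteristic zero.
\<close>
lemma coeff_prod_linear_mem:
  assumes "finite A" "\<And>k. (\<Sum>a\<in>A. g a ^ k) \<in> F"
  shows "coeff (\<Prod>a\<in>A. [:- g a, 1:]) i \<in> F"
proof -
  define Q where "Q = (\<lambda>k. fps_nth (\<Prod>a\<in>A. 1 - fps_const (g a) * fps_X) k)"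
  have Q: "Q k \<in> F" for k
  proof (induction k rule: less_induct)
    case (less k)
    show ?case
    proof (cases k)
      case 0
      thus ?thesis by (simp add: Q_def prod_fps_linear_nth[OF assms(1)] coeff_prod_linear_card one_mem)
    next
      case (Suc l)
      have "of_nat (Suc l) * Q (Suc l) = - (\<Sum>i\<le>l. Q i * (\<Sum>a\<in>A. g a ^ Suc (l - i)))"
        unfolding Q_def by (rule newton_identity[OF assms(1)])
      hence "Q k = - (\<Sum>i\<le>l. Q i * (\<Sum>a\<in>A. g a ^ Suc (l - i))) / of_nat (Suc l)"
        unfolding Suc by (simp add: field_simps del: of_nat_Suc)
      also have "\<dots> \<in> F"
        by (intro divide_mem uminus_mem sum_mem mult_mem assms of_nat_mem less.IH) (auto simp: Suc)
      finally show ?thesis .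
    qed
  qed
  have deg: "degree (\<Prod>a\<in>A. [:- g a, 1:]) = card A"
    by (subst degree_prod_eq_sum_degree) auto
  show ?thesis
  proof (cases "i \<le> card A")
    case True
    hence "Q (card A - i) = coeff (\<Prod>a\<in>A. [:- g a, 1:]) i"
      unfolding Q_def prod_fps_linear_nth[OF assms(1)] by simp
    thus ?thesis using Q[of "card A - i"] by simp
  next
    case False
    thus ?thesis by (simp add: coeff_eq_0 deg zero_mem)
  qed
qed

lemma prod_mem_if_power_sums_mem:
  assumes "finite A" "\<And>k. (\<Sum>a\<in>A. g a ^ k) \<in> F"
  shows "(\<Prod>a\<in>A. g a) \<in> F"
proof -
  have "coeff (\<Prod>a\<in>A. [:- g a, 1:]) 0 = (- 1) ^ card A * (\<Prod>a\<in>A. g a)"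
    by (simp add: poly_prod prod_uminus flip: poly_0_coeff_0)
  hence "(\<Prod>a\<in>A. g a) = (- 1) ^ card A * coeff (\<Prod>a\<in>A. [:- g a, 1:]) 0"
    by (simp flip: power_mult_distrib mult.assoc)
  thus ?thesis using coeff_prod_linear_mem[OF assms, of 0]
    by (simp add: mult_mem power_mem uminus_mem one_mem)
qed

lemma power_sums_poly_mem:
  assumes "\<And>k. (\<Sum>a\<in>A. g a ^ k) \<in> F" "\<And>i. coeff p i \<in> F"
  shows "(\<Sum>a\<in>A. poly p (g a) ^ k) \<in> F"
proof -
  have "(\<Sum>a\<in>A. poly p (g a) ^ k) = (\<Sum>a\<in>A. \<Sum>i\<le>degree (p ^ k). coeff (p ^ k) i * g a ^ i)"
    by (simp flip: poly_power poly_altdef)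
  also have "\<dots> = (\<Sum>i\<le>degree (p ^ k). coeff (p ^ k) i * (\<Sum>a\<in>A. g a ^ i))"
    by (subst sum.swap) (simp add: sum_distrib_left)
  also have "\<dots> \<in> F" by (intro sum_mem mult_mem assms coeff_power_mem)
  finally show ?thesis .
qed

end

section \<open>Polynomials with prescribed roots\<close>

lemma monic_division:
  fixes p g :: "'a :: idom poly"
  assumes "lead_coeff g = 1"
  shows "\<exists>q r. p = g * q + r \<and> (r = 0 \<or> degree r < degree g)"
proof -
  have "g \<noteq> 0" using assms by auto
  obtain q r where qr: "pseudo_divmod p g = (q, r)" by force
  show ?thesis using pseudo_divmod[OF \<open>g \<noteq> 0\<close> qr] assms by auto
qed

lemma monic_eq_prod_roots:
  fixes p :: "'a :: idom poly"
  assumes "finite A" "lead_coeff p = 1" "card A = degree p" "\<And>a. a \<in> A \<Longrightarrow> poly p a = 0"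
  shows "p = (\<Prod>a\<in>A. [:- a, 1:])"
proof (rule poly_eqI_degree_lead_coeff[of _ "card A" _ A])
  show "coeff p (card A) = coeff (\<Prod>a\<in>A. [:- a, 1:]) (card A)"
    using coeff_prod_linear_card[of "\<lambda>a. a" A] assms by simp
  have "degree (\<Prod>a\<in>A. [:- a, 1:]) = card A"
    by (subst degree_prod_eq_sum_degree) auto
  thus "degree (\<Prod>a\<in>A. [:- a, 1:]) \<le> card A" by simp
next
  fix z assume "z \<in> A"
  hence "poly (\<Prod>a\<in>A. [:- a, 1:]) z = 0"
    using assms(1) unfolding poly_prod by (intro prod_zero) auto
  thus "poly p z = poly (\<Prod>a\<in>A. [:- a, 1:]) z" using assms \<open>z \<in> A\<close> by simp
qed (use assms in auto)

section \<open>Moebius inversion\<close>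

lemma moebius_mult_prime:
  assumes p: "normalization_semidom_class.prime p" and k: "squarefree k" "\<not> p dvd k"
  shows "moebius (p * k) = - moebius k"
proof -
  have k0: "k > 0" using k by (intro Nat.gr0I) auto
  have "coprime p k" using p k by (simp add: prime_imp_coprime)
  hence "squarefree (p * k)" using p k by (simp add: squarefree_mult_coprime squarefree_prime)
  moreover have "prime_factors (p * k) = insert p (prime_factors k)"
    using p k0 by (subst prime_factors_product) (auto simp: prime_prime_factors)
  moreover have "p \<notin> prime_factors k" using k by auto
  ultimately show ?thesis using k by (simp add: moebius_def)
qed

text \<open>
  Multiplication by a prime pairs the squarefree divisors not divisible by it with those that are, and
  reverses the sign; the sum over all divisors therefore cancels.
\<close>
lemma sum_moebius_divisors:
  assumes "n > 0"
  shows "(\<Sum>k | k dvd n. moebius k) = (if n = 1 then 1 else 0)"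
proof (cases "n = 1")
  case True
  have "{k. k dvd n} = {1}" using True by auto
  thus ?thesis by (simp add: True moebius_def)
next
  case False
  then obtain p where p: "normalization_semidom_class.prime p" "p dvd n" using prime_factor_nat by blast
  define S where "S = {k. k dvd n \<and> squarefree k}"
  have fin: "finite {k. k dvd n}" using assms by (rule finite_divisors_nat)
  hence finS: "finite S" unfolding S_def by (rule finite_subset[rotated]) auto
  have "(\<Sum>k | k dvd n. moebius k) = (\<Sum>k\<in>S. moebius k)"
    using fin by (intro sum.mono_neutral_right) (auto simp: S_def moebius_def)
  also have "\<dots> = (\<Sum>k\<in>{k\<in>S. p dvd k} \<union> {k\<in>S. \<not> p dvd k}. moebius k)"
    by (intro sum.cong) auto
  also have "\<dots> = (\<Sum>k\<in>{k\<in>S. p dvd k}. moebius k) + (\<Sum>k\<in>{k\<in>S. \<not> p dvd k}. moebius k)"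
    using finS by (intro sum.union_disjoint) auto
  also have "(\<Sum>k\<in>{k\<in>S. p dvd k}. moebius k) = (\<Sum>k\<in>{k\<in>S. \<not> p dvd k}. moebius (p * k))"
  proof (rule sum.reindex_bij_witness[of _ "\<lambda>k. p * k" "\<lambda>k. k div p"])
    fix k assume k: "k \<in> {k \<in> S. p dvd k}"
    then obtain l where l: "k = p * l" by auto
    have "\<not> p dvd l"
    proof
      assume "p dvd l"
      hence "p\<^sup>2 dvd k" by (auto simp: l power2_eq_square)
      thus False using k p(1) unfolding S_def squarefree_def by (metis (mono_tags, lifting) mem_Collect_eq not_prime_unit)
    qed
    thus "k div p \<in> {k \<in> S. \<not> p dvd k}"
      using k p(1) unfolding S_def l by (auto dest: squarefree_multD dvd_mult_right prime_gt_0_nat)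
  next
    fix k assume k: "k \<in> {k \<in> S. \<not> p dvd k}"
    hence cop: "coprime p k" using p(1) by (simp add: prime_imp_coprime)
    show "p * k \<in> {k \<in> S. p dvd k}"
      using k cop p unfolding S_def
      by (auto simp: squarefree_mult_coprime squarefree_prime intro: divides_mult)
  qed (use p(1) in auto)
  also have "\<dots> = (\<Sum>k\<in>{k\<in>S. \<not> p dvd k}. - moebius k)"
    using p(1) by (intro sum.cong) (auto simp: S_def moebius_mult_prime)
  finally show ?thesis using False by (simp add: sum_negf)
qed

lemma sum_moebius_between:
  assumes "m > 0" "j dvd m"
  shows "(\<Sum>k | j dvd k \<and> k dvd m. moebius (m div k)) = (if j = m then 1 else 0)"
proof -
  obtain l where l: "m = j * l" using assms by blast
  have pos: "j > 0" "l > 0" using assms l by auto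
  have "(\<Sum>k | j dvd k \<and> k dvd m. moebius (m div k)) = (\<Sum>k | k dvd l. moebius k)"
    by (rule sum.reindex_bij_witness[of _ "\<lambda>k. m div k" "\<lambda>k. m div k"])
       (use pos in \<open>auto simp: l elim!: dvdE\<close>)
  also have "\<dots> = (if j = m then 1 else 0)"
    using sum_moebius_divisors[OF pos(2)] pos by (auto simp: l)
  finally show ?thesis .
qed

lemma sum_moebius_inversion:
  fixes a b :: "nat \<Rightarrow> int"
  assumes "m > 0" "\<And>k. k dvd m \<Longrightarrow> b k = (\<Sum>j | j dvd k. a j)"
  shows "(\<Sum>k | k dvd m. b k * moebius (m div k)) = a m"
proof -
  have fin: "finite {k. k dvd m}" using assms(1) by (rule finite_divisors_nat)
  have "(\<Sum>k | k dvd m. b k * moebius (m div k))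
      = (\<Sum>k | k dvd m. \<Sum>j | j dvd m \<and> j dvd k. a j * moebius (m div k))"
    using assms(2) by (intro sum.cong) (auto simp: sum_distrib_right intro!: sum.cong dest: dvd_trans)
  also have "\<dots> = (\<Sum>j | j dvd m. \<Sum>k | k dvd m \<and> j dvd k. a j * moebius (m div k))"
    using sum.swap_restrict[OF fin fin, of "\<lambda>k j. a j * moebius (m div k)" "\<lambda>k j. j dvd k"] by simp
  also have "\<dots> = (\<Sum>j | j dvd m. a j * (if j = m then 1 else 0))"
    using sum_moebius_between[OF assms(1)]
    by (intro sum.cong) (auto simp: conj_commute simp flip: sum_distrib_left)
  also have "\<dots> = a m" using fin by (simp add: if_distrib sum.delta cong: if_cong)
  finally show ?thesis .
qed

text \<open>
  The multiplicative form, with integer exponents, as in the definition of the dynatomic polynomial.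
\<close>
lemma prod_moebius_inversion:
  fixes a b :: "nat \<Rightarrow> 'a :: field"
  assumes "m > 0" "\<And>k. k dvd m \<Longrightarrow> b k = (\<Prod>j | j dvd k. a j)" "\<And>k. k dvd m \<Longrightarrow> a k \<noteq> 0"
  shows "(\<Prod>k | k dvd m. b k powi moebius (m div k)) = a m"
proof -
  have fin: "finite {k. k dvd m}" using assms(1) by (rule finite_divisors_nat)
  have powi_prod: "prod f A powi i = (\<Prod>x\<in>A. f x powi i)" for f :: "nat \<Rightarrow> 'a" and A i
    by (induction A rule: infinite_finite_induct) (auto simp: power_int_mult_distrib)
  have powi_sum: "(\<Prod>x\<in>A. c powi h x) = c powi (\<Sum>x\<in>A. h x)" if "c \<noteq> 0"
    for c :: 'a and A :: "nat set" and h
    using that by (induction A rule: infinite_finite_induct) (auto simp: power_int_add)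
  have "(\<Prod>k | k dvd m. b k powi moebius (m div k))
      = (\<Prod>k | k dvd m. \<Prod>j | j dvd m \<and> j dvd k. a j powi moebius (m div k))"
    using assms(2) by (intro prod.cong) (auto simp: powi_prod intro!: prod.cong dest: dvd_trans)
  also have "\<dots> = (\<Prod>j | j dvd m. \<Prod>k | k dvd m \<and> j dvd k. a j powi moebius (m div k))"
    using prod.swap_restrict[OF fin fin, of "\<lambda>k j. a j powi moebius (m div k)" "\<lambda>k j. j dvd k"] by simp
  also have "\<dots> = (\<Prod>j | j dvd m. a j powi (if j = m then 1 else 0))"
    using sum_moebius_between[OF assms(1)] assms(3)
    by (intro prod.cong) (auto simp: conj_commute powi_sum)
  also have "\<dots> = a m" using fin by (simp add: if_distrib prod.delta cong: if_cong)
  finally show ?thesis .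
qed

section \<open>Cyclotomic polynomials\<close>

lemma of_int_poly_inject:
  "of_int_poly p = (of_int_poly q :: 'a :: ring_char_0 poly) \<Longrightarrow> p = q"
  by (rule poly_eqI) (metis coeff_map_poly of_int_0 of_int_eq_iff)

definition complex_cyclotomic :: "nat \<Rightarrow> complex poly" where
  "complex_cyclotomic i = (\<Prod>k\<in>totatives i. [:- cis (2 * pi * real k / real i), 1:])"

lemma monic_x_pow_minus_1:
  assumes "n > 0"
  shows "degree ([:0, 1:] ^ n - 1 :: 'a :: idom poly) = n" "lead_coeff ([:0, 1:] ^ n - 1 :: 'a poly) = 1"
proof -
  have c: "coeff ([:0, 1:] ^ n :: 'a poly) i = (if i = n then 1 else 0)" for i
    by (simp add: x_as_monom monom_power)
  show deg: "degree ([:0, 1:] ^ n - 1 :: 'a poly) = n"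
    using assms by (intro antisym degree_le le_degree) (auto simp: c coeff_1)
  show "lead_coeff ([:0, 1:] ^ n - 1 :: 'a poly) = 1"
    unfolding deg using assms by (simp add: c coeff_1)
qed

text \<open>
  Each \<open>n\<close>-th root of unity is a primitive \<open>l\<close>-th root of unity for exactly one \<open>l\<close>, found by cancelling
  \<open>gcd k n\<close> in the fraction \<open>k/n\<close>.
\<close>
lemma prod_complex_cyclotomic:
  assumes "n > 0"
  shows "(\<Prod>l | l dvd n. complex_cyclotomic l) = [:0, 1:] ^ n - 1"
proof -
  define h where "h = (\<lambda>k. cis (2 * pi * real k / real n))"
  have fin: "finite {l. l dvd n}" using assms by (rule finite_divisors_nat)
  have bij: "bij_betw h {..<n} {z. z ^ n = 1}"
    unfolding h_def using Complex.bij_betw_roots_unity[OF assms] .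
  have "[:0, 1:] ^ n - 1 = (\<Prod>a\<in>{z. z ^ n = 1}. [:- a, 1 :: complex:])"
  proof (rule monic_eq_prod_roots)
    show "finite {z :: complex. z ^ n = 1}" using bij bij_betw_finite by blast
    show "card {z :: complex. z ^ n = 1} = degree ([:0, 1:] ^ n - 1 :: complex poly)"
      using bij_betw_same_card[OF bij] monic_x_pow_minus_1(1)[OF assms, where 'a = complex] by simp
  qed (use monic_x_pow_minus_1[OF assms] in \<open>auto simp: poly_power\<close>)
  also have "\<dots> = (\<Prod>k<n. [:- h k, 1:])"
    using prod.reindex_bij_betw[OF bij, of "\<lambda>a. [:- a, 1:]"] by simp
  also have "\<dots> = (\<Prod>k\<in>{0<..n}. [:- h k, 1:])"
  proof -
    have "{..<n} = insert 0 {0<..<n}" "{0<..n} = insert n {0<..<n}" using assms by auto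
    moreover have "h 0 = h n" using assms by (simp add: h_def)
    ultimately show ?thesis by simp
  qed
  also have "\<dots> = (\<Prod>l | l dvd n. \<Prod>k\<in>{k\<in>{0<..n}. gcd k n = l}. [:- h k, 1:])"
    by (rule prod.group[symmetric]) (use fin in auto)
  also have "\<dots> = (\<Prod>l | l dvd n. complex_cyclotomic (n div l))"
  proof (intro prod.cong refl)
    fix l assume "l \<in> {l. l dvd n}"
    hence l: "l dvd n" "l > 0" using assms by (auto intro!: Nat.gr0I)
    have "(\<Prod>k\<in>{k\<in>{0<..n}. gcd k n = l}. [:- h k, 1:]) = (\<Prod>k\<in>totatives (n div l). [:- h (k * l), 1:])"
      using prod.reindex_bij_betw[OF bij_betw_totatives_gcd_eq[OF l(1) assms], of "\<lambda>k. [:- h k, 1:]"] by simp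
    also have "\<dots> = complex_cyclotomic (n div l)"
      unfolding complex_cyclotomic_def h_def using l assms
      by (intro prod.cong) (auto simp: real_of_nat_div field_simps)
    finally show "(\<Prod>k\<in>{k\<in>{0<..n}. gcd k n = l}. [:- h k, 1:]) = complex_cyclotomic (n div l)" .
  qed
  also have "\<dots> = (\<Prod>l | l dvd n. complex_cyclotomic l)"
    by (rule prod.reindex_bij_witness[of _ "\<lambda>k. n div k" "\<lambda>k. n div k"]) (use assms in \<open>auto elim!: dvdE\<close>)
  finally show ?thesis ..
qed

lemma lead_coeff_complex_cyclotomic: "lead_coeff (complex_cyclotomic n) = 1"
  by (simp add: complex_cyclotomic_def lead_coeff_prod)

lemma degree_complex_cyclotomic: "degree (complex_cyclotomic n) = totient n"
  unfolding complex_cyclotomic_def totient_def by (subst degree_prod_eq_sum_degree) auto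

lemma divisors_insert: "n > 0 \<Longrightarrow> {k. k dvd n} = insert n {k. k dvd n \<and> k < n}" for n :: nat
  by (auto dest: dvd_imp_le)

text \<open>
  Integrality by induction: \<open>x\<^sup>n - 1\<close> is divided by the monic integer polynomial collecting the
  cyclotomic polynomials of smaller index, and the remainder vanishes because it does over \<open>\<complex>\<close>.
\<close>
lemma complex_cyclotomic_integral:
  "n > 0 \<Longrightarrow> \<exists>P :: int poly. of_int_poly P = complex_cyclotomic n"
proof (induction n rule: less_induct)
  case (less n)
  have "\<exists>P :: int poly. of_int_poly P = complex_cyclotomic l" if "l dvd n" "l < n" for l
    using less that by (auto intro: dvd_pos_nat)
  then obtain P :: "nat \<Rightarrow> int poly"
    where P: "\<And>l. l dvd n \<Longrightarrow> l < n \<Longrightarrow> of_int_poly (P l) = complex_cyclotomic l" by metis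
  define B where "B = (\<Prod>l | l dvd n \<and> l < n. P l)"
  have B: "of_int_poly B = (\<Prod>l | l dvd n \<and> l < n. complex_cyclotomic l)"
    unfolding B_def of_int_poly_hom.hom_prod by (intro prod.cong) (auto simp: P)
  have "lead_coeff (of_int_poly B :: complex poly) = 1"
    unfolding B lead_coeff_prod by (simp add: lead_coeff_complex_cyclotomic)
  hence lB: "lead_coeff B = 1" by simp
  obtain q r where qr: "[:0, 1:] ^ n - 1 = B * q + r" "r = 0 \<or> degree r < degree B"
    using monic_division[OF lB] by blast
  have "of_int_poly B * complex_cyclotomic n = ([:0, 1:] ^ n - 1 :: complex poly)"
    using prod_complex_cyclotomic[OF less.prems] less.prems unfolding B
    by (simp add: divisors_insert mult.commute)
  also have "\<dots> = of_int_poly ([:0, 1:] ^ n - 1)"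
    by (simp add: of_int_poly_hom.hom_minus of_int_poly_hom.hom_power)
  also have "\<dots> = of_int_poly B * of_int_poly q + of_int_poly r"
    unfolding qr(1) by (simp add: of_int_poly_hom.hom_add of_int_poly_hom.hom_mult)
  finally have eq: "of_int_poly B * (complex_cyclotomic n - of_int_poly q) = (of_int_poly r :: complex poly)"
    by (simp add: right_diff_distrib)
  have "complex_cyclotomic n - of_int_poly q = 0"
  proof (rule ccontr)
    assume nz: "complex_cyclotomic n - of_int_poly q \<noteq> 0"
    have B0: "of_int_poly B \<noteq> (0 :: complex poly)"
      using \<open>lead_coeff (of_int_poly B :: complex poly) = 1\<close> by (metis coeff_0 zero_neq_one)
    have "degree (of_int_poly r :: complex poly) \<ge> degree (of_int_poly B :: complex poly)"
      unfolding eq[symmetric] degree_mult_eq[OF B0 nz] by simp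
    moreover have "of_int_poly r \<noteq> (0 :: complex poly)"
      unfolding eq[symmetric] using B0 nz by (metis mult_eq_0_iff)
    ultimately show False using qr(2) by auto
  qed
  thus ?case by (metis eq_iff_diff_eq_0)
qed

lemma of_int_poly_cyclotomic:
  assumes "n > 0"
  shows "of_int_poly (cyclotomic n) = complex_cyclotomic n"
proof -
  obtain P :: "int poly" where P: "of_int_poly P = complex_cyclotomic n"
    using complex_cyclotomic_integral[OF assms] by blast
  show ?thesis unfolding cyclotomic_def complex_cyclotomic_def[symmetric]
    by (rule theI[of _ P], fact P) (metis P of_int_poly_inject)
qed

lemma lead_coeff_cyclotomic: "n > 0 \<Longrightarrow> lead_coeff (cyclotomic n) = 1"
  using lead_coeff_complex_cyclotomic[of n] by (simp flip: of_int_poly_cyclotomic)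

lemma degree_cyclotomic: "n > 0 \<Longrightarrow> degree (cyclotomic n) = totient n"
  using degree_complex_cyclotomic[of n] by (simp flip: of_int_poly_cyclotomic)

lemma prod_cyclotomic:
  assumes "n > 0"
  shows "(\<Prod>l | l dvd n. cyclotomic l) = [:0, 1:] ^ n - 1"
proof -
  have "of_int_poly (\<Prod>l | l dvd n. cyclotomic l) = (\<Prod>l | l dvd n. complex_cyclotomic l)"
    unfolding of_int_poly_hom.hom_prod using assms
    by (intro prod.cong refl of_int_poly_cyclotomic) (auto intro: dvd_pos_nat[OF assms])
  also have "\<dots> = of_int_poly ([:0, 1:] ^ n - 1)"
    unfolding prod_complex_cyclotomic[OF assms]
    by (simp add: of_int_poly_hom.hom_minus of_int_poly_hom.hom_power)
  finally show ?thesis by (rule of_int_poly_inject)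
qed

lemma cyclotomic_1: "cyclotomic 1 = [:- 1, 1:]"
proof -
  have "{l :: nat. l dvd 1} = {1}" by auto
  thus ?thesis using prod_cyclotomic[of 1] by (simp add: one_pCons)
qed

section \<open>Periodic points of unicritical polynomials\<close>

text \<open>
  Iterating the relation from \<open>w\<^sub>0\<close> expresses a multiple of \<open>w\<^sub>j\<close> as a monic polynomial of degree
  \<open>d\<^sup>j\<close> in \<open>w\<^sub>0\<close>; after a full turn \<open>w\<^sub>k = w\<^sub>0\<close> gives a monic equation. It is applied in three coordinates:
  over \<open>\<int>[c]\<close>, over \<open>\<int>[t]\<close>, and at infinity over \<open>\<int>[1/t]\<close>.
\<close>
lemma integral_over_if_cyclic_relation:
  fixes w :: "nat \<Rightarrow> 'a :: field"
  assumes R: "comm_subring R" and d: "d \<ge> 2" and k: "k > 0"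
    and ab: "a \<in> integral_over R" "b \<in> integral_over R"
    and rel: "\<And>i. w i ^ d = a * w (Suc i) + b" and cyc: "w k = w 0"
  shows "w 0 \<in> integral_over R"
proof -
  interpret I: comm_subring "integral_over R" using R by (rule comm_subring_integral_over)
  have ex: "\<exists>P A. lead_coeff P = 1 \<and> degree P = d ^ j \<and> (\<forall>i. coeff P i \<in> integral_over R) \<and>
      A \<in> integral_over R \<and> poly P (w 0) = A * w j" for j
  proof (induction j)
    case 0
    show ?case
      by (intro exI[of _ "[:0, 1:]"] exI[of _ 1])
         (auto simp: coeff_pCons I.one_mem I.zero_mem split: nat.splits)
  next
    case (Suc j)
    then obtain P A where P: "lead_coeff P = 1" "degree P = d ^ j" "\<And>i. coeff P i \<in> integral_over R"
      and A: "A \<in> integral_over R" "poly P (w 0) = A * w j" by blast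
    define Q where "Q = P ^ d + [:- (A ^ d * b):]"
    have "P \<noteq> 0" using P(1) by auto
    hence deg': "degree (P ^ d) = d ^ Suc j" by (simp add: degree_power_eq P(2))
    hence deg: "degree Q = d ^ Suc j" unfolding Q_def using d by (subst degree_add_eq_left) auto
    have "coeff [:- (A ^ d * b):] (d ^ Suc j) = 0" using d by (simp add: coeff_pCons split: nat.splits)
    hence "lead_coeff Q = lead_coeff (P ^ d)" unfolding deg unfolding Q_def using deg' by simp
    hence "lead_coeff Q = 1" by (simp add: lead_coeff_power P(1))
    moreover have "coeff Q i \<in> integral_over R" for i unfolding Q_def coeff_add
      by (intro I.add_mem I.coeff_power_mem P)
         (auto simp: coeff_pCons intro!: I.uminus_mem I.mult_mem I.power_mem A ab I.zero_mem split: nat.splits)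
    moreover have "poly Q (w 0) = (A ^ d * a) * w (Suc j)"
      unfolding Q_def by (simp add: poly_power A(2) power_mult_distrib rel algebra_simps)
    ultimately show ?case using deg A(1) ab
      by (intro exI[of _ Q] exI[of _ "A ^ d * a"]) (auto intro: I.mult_mem I.power_mem)
  qed
  obtain P A where P: "lead_coeff P = 1" "degree P = d ^ k" "\<And>i. coeff P i \<in> integral_over R"
    and A: "A \<in> integral_over R" "poly P (w 0) = A * w k" using ex[of k] by blast
  have "2 ^ 1 \<le> d ^ 1" using d by simp
  also have "d ^ 1 \<le> d ^ k" using d k by (intro power_increasing) auto
  finally have dk: "d ^ k \<ge> 2" by simp
  have "degree (- [:0, A:]) \<le> 1" by simp
  hence "degree (- [:0, A:]) < degree P" unfolding P(2) using dk by linarith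
  hence deg: "degree (P - [:0, A:]) = d ^ k"
    unfolding diff_conv_add_uminus P(2)[symmetric] by (rule degree_add_eq_left)
  show ?thesis
  proof (rule integral_over_trans[OF R])
    have "degree [:0, A:] \<le> 1" by simp
    hence "coeff [:0, A:] (d ^ k) = 0" using dk by (intro coeff_eq_0) linarith
    thus "lead_coeff (P - [:0, A:]) = 1" unfolding deg using P by simp
    show "coeff (P - [:0, A:]) i \<in> integral_over R" for i
      using P(3) A(1) by (auto simp: coeff_pCons intro!: I.diff_mem I.zero_mem split: nat.splits)
    show "poly (P - [:0, A:]) (w 0) = 0" using A(2) cyc by simp
  qed
qed

lemma proots_prod_linear: "proots (\<Prod>x\<in>#A. [:- x, 1 :: 'a :: idom:]) = A"
proof (induction A)
  case (add x A)
  have "(\<Prod>x\<in>#A. [:- x, 1:]) \<noteq> 0" by auto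
  thus ?case using add by (simp add: proots_mult del: mult_pCons_left)
qed simp

text \<open>
  The dynamics is studied over an arbitrary algebraically closed field of characteristic zero with a
  transcendental parameter; the algebraic closure of \<open>\<rat>(c)\<close> enters only at the end.
\<close>
locale unicritical_dynamics =
  fixes d :: nat and c :: "'a :: {alg_closed_field, field_char_0}"
  assumes d: "d \<ge> 2" and c: "int_transcendental c"
begin

definition f :: "'a \<Rightarrow> 'a" where "f z = z ^ d + c"

primrec iter_poly :: "nat \<Rightarrow> 'a poly" where
  "iter_poly 0 = [:0, 1:]"
| "iter_poly (Suc k) = iter_poly k ^ d + [:c:]"

definition Fix :: "nat \<Rightarrow> 'a set" where "Fix k = {z. (f ^^ k) z = z}"

definition Per :: "nat \<Rightarrow> 'a set" where
  "Per k = {z. (f ^^ k) z = z \<and> (\<forall>j. 0 < j \<and> j < k \<longrightarrow> (f ^^ j) z \<noteq> z)}"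

definition orbit :: "nat \<Rightarrow> 'a \<Rightarrow> 'a set" where
  "orbit m z = (\<lambda>i. (f ^^ i) z) ` {..<m}"

definition cycles :: "nat \<Rightarrow> 'a set set" where
  "cycles m = orbit m ` Per m"

text \<open>
  The multiplier of a cycle as a product over its points, by the chain rule. This form shows that it does
  not depend on the choice of a point.
\<close>
definition cycle_mult :: "'a set \<Rightarrow> 'a" where
  "cycle_mult C = (\<Prod>z\<in>C. of_nat d * z ^ (d - 1))"

definition t :: 'a where "t = of_nat d ^ d * c ^ (d - 1)"

abbreviation "Ic \<equiv> integral_over (int_adj c)"
abbreviation "It \<equiv> integral_over (int_adj t)"

sublocale Zc: comm_subring "int_adj c" by (rule comm_subring_int_adj)
sublocale Zt: comm_subring "int_adj t" by (rule comm_subring_int_adj)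
sublocale Ic: comm_subring Ic by (rule comm_subring_integral_over[OF comm_subring_int_adj])
sublocale It: comm_subring It by (rule comm_subring_integral_over[OF comm_subring_int_adj])
sublocale Qc: subfield_set "frac_adj c" by (rule subfield_set_frac_adj)
sublocale Qt: subfield_set "frac_adj t" by (rule subfield_set_frac_adj)

lemma c_mem: "c \<in> int_adj c" by (rule int_adj_self)

lemma c_nonzero: "c \<noteq> 0"
  using c[unfolded int_transcendental_def, rule_format, of "[:0, 1:]"] by auto

lemma t_mem: "t \<in> int_adj c"
  unfolding t_def by (intro Zc.mult_mem Zc.power_mem Zc.of_nat_mem c_mem)

lemma int_adj_t_subset: "int_adj t \<subseteq> int_adj c"
  by (rule int_adj_subset[OF comm_subring_int_adj t_mem])

lemma frac_adj_t_subset: "frac_adj t \<subseteq> frac_adj c"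
  using int_adj_t_subset unfolding frac_adj_def by blast

lemma t_nonzero: "t \<noteq> 0" using c_nonzero d by (auto simp: t_def)

lemma t_eval:
  "poly (of_int_poly p) t = poly (of_int_poly (pcompose p (Polynomial.monom (int d ^ d) (d - 1)))) c"
proof -
  have "of_int_poly (Polynomial.monom (int d ^ d) (d - 1)) = Polynomial.monom (of_nat d ^ d :: 'a) (d - 1)"
    by (simp add: map_poly_monom)
  thus ?thesis
    by (simp add: of_int_hom.map_poly_pcompose poly_pcompose poly_monom t_def)
qed

lemma t_transcendental: "int_transcendental t"
  unfolding int_transcendental_def
proof safe
  fix p :: "int poly" assume p: "p \<noteq> 0" "poly (of_int_poly p) t = 0"
  let ?q = "Polynomial.monom (int d ^ d) (d - 1)"
  have "degree ?q > 0" using d by (simp add: degree_monom_eq)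
  hence "pcompose p ?q \<noteq> 0" using p(1) pcompose_eq_0[of p ?q] by blast
  thus False using p(2) c unfolding t_eval int_transcendental_def by blast
qed

lemma poly_iter_poly: "poly (iter_poly k) z = (f ^^ k) z"
  by (induction k) (auto simp: f_def poly_power)

lemma degree_iter_poly: "degree (iter_poly k) = d ^ k" "lead_coeff (iter_poly k) = 1"
proof (induction k)
  case (Suc k)
  hence nz: "iter_poly k \<noteq> 0" by auto
  case 1
  have deg': "degree (iter_poly k ^ d) = d ^ Suc k" using Suc nz by (simp add: degree_power_eq)
  hence deg: "degree (iter_poly (Suc k)) = d ^ Suc k"
    using d by simp (subst degree_add_eq_left, auto)
  thus ?case .
  case 2
  have "coeff [:c:] (d ^ Suc k) = 0" using d by (simp add: coeff_pCons split: nat.splits)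
  hence "lead_coeff (iter_poly (Suc k)) = lead_coeff (iter_poly k ^ d)" unfolding deg deg' by simp
  thus ?case using Suc by (simp add: lead_coeff_power)
qed auto

lemma poly_pderiv_iter_poly:
  "poly (pderiv (iter_poly k)) z = (\<Prod>i<k. of_nat d * (f ^^ i) z ^ (d - 1))"
proof (induction k)
  case (Suc k)
  have "pderiv (iter_poly (Suc k)) = smult (of_nat d) (iter_poly k ^ (d - 1)) * pderiv (iter_poly k)"
    by (simp add: pderiv_add pderiv_power pderiv_pCons)
  thus ?case by (simp add: Suc poly_power poly_iter_poly mult.commute)
qed (simp add: pderiv_pCons)

lemma funpow_commute: "(f ^^ i) ((f ^^ j) z) = (f ^^ j) ((f ^^ i) z)"
proof -
  have "(f ^^ (i + j)) z = (f ^^ (j + i)) z" by (simp only: add.commute)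
  thus ?thesis unfolding funpow_add comp_apply .
qed

lemma Fix_iterate: "z \<in> Fix k \<Longrightarrow> (f ^^ i) z \<in> Fix k"
  unfolding Fix_def mem_Collect_eq funpow_commute[of k i] by simp

lemma Fix_integral:
  assumes "k > 0" "z \<in> Fix k"
  shows "z \<in> Ic"
proof -
  have "(f ^^ 0) z \<in> Ic"
  proof (rule integral_over_if_cyclic_relation[OF comm_subring_int_adj d assms(1)])
    show "1 \<in> Ic" "- c \<in> Ic"
      using subset_integral_over[OF comm_subring_int_adj] c_mem by (auto intro: Ic.uminus_mem Ic.one_mem)
    show "(f ^^ i) z ^ d = 1 * (f ^^ Suc i) z + - c" for i by (simp add: f_def)
    show "(f ^^ k) z = (f ^^ 0) z" using assms(2) by (simp add: Fix_def)
  qed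
  thus ?thesis by simp
qed

text \<open>
  If \<open>1/d\<^sup>n\<close> were integral it would lie in \<open>\<int>[c]\<close>, making \<open>d\<^sup>n\<close> a unit of \<open>\<int>\<close>.
\<close>
lemma inverse_power_d_not_integral:
  assumes "n > 0"
  shows "1 / of_nat d ^ n \<notin> Ic"
proof
  assume "1 / of_nat d ^ n \<in> Ic"
  moreover have "1 / of_nat d ^ n \<in> frac_adj c"
    by (intro Qc.divide_mem Qc.one_mem Qc.power_mem Qc.of_nat_mem)
  ultimately have "1 / of_nat d ^ n \<in> int_adj c" using int_adj_integrally_closed[OF c] by blast
  then obtain p where p: "1 / of_nat d ^ n = poly (of_int_poly p) c" by (auto simp: int_adj_def)
  have "poly (of_int_poly (Polynomial.smult (int d ^ n) p - 1)) c = 0"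
    using d by (simp add: of_int_poly_hom.hom_minus of_int_hom.map_poly_hom_smult flip: p)
  hence "Polynomial.smult (int d ^ n) p - 1 = 0" using c unfolding int_transcendental_def by blast
  hence "coeff (Polynomial.smult (int d ^ n) p) 0 = 1" by simp
  hence "int d ^ n dvd 1" by (metis coeff_smult dvd_triv_left)
  moreover have "1 < int d ^ n" using d assms by (intro one_less_power) auto
  ultimately show False by simp
qed

text \<open>
  The derivative is \<open>d\<^sup>k\<close> times an integral element, so if one of its powers were \<open>1\<close>, a power of
  \<open>1/d\<close> would be integral. The case \<open>r = 1\<close> says that \<open>f\<^sup>k(z) - z\<close> has no multiple roots.
\<close>
lemma pderiv_iter_poly_not_root_of_unity:
  assumes "k > 0" "z \<in> Fix k" "r > 0"
  shows "poly (pderiv (iter_poly k)) z ^ r \<noteq> 1"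
proof
  define b where "b = (\<Prod>i<k. (f ^^ i) z ^ (d - 1))"
  have b: "b \<in> Ic" unfolding b_def
    by (intro Ic.prod_mem Ic.power_mem Fix_integral[OF assms(1)] Fix_iterate assms)
  assume "poly (pderiv (iter_poly k)) z ^ r = 1"
  hence "of_nat d ^ (k * r) * b ^ r = 1"
    by (simp add: poly_pderiv_iter_poly prod.distrib b_def power_mult_distrib power_mult)
  hence "1 / of_nat d ^ (k * r) = b ^ r" using d by (simp add: field_simps)
  moreover have "b ^ r \<in> Ic" by (intro Ic.power_mem b)
  ultimately show False using inverse_power_d_not_integral[of "k * r"] assms by simp
qed

lemma fixed_point_poly:
  assumes "k > 0"
  shows "degree (iter_poly k - [:0, 1:]) = d ^ k" "lead_coeff (iter_poly k - [:0, 1:]) = 1"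
proof -
  have "2 ^ 1 \<le> d ^ 1" using d by simp
  also have "d ^ 1 \<le> d ^ k" using d assms by (intro power_increasing) auto
  finally have dk: "d ^ k \<ge> 2" by simp
  show deg: "degree (iter_poly k - [:0, 1:]) = d ^ k"
  proof -
    have "degree (- [:0, 1:] :: 'a poly) \<le> 1" by simp
    hence "degree (- [:0, 1:] :: 'a poly) < degree (iter_poly k)"
      unfolding degree_iter_poly using dk by linarith
    thus ?thesis unfolding diff_conv_add_uminus degree_iter_poly(1)[symmetric] by (rule degree_add_eq_left)
  qed
  have "degree [:0, 1 :: 'a:] \<le> 1" by simp
  hence "coeff [:0, 1:] (d ^ k) = (0 :: 'a)" using dk by (intro coeff_eq_0) linarith
  thus "lead_coeff (iter_poly k - [:0, 1:]) = 1" unfolding deg using degree_iter_poly[of k] by simp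
qed

lemma Fix_eq_roots: "Fix k = {z. poly (iter_poly k - [:0, 1:]) z = 0}"
  by (auto simp: Fix_def poly_iter_poly)

lemma finite_Fix: "k > 0 \<Longrightarrow> finite (Fix k)"
  using fixed_point_poly(2)[of k] unfolding Fix_eq_roots by (intro poly_roots_finite) auto

lemma card_Fix:
  assumes "k > 0"
  shows "card (Fix k) = d ^ k"
proof -
  define p where "p = iter_poly k - [:0, 1:]"
  have p: "p \<noteq> 0" "degree p = d ^ k" using fixed_point_poly[OF assms] by (auto simp: p_def)
  obtain A where A: "size A = degree p" "p = Polynomial.smult (lead_coeff p) (\<Prod>x\<in>#A. [:- x, 1:])"
    using alg_closed_imp_factorization[OF p(1)] by blast
  have "rsquarefree p" unfolding rsquarefree_roots
  proof safe
    fix a assume a: "poly p a = 0" "poly (pderiv p) a = 0"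
    have "a \<in> Fix k" using a by (simp add: Fix_eq_roots p_def)
    moreover have "poly (pderiv (iter_poly k)) a ^ 1 = 1"
      using a(2) by (simp add: p_def pderiv_diff pderiv_pCons)
    ultimately show False using pderiv_iter_poly_not_root_of_unity[OF assms, of a 1] by simp
  qed
  have "proots p = mset_set (Fix k)"
  proof (rule multiset_eqI)
    fix x
    have "order x p = 0 \<or> order x p = 1" using \<open>rsquarefree p\<close> unfolding rsquarefree_def by blast
    hence "order x p = (if poly p x = 0 then 1 else 0)" using p(1) by (auto simp: order_root)
    thus "count (proots p) x = count (mset_set (Fix k)) x"
      using p(1) finite_Fix[OF assms] by (simp add: count_mset_set' Fix_eq_roots p_def[symmetric])
  qed
  moreover have "size (proots p) = size A"
  proof -
    have "proots p = proots (\<Prod>x\<in>#A. [:- x, 1:])"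
      by (subst A(2)) (use p(1) in simp)
    also have "\<dots> = A" by (rule proots_prod_linear)
    finally show ?thesis by simp
  qed
  ultimately show ?thesis using A(1) p(2) by simp
qed

lemma fixed_point_poly_eq_prod:
  assumes "k > 0"
  shows "iter_poly k - [:0, 1:] = (\<Prod>z\<in>Fix k. [:- z, 1:])"
  using fixed_point_poly[OF assms] card_Fix[OF assms] finite_Fix[OF assms]
  by (intro monic_eq_prod_roots) (auto simp: Fix_eq_roots)

lemma Per_subset_Fix: "Per k \<subseteq> Fix k"
  by (auto simp: Per_def Fix_def)

lemma finite_Per: "k > 0 \<Longrightarrow> finite (Per k)"
  using finite_Fix Per_subset_Fix finite_subset by blast

text \<open>
  The times at which a point of exact period \<open>k\<close> returns are the multiples of \<open>k\<close>; this makes the fixed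
  points of \<open>f\<^sup>k\<close> the disjoint union of the sets \<open>Per j\<close> over the divisors \<open>j\<close> of \<open>k\<close>.
\<close>
lemma Per_dvd_iff:
  assumes "z \<in> Per k" "k > 0"
  shows "(f ^^ n) z = z \<longleftrightarrow> k dvd n"
proof -
  have "(f ^^ (n mod k)) z = (f ^^ n) z"
    using assms by (intro funpow_mod_eq) (simp add: Per_def)
  moreover have "(f ^^ (n mod k)) z = z \<longleftrightarrow> n mod k = 0"
    using assms mod_less_divisor[OF assms(2), of n] by (auto simp: Per_def intro: ccontr)
  ultimately show ?thesis by (simp add: dvd_eq_mod_eq_0)
qed

lemma Per_disjoint:
  assumes "j > 0" "k > 0" "j \<noteq> k"
  shows "Per j \<inter> Per k = {}"
proof -
  have False if z: "z \<in> Per j" "z \<in> Per k" for z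
  proof -
    have "j dvd k" "k dvd j" using Per_dvd_iff[OF z(1) assms(1)] Per_dvd_iff[OF z(2) assms(2)] z
      by (auto simp: Per_def)
    thus False using assms(3) dvd_antisym by blast
  qed
  thus ?thesis by blast
qed

lemma Fix_eq_Union_Per:
  assumes "k > 0"
  shows "Fix k = (\<Union>j\<in>{j. j dvd k}. Per j)"
proof (intro equalityI subsetI)
  fix z assume z: "z \<in> Fix k"
  define j where "j = (LEAST j. j > 0 \<and> (f ^^ j) z = z)"
  have ex: "k > 0 \<and> (f ^^ k) z = z" using z assms by (simp add: Fix_def)
  have j: "j > 0 \<and> (f ^^ j) z = z" unfolding j_def by (rule LeastI[of "\<lambda>j. j > 0 \<and> (f ^^ j) z = z", OF ex])
  have "\<not> (i > 0 \<and> (f ^^ i) z = z)" if "i < j" for i using that unfolding j_def by (rule not_less_Least)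
  hence "z \<in> Per j" using j by (auto simp: Per_def)
  moreover have "j dvd k" using Per_dvd_iff[OF calculation] j ex by simp
  ultimately show "z \<in> (\<Union>j\<in>{j. j dvd k}. Per j)" by blast
next
  fix z assume "z \<in> (\<Union>j\<in>{j. j dvd k}. Per j)"
  then obtain j where j: "j dvd k" "z \<in> Per j" by blast
  thus "z \<in> Fix k" using Per_dvd_iff[of z j k] assms by (auto simp: Fix_def intro: dvd_pos_nat)
qed

lemma sum_Fix:
  assumes "k > 0"
  shows "(\<Sum>z\<in>Fix k. h z) = (\<Sum>j | j dvd k. \<Sum>z\<in>Per j. h z)"
  unfolding Fix_eq_Union_Per[OF assms] using assms
  by (intro sum.UNION_disjoint) (auto simp: finite_Per dvd_pos_nat dest!: Per_disjoint[rotated 2])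

lemma prod_Fix:
  assumes "k > 0"
  shows "(\<Prod>z\<in>Fix k. h z) = (\<Prod>j | j dvd k. \<Prod>z\<in>Per j. h z)"
  unfolding Fix_eq_Union_Per[OF assms] using assms
  by (intro prod.UNION_disjoint) (auto simp: finite_Per dvd_pos_nat dest!: Per_disjoint[rotated 2])

lemma inj_on_orbit:
  assumes "z \<in> Per m"
  shows "inj_on (\<lambda>i. (f ^^ i) z) {..<m}"
proof (rule linorder_inj_onI')
  fix i j assume ij: "i \<in> {..<m}" "j \<in> {..<m}" "i < j"
  show "(f ^^ i) z \<noteq> (f ^^ j) z"
  proof
    assume eq: "(f ^^ i) z = (f ^^ j) z"
    have "(f ^^ (m - j + i)) z = (f ^^ (m - j + j)) z"
      unfolding funpow_add comp_apply eq ..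
    hence "(f ^^ (m - j + i)) z = z" using ij assms by (simp add: Per_def)
    hence "m dvd m - j + i" using Per_dvd_iff[OF assms] ij by simp
    moreover have "0 < m - j + i" "m - j + i < m" using ij by auto
    ultimately show False using nat_dvd_not_less[of "m - j + i" m] by simp
  qed
qed

lemma card_orbit: "z \<in> Per m \<Longrightarrow> card (orbit m z) = m"
  unfolding orbit_def by (subst card_image[OF inj_on_orbit]) auto

lemma Per_iterate:
  assumes "z \<in> Per m" "m > 0"
  shows "(f ^^ i) z \<in> Per m"
proof -
  have "(f ^^ i) z \<in> Fix m" using assms Per_subset_Fix Fix_iterate by blast
  moreover have "(f ^^ j) ((f ^^ i) z) \<noteq> (f ^^ i) z" if "0 < j" "j < m" for j
  proof
    assume eq: "(f ^^ j) ((f ^^ i) z) = (f ^^ i) z"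
    define l where "l = m * i - i"
    have li: "l + i = m * i" using assms(2) by (simp add: l_def)
    have "(f ^^ j) z = (f ^^ j) ((f ^^ (l + i)) z)" using Per_dvd_iff[OF assms, of "l + i"] li by simp
    also have "\<dots> = (f ^^ l) ((f ^^ j) ((f ^^ i) z))"
      unfolding funpow_add comp_apply funpow_commute[of j l] ..
    also have "\<dots> = (f ^^ (l + i)) z" unfolding eq by (simp add: funpow_add)
    also have "\<dots> = z" using Per_dvd_iff[OF assms, of "l + i"] li by simp
    finally show False using assms that by (auto simp: Per_def)
  qed
  ultimately show ?thesis by (auto simp: Per_def Fix_def)
qed

lemma orbit_subset_Per: "z \<in> Per m \<Longrightarrow> m > 0 \<Longrightarrow> orbit m z \<subseteq> Per m"
  by (auto simp: orbit_def Per_iterate)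

lemma self_in_orbit: "m > 0 \<Longrightarrow> z \<in> orbit m z"
  unfolding orbit_def by (rule image_eqI[of _ _ 0]) auto

lemma orbit_eq:
  assumes "z \<in> Per m" "m > 0" "w \<in> orbit m z"
  shows "orbit m w = orbit m z"
proof (rule card_subset_eq)
  obtain i where i: "w = (f ^^ i) z" using assms(3) by (auto simp: orbit_def)
  show "orbit m w \<subseteq> orbit m z"
  proof
    fix x assume "x \<in> orbit m w"
    then obtain j where "x = (f ^^ (j + i)) z" by (auto simp: orbit_def i funpow_add)
    also have "\<dots> = (f ^^ ((j + i) mod m)) z"
      using assms(1) by (intro funpow_mod_eq[symmetric]) (simp add: Per_def)
    finally show "x \<in> orbit m z" using assms(2) by (auto simp: orbit_def)
  qed
  show "card (orbit m w) = card (orbit m z)"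
    using assms orbit_subset_Per card_orbit by (metis subsetD)
qed (simp add: orbit_def)

lemma finite_cycles: "m > 0 \<Longrightarrow> finite (cycles m)"
  by (simp add: cycles_def finite_Per)

text \<open>
  Distinct cycles are disjoint and all have \<open>m\<close> elements, so a product over points of period \<open>m\<close> of a
  quantity depending on the cycle only is the \<open>m\<close>-th power of the product over cycles.
\<close>
lemma orbit_fibre:
  assumes "C \<in> cycles m" "m > 0"
  shows "{z \<in> Per m. orbit m z = C} = C" "card C = m"
proof -
  obtain z where z: "z \<in> Per m" "C = orbit m z" using assms by (auto simp: cycles_def)
  show "{z \<in> Per m. orbit m z = C} = C"
    using z orbit_eq[OF z(1) assms(2)] self_in_orbit[OF assms(2)] orbit_subset_Per[OF z(1) assms(2)]
    by blast
  show "card C = m" using z card_orbit by simp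
qed

lemma sum_Per_orbit:
  assumes "m > 0"
  shows "(\<Sum>z\<in>Per m. h (orbit m z)) = of_nat m * (\<Sum>C\<in>cycles m. h C :: 'b :: comm_semiring_1)"
proof -
  have "(\<Sum>z\<in>Per m. h (orbit m z)) = (\<Sum>C\<in>cycles m. \<Sum>z | z \<in> Per m \<and> orbit m z = C. h (orbit m z))"
    unfolding cycles_def by (rule sum.image_gen[OF finite_Per[OF assms]])
  also have "\<dots> = (\<Sum>C\<in>cycles m. \<Sum>z | z \<in> Per m \<and> orbit m z = C. h C)"
    by (intro sum.cong refl) auto
  also have "\<dots> = (\<Sum>C\<in>cycles m. of_nat m * h C)"
    using orbit_fibre[OF _ assms] by (intro sum.cong) auto
  finally show ?thesis by (simp add: sum_distrib_left)
qed

lemma prod_Per_orbit: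
  assumes "m > 0"
  shows "(\<Prod>z\<in>Per m. h (orbit m z)) = (\<Prod>C\<in>cycles m. h C :: 'b :: comm_semiring_1) ^ m"
proof -
  have "(\<Prod>z\<in>Per m. h (orbit m z)) = (\<Prod>C\<in>cycles m. \<Prod>z | z \<in> Per m \<and> orbit m z = C. h (orbit m z))"
    unfolding cycles_def by (rule prod.image_gen[OF finite_Per[OF assms]])
  also have "\<dots> = (\<Prod>C\<in>cycles m. \<Prod>z | z \<in> Per m \<and> orbit m z = C. h C)"
    by (intro prod.cong refl) auto
  also have "\<dots> = (\<Prod>C\<in>cycles m. h C ^ m)"
    using orbit_fibre[OF _ assms] by (intro prod.cong) auto
  finally show ?thesis by (simp add: prod_power_distrib)
qed

lemma prod_over_cycles:
  assumes "m > 0"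
  shows "(\<Prod>C\<in>cycles m. \<Prod>z\<in>C. h z) = (\<Prod>z\<in>Per m. h z)"
proof -
  have "(\<Prod>z\<in>Per m. h z) = (\<Prod>C\<in>cycles m. \<Prod>z | z \<in> Per m \<and> orbit m z = C. h z)"
    unfolding cycles_def by (rule prod.image_gen[OF finite_Per[OF assms]])
  thus ?thesis using orbit_fibre[OF _ assms] by simp
qed

lemma card_Per: "m > 0 \<Longrightarrow> card (Per m) = m * card (cycles m)"
  using sum_Per_orbit[of m "\<lambda>_. 1 :: nat"] by simp

lemma mult_orbit: "z \<in> Per m \<Longrightarrow> cycle_mult (orbit m z) = poly (pderiv (iter_poly m)) z"
  unfolding cycle_mult_def orbit_def poly_pderiv_iter_poly by (subst prod.reindex[OF inj_on_orbit]) auto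

end

section \<open>Multipliers are rational and integral over the ring generated by t\<close>

context unicritical_dynamics
begin

text \<open>
  The iterates in the coordinate \<open>y = z/(cd)\<close>, where \<open>f\<close> becomes \<open>y \<mapsto> (t y\<^sup>d + 1)/d\<close>. Only \<open>t\<close> and rational
  numbers occur in the coefficients.
\<close>
primrec scaled_iter_poly :: "nat \<Rightarrow> 'a poly" where
  "scaled_iter_poly 0 = [:0, 1:]"
| "scaled_iter_poly (Suc k) =
     Polynomial.smult (inverse (of_nat d)) (Polynomial.smult t (scaled_iter_poly k ^ d) + 1)"

definition scaled :: "'a \<Rightarrow> 'a" where "scaled z = z / (c * of_nat d)"

lemma scaled_eq_iff: "scaled z = scaled w \<longleftrightarrow> z = w"
  using c_nonzero d by (simp add: scaled_def)

lemma power_d: "x ^ d = x * x ^ (d - 1)" for x :: 'a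
  using power_eq_if[of x d] d by simp

lemma t_mult_scaled_power: "t * scaled w ^ (d - 1) = of_nat d * w ^ (d - 1)"
proof -
  have "t = of_nat d * (c * of_nat d) ^ (d - 1)"
    unfolding t_def power_d[of "of_nat d"] power_mult_distrib by (simp add: ac_simps)
  moreover have "(c * of_nat d) ^ (d - 1) * scaled w ^ (d - 1) = w ^ (d - 1)"
    using c_nonzero d unfolding scaled_def power_mult_distrib[symmetric] by simp
  ultimately show ?thesis by (metis mult.assoc)
qed

lemma coeff_scaled_iter_poly: "coeff (scaled_iter_poly k) i \<in> frac_adj t"
proof (induction k arbitrary: i)
  case 0
  show ?case by (auto simp: coeff_pCons Qt.one_mem Qt.zero_mem split: nat.splits)
next
  case (Suc k)
  have "t \<in> frac_adj t" using int_adj_subset_frac_adj int_adj_self by blast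
  thus ?case using Suc
    by (auto simp: coeff_1 intro!: Qt.mult_mem Qt.add_mem Qt.inverse_mem Qt.of_nat_mem
          Qt.coeff_power_mem Qt.one_mem Qt.zero_mem)
qed

lemma degree_scaled_iter_poly: "degree (scaled_iter_poly k) = d ^ k"
proof (induction k)
  case (Suc k)
  have "degree (scaled_iter_poly k ^ d) = d ^ Suc k"
    using Suc d by (subst degree_power_eq) auto
  hence "degree (Polynomial.smult t (scaled_iter_poly k ^ d)) = d ^ Suc k" using t_nonzero by simp
  hence "degree (Polynomial.smult t (scaled_iter_poly k ^ d) + 1) = d ^ Suc k"
    using d by (subst degree_add_eq_left) auto
  thus ?case using d by simp
qed simp

lemma poly_scaled_iter_poly: "poly (scaled_iter_poly k) (scaled z) = scaled ((f ^^ k) z)"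
proof (induction k)
  case (Suc k)
  have "inverse (of_nat d) * (t * scaled w ^ d + 1) = scaled (f w)" for w
  proof -
    have "t * scaled w ^ d = scaled w * (t * scaled w ^ (d - 1))"
      unfolding power_d[of "scaled w"] by (simp only: ac_simps)
    also have "\<dots> = scaled w * (of_nat d * w ^ (d - 1))" by (simp only: t_mult_scaled_power)
    finally have "t * scaled w ^ d = w ^ d / c"
      unfolding power_d[of w] scaled_def using d by simp
    thus ?thesis using d c_nonzero by (simp add: scaled_def f_def field_simps)
  qed
  thus ?case using Suc by (simp add: poly_power)
qed (simp add: scaled_def)

lemma power_sums_scaled_Fix:
  assumes "k > 0"
  shows "(\<Sum>z\<in>Fix k. scaled z ^ i) \<in> frac_adj t"
proof -
  define p where "p = scaled_iter_poly k - [:0, 1:]"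
  have "2 ^ 1 \<le> d ^ 1" using d by simp
  also have "d ^ 1 \<le> d ^ k" using d assms by (intro power_increasing) auto
  finally have dk: "d ^ k \<ge> 2" by simp
  have "degree (- [:0, 1:] :: 'a poly) \<le> 1" by simp
  hence deg1: "degree (- [:0, 1:] :: 'a poly) < degree (scaled_iter_poly k)"
    unfolding degree_scaled_iter_poly using dk by linarith
  have deg: "degree p = d ^ k"
    unfolding p_def diff_conv_add_uminus degree_scaled_iter_poly[symmetric]
    using deg1 by (rule degree_add_eq_left)
  hence p0: "p \<noteq> 0" using dk by (metis degree_0 not_numeral_le_zero)
  have p: "coeff p i \<in> frac_adj t" for i unfolding p_def coeff_diff
    by (intro Qt.diff_mem coeff_scaled_iter_poly)
       (auto simp: coeff_pCons Qt.zero_mem Qt.one_mem split: nat.splits)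
  define q where "q = Polynomial.smult (inverse (lead_coeff p)) p"
  have inj: "inj_on scaled (Fix k)" by (simp add: inj_on_def scaled_eq_iff)
  have "q = (\<Prod>a\<in>scaled ` Fix k. [:- a, 1:])"
  proof (rule monic_eq_prod_roots)
    show "finite (scaled ` Fix k)" using finite_Fix[OF assms] by simp
    show "lead_coeff q = 1" using p0 by (simp add: q_def)
    show "card (scaled ` Fix k) = degree q"
      unfolding card_image[OF inj] card_Fix[OF assms] deg[symmetric] using p0 by (simp add: q_def)
    show "poly q a = 0" if "a \<in> scaled ` Fix k" for a
      using that by (auto simp: q_def p_def poly_scaled_iter_poly Fix_def)
  qed
  also have "\<dots> = (\<Prod>z\<in>Fix k. [:- scaled z, 1:])" by (simp add: prod.reindex[OF inj])
  finally have q_eq: "q = (\<Prod>z\<in>Fix k. [:- scaled z, 1:])" .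
  have "coeff (\<Prod>z\<in>Fix k. [:- scaled z, 1:]) i \<in> frac_adj t" for i
    unfolding q_eq[symmetric] using p by (simp add: q_def Qt.mult_mem Qt.inverse_mem)
  thus ?thesis by (intro Qt.power_sums_mem finite_Fix assms)
qed

text \<open>
  Power sums are additive over the decomposition of the fixed points of \<open>f\<^sup>k\<close> by exact period, so
  induction over the divisors reduces to the full set of roots of \<open>f\<^sup>k(z) - z\<close>.
\<close>
lemma power_sums_scaled_Per:
  "k > 0 \<Longrightarrow> (\<Sum>z\<in>Per k. scaled z ^ i) \<in> frac_adj t"
proof (induction k rule: less_induct)
  case (less k)
  have "(\<Sum>z\<in>Per k. scaled z ^ i)
      = (\<Sum>z\<in>Fix k. scaled z ^ i) - (\<Sum>j | j dvd k \<and> j < k. \<Sum>z\<in>Per j. scaled z ^ i)"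
    using less.prems by (simp add: sum_Fix divisors_insert)
  also have "\<dots> \<in> frac_adj t"
  proof (intro Qt.diff_mem power_sums_scaled_Fix less.prems, rule Qt.sum_mem)
    fix j assume "j \<in> {j. j dvd k \<and> j < k}"
    thus "(\<Sum>z\<in>Per j. scaled z ^ i) \<in> frac_adj t"
      using less by (auto intro: dvd_pos_nat)
  qed
  finally show ?case .
qed

text \<open>
  A multiplier is a polynomial over \<open>\<rat>(t)\<close> in the scaled coordinate of any point of its cycle; the power
  sums over points are \<open>m\<close> times those over cycles.
\<close>
lemma power_sums_mult:
  assumes "m > 0"
  shows "(\<Sum>C\<in>cycles m. cycle_mult C ^ k) \<in> frac_adj t"
proof -
  define W where "W = (\<Prod>i<m. Polynomial.smult t (scaled_iter_poly i ^ (d - 1)))"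
  have t: "t \<in> frac_adj t" using int_adj_subset_frac_adj int_adj_self by blast
  have W: "coeff W i \<in> frac_adj t" for i unfolding W_def
    using t by (intro Qt.coeff_prod_mem)
      (auto intro!: Qt.mult_mem Qt.coeff_power_mem coeff_scaled_iter_poly)
  have "cycle_mult (orbit m z) = poly W (scaled z)" if "z \<in> Per m" for z
    using that by (simp add: mult_orbit poly_pderiv_iter_poly W_def poly_prod poly_power
      poly_scaled_iter_poly t_mult_scaled_power del: One_nat_def)
  hence "(\<Sum>z\<in>Per m. cycle_mult (orbit m z) ^ k) = (\<Sum>z\<in>Per m. poly W (scaled z) ^ k)"
    by (intro sum.cong) auto
  also have "\<dots> \<in> frac_adj t"
    by (intro Qt.power_sums_poly_mem power_sums_scaled_Per assms W)
  finally have "of_nat m * (\<Sum>C\<in>cycles m. cycle_mult C ^ k) \<in> frac_adj t"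
    by (simp add: sum_Per_orbit[OF assms, of "\<lambda>C. cycle_mult C ^ k"])
  hence "of_nat m * (\<Sum>C\<in>cycles m. cycle_mult C ^ k) / of_nat m \<in> frac_adj t"
    by (intro Qt.divide_mem Qt.of_nat_mem)
  thus ?thesis using assms by simp
qed

text \<open>
  The coordinate \<open>w = \<lambda>z\<close> makes the multiplier a product of \<open>w\<^bsup>d-1\<^esup>\<close> without powers of \<open>d\<close>, and turns the
  dynamics into \<open>d w' = w\<^sup>d + s\<close> with \<open>s = d \<lambda> c\<close>; here \<open>s\<^bsup>d-1\<^esup> = t\<close>.
\<close>
definition lam :: 'a where "lam = (SOME l. l ^ (d - 1) = of_nat d)"

text \<open>
  A \<open>d\<close>-th root of \<open>s = d \<lambda> c\<close>. It measures the size of the periodic points near \<open>c = \<infinity>\<close> in the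
  coordinate \<open>w = \<lambda>z\<close>.
\<close>
definition sg :: 'a where "sg = (SOME s. s ^ d = of_nat d * lam * c)"

lemma lam: "lam ^ (d - 1) = of_nat d" "lam ^ d = of_nat d * lam"
proof -
  have "\<exists>l :: 'a. l ^ (d - 1) = of_nat d" using d by (intro nth_root_exists) auto
  thus 1: "lam ^ (d - 1) = of_nat d" unfolding lam_def by (rule someI_ex)
  show "lam ^ d = of_nat d * lam" using power_eq_if[of lam d] d 1 by (simp add: mult.commute)
qed

lemma sg: "sg ^ d = of_nat d * lam * c"
proof -
  have "\<exists>l :: 'a. l ^ d = of_nat d * lam * c" using d by (intro nth_root_exists) auto
  thus ?thesis unfolding sg_def by (rule someI_ex)
qed

lemma lam_nonzero: "lam \<noteq> 0" using lam(1) d by (intro notI) (simp add: power_0_left)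

lemma sg_nonzero: "sg \<noteq> 0"
  using sg d c_nonzero lam_nonzero by (intro notI) (simp add: power_0_left)

lemma sg_power: "sg ^ (d * (d - 1)) = t"
  unfolding power_mult sg power_mult_distrib lam(1) t_def
  using power_eq_if[of "of_nat d :: 'a" d] d by (simp add: mult.commute)

text \<open>
  All of \<open>\<lambda>\<close>, \<open>s\<close> and hence \<open>w = \<lambda>z\<close> are integral over \<open>\<int>[t]\<close>, and the multiplier is a product of
  powers of such \<open>w\<close>.
\<close>
lemma mult_integral:
  assumes "m > 0" "C \<in> cycles m"
  shows "cycle_mult C \<in> It"
proof -
  note R = comm_subring_int_adj[of t]
  have L: "d * (d - 1) > 0" using d by simp
  have tI: "t \<in> It" using int_adj_self subset_integral_over[OF R] by blast
  have lam_It: "lam \<in> It"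
    by (rule integral_over_root[OF R, of _ "d - 1"]) (unfold lam(1), use d in \<open>auto simp: It.of_nat_mem\<close>)
  have "sg \<in> It"
    by (rule integral_over_root[OF R, of _ "d * (d - 1)"]) (unfold sg_power, use L tI in auto)
  hence s: "- (of_nat d * lam * c) \<in> It" unfolding sg[symmetric] by (intro It.uminus_mem It.power_mem)
  have w: "lam * z \<in> It" if z: "z \<in> Fix m" for z
  proof -
    have "lam * (f ^^ 0) z \<in> It"
    proof (rule integral_over_if_cyclic_relation[OF R d assms(1), of "of_nat d" _ "\<lambda>i. lam * (f ^^ i) z"])
      show "(lam * (f ^^ i) z) ^ d = of_nat d * (lam * (f ^^ Suc i) z) + - (of_nat d * lam * c)" for i
        by (simp add: power_mult_distrib lam(2) f_def algebra_simps)
    qed (use s z in \<open>auto simp: It.of_nat_mem Fix_def\<close>)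
    thus ?thesis by simp
  qed
  have "C \<subseteq> Fix m" using assms orbit_subset_Per Per_subset_Fix by (fastforce simp: cycles_def)
  hence "(\<Prod>z\<in>C. (lam * z) ^ (d - 1)) \<in> It" using w by (intro It.prod_mem It.power_mem) auto
  thus ?thesis unfolding cycle_mult_def power_mult_distrib lam(1) .
qed

text \<open>
  Rational over \<open>\<rat>(c)\<close> by Newton's identities and integral over \<open>\<int>[c]\<close>: the monic polynomial with roots
  \<open>Per m\<close> has coefficients in \<open>\<int>[c]\<close>. It is the dynatomic polynomial.
\<close>
lemma Per_poly_coeff:
  assumes "m > 0"
  shows "coeff (\<Prod>z\<in>Per m. [:- z, 1:]) i \<in> int_adj c"
proof (rule int_adj_integrally_closed[OF c])
  have "(\<Sum>z\<in>Per m. z ^ k) = (c * of_nat d) ^ k * (\<Sum>z\<in>Per m. scaled z ^ k)" for k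
    using c_nonzero d by (simp add: sum_distrib_left scaled_def flip: power_mult_distrib)
  moreover have "c \<in> frac_adj c" using int_adj_subset_frac_adj int_adj_self by blast
  ultimately have "(\<Sum>z\<in>Per m. z ^ k) \<in> frac_adj c" for k
    using power_sums_scaled_Per[OF assms, of k] frac_adj_t_subset
    by (auto intro!: Qc.mult_mem Qc.power_mem Qc.of_nat_mem)
  thus "coeff (\<Prod>z\<in>Per m. [:- z, 1:]) i \<in> frac_adj c"
    by (intro Qc.coeff_prod_linear_mem finite_Per assms)
  show "coeff (\<Prod>z\<in>Per m. [:- z, 1:]) i \<in> Ic"
    using Fix_integral[OF assms] Per_subset_Fix[of m]
    by (intro Ic.coeff_prod_mem)
       (auto simp: coeff_pCons Ic.one_mem Ic.zero_mem intro!: Ic.uminus_mem split: nat.splits)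
qed

lemma multiplier_poly_coeff:
  assumes "m > 0"
  shows "coeff (\<Prod>C\<in>cycles m. [:- cycle_mult C, 1:]) i \<in> int_adj t"
proof (rule int_adj_integrally_closed[OF t_transcendental])
  show "coeff (\<Prod>C\<in>cycles m. [:- cycle_mult C, 1:]) i \<in> frac_adj t"
    by (intro Qt.coeff_prod_linear_mem finite_cycles power_sums_mult assms)
  show "coeff (\<Prod>C\<in>cycles m. [:- cycle_mult C, 1:]) i \<in> It"
    using mult_integral[OF assms]
    by (intro It.coeff_prod_mem)
       (auto simp: coeff_pCons It.one_mem It.zero_mem intro!: It.uminus_mem split: nat.splits)
qed

text \<open>
  The product is a symmetric function of the multipliers, hence in \<open>\<rat>(t)\<close>, and it is integral over \<open>\<int>[t]\<close>.
\<close>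
lemma prod_poly_mult_mem:
  assumes "m > 0"
  shows "(\<Prod>C\<in>cycles m. poly (of_int_poly q) (cycle_mult C)) \<in> int_adj t"
proof (rule int_adj_integrally_closed[OF t_transcendental])
  show "(\<Prod>C\<in>cycles m. poly (of_int_poly q) (cycle_mult C)) \<in> frac_adj t"
    by (intro Qt.prod_mem_if_power_sums_mem Qt.power_sums_poly_mem finite_cycles power_sums_mult assms)
       (auto simp: Qt.of_int_mem)
  show "(\<Prod>C\<in>cycles m. poly (of_int_poly q) (cycle_mult C)) \<in> It"
    using mult_integral[OF assms] by (intro It.prod_mem It.poly_mem) (auto simp: It.of_int_mem)
qed

end

section \<open>Multipliers at infinity\<close>

lemma int_transcendental_inverse:
  fixes x :: "'a :: field_char_0"
  assumes "int_transcendental x"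
  shows "int_transcendental (1 / x)"
  unfolding int_transcendental_def
proof safe
  fix p :: "int poly" assume p: "p \<noteq> 0" "poly (of_int_poly p) (1 / x) = 0"
  have x0: "x \<noteq> 0"
    using assms[unfolded int_transcendental_def, rule_format, of "[:0, 1:]"] by auto
  have "of_int_poly (reflect_poly p) = (reflect_poly (of_int_poly p) :: 'a poly)"
    by (intro poly_eqI) (auto simp: coeff_reflect_poly)
  hence "poly (of_int_poly (reflect_poly p)) x = 0"
    using p(2) x0 by (simp add: poly_reflect_poly_nz inverse_eq_divide)
  thus False using p(1) assms unfolding int_transcendental_def by (metis reflect_poly_eq_0_iff)
qed

context unicritical_dynamics
begin

abbreviation "Iinf \<equiv> integral_over (int_adj (1 / t))"

sublocale Iinf: comm_subring Iinf by (rule comm_subring_integral_over[OF comm_subring_int_adj])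

definition eps :: 'a where "eps = 1 / sg"

text \<open>
  Congruence to \<open>1\<close> modulo \<open>\<epsilon> = 1/\<sigma>\<close> in the integral closure of \<open>\<int>[1/t]\<close>. It replaces a valuation at
  \<open>c = \<infinity>\<close> on the algebraic closure.
\<close>
definition near_one :: "'a \<Rightarrow> bool" where
  "near_one x \<longleftrightarrow> (\<exists>i\<in>Iinf. x = 1 + eps * i)"

lemma eps_power: "eps ^ (d * (d - 1)) = 1 / t"
  by (simp only: eps_def power_one_over sg_power)

lemma exponent_pos: "d * (d - 1) > 0" using d by simp

lemma inverse_t_Iinf: "1 / t \<in> Iinf"
  using subset_integral_over[OF comm_subring_int_adj] int_adj_self by blast

lemma eps_Iinf: "eps \<in> Iinf"
  by (rule integral_over_root[OF comm_subring_int_adj, of _ "d * (d - 1)"])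
     (unfold eps_power, rule inverse_t_Iinf, rule exponent_pos)

lemma inverse_t_eps: "\<exists>i\<in>Iinf. 1 / t = eps * i"
proof
  show "1 / t = eps * eps ^ (d * (d - 1) - 1)"
    unfolding eps_power[symmetric] using exponent_pos
    by (metis power_Suc Suc_diff_1)
qed (intro Iinf.power_mem eps_Iinf)

text \<open>
  The ideal generated by \<open>\<epsilon>\<close> contains no nonzero integer: a power of the relation turns \<open>\<epsilon>\<close> into \<open>1/t\<close>, and
  \<open>\<int>[1/t]\<close> is integrally closed with \<open>1/t\<close> a prime element not dividing any nonzero integer.
\<close>
lemma int_in_eps_ideal:
  assumes "of_int l = eps * i" "i \<in> Iinf"
  shows "l = 0"
proof -
  define n where "n = d * (d - 1)"
  have "of_int l ^ n = 1 / t * i ^ n" unfolding assms(1) power_mult_distrib n_def eps_power ..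
  hence "of_int l ^ n * t = i ^ n" using t_nonzero by simp
  moreover have "i ^ n \<in> Iinf" by (intro Iinf.power_mem assms)
  moreover have "of_int l ^ n * t \<in> frac_adj (1 / t)"
  proof -
    interpret Q: subfield_set "frac_adj (1 / t)" by (rule subfield_set_frac_adj)
    have "1 / t \<in> frac_adj (1 / t)" using int_adj_subset_frac_adj int_adj_self by blast
    hence "of_int l ^ n / (1 / t) \<in> frac_adj (1 / t)"
      by (rule Q.divide_mem[OF Q.power_mem[OF Q.of_int_mem]])
    moreover have "of_int l ^ n / (1 / t) = of_int l ^ n * t" using t_nonzero by simp
    ultimately show ?thesis by (simp only:)
  qed
  ultimately have "of_int l ^ n * t \<in> int_adj (1 / t)"
    using int_adj_integrally_closed[OF int_transcendental_inverse[OF t_transcendental]] by metis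
  then obtain p where "of_int l ^ n * t = poly (of_int_poly p) (1 / t)" by (auto simp: int_adj_def)
  hence "poly (of_int_poly (pCons (l ^ n) (- p))) (1 / t) = 0"
    using t_nonzero by (simp add: of_int_hom.map_poly_pCons_hom of_int_poly_hom.hom_uminus field_simps)
  hence "pCons (l ^ n) (- p) = 0"
    using int_transcendental_inverse[OF t_transcendental] unfolding int_transcendental_def by blast
  thus ?thesis using exponent_pos by (simp add: n_def)
qed

lemma near_one_Iinf: "near_one x \<Longrightarrow> x \<in> Iinf"
  by (auto simp: near_one_def intro!: Iinf.add_mem Iinf.one_mem Iinf.mult_mem eps_Iinf)

lemma near_one_1: "near_one 1"
  unfolding near_one_def by (intro bexI[of _ 0] Iinf.zero_mem) simp

lemma near_one_add:
  assumes "near_one x" "i \<in> Iinf"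
  shows "near_one (x + eps * i)"
proof -
  obtain j where "j \<in> Iinf" "x = 1 + eps * j" using assms by (auto simp: near_one_def)
  thus ?thesis unfolding near_one_def
    by (intro bexI[of _ "j + i"] Iinf.add_mem assms) (auto simp: algebra_simps)
qed

lemma near_one_mult:
  assumes "near_one x" "near_one y"
  shows "near_one (x * y)"
proof -
  obtain j where j: "j \<in> Iinf" "y = 1 + eps * j" using assms by (auto simp: near_one_def)
  have "x * y = x + eps * (x * j)" by (simp add: j algebra_simps)
  thus ?thesis using near_one_add[OF assms(1)] near_one_Iinf[OF assms(1)] j Iinf.mult_mem by metis
qed

lemma near_one_prod: "(\<And>a. a \<in> A \<Longrightarrow> near_one (h a)) \<Longrightarrow> near_one (prod h A)"
  by (induction A rule: infinite_finite_induct) (auto intro: near_one_1 near_one_mult)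

lemma near_one_power: "near_one x \<Longrightarrow> near_one (x ^ n)"
  by (induction n) (auto intro: near_one_1 near_one_mult)

text \<open>
  The inverse of an element congruent to \<open>1\<close> need not be integral, so cancellation asks for integrality of
  the other factor.
\<close>
lemma near_one_cancel:
  assumes "near_one (x * y)" "near_one y" "x \<in> Iinf"
  shows "near_one x"
proof -
  obtain j where j: "j \<in> Iinf" "y = 1 + eps * j" using assms by (auto simp: near_one_def)
  have "x = x * y + eps * (- (x * j))" by (simp add: j algebra_simps)
  moreover have "- (x * j) \<in> Iinf" using j assms by (intro Iinf.uminus_mem Iinf.mult_mem)
  ultimately show ?thesis using near_one_add[OF assms(1)] by metis
qed

text \<open>
  Changing each factor by a multiple of \<open>\<epsilon>\<close> changes the product by a multiple of \<open>\<epsilon>\<close>.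
\<close>
lemma near_one_prod_perturbed:
  assumes "finite A" "\<And>a. a \<in> A \<Longrightarrow> x a \<in> Iinf" "\<And>a. a \<in> A \<Longrightarrow> \<exists>i\<in>Iinf. y a = x a + eps * i"
    and "near_one (prod x A)"
  shows "near_one (prod y A)"
proof -
  have "\<exists>i\<in>Iinf. prod y A = prod x A + eps * i"
    using assms(1-3)
  proof (induction A rule: finite_induct)
    case empty
    show ?case by (intro bexI[of _ 0] Iinf.zero_mem) simp
  next
    case (insert a A)
    obtain i where i: "i \<in> Iinf" "prod y A = prod x A + eps * i" using insert by auto
    obtain j where j: "j \<in> Iinf" "y a = x a + eps * j" using insert.prems(2)[of a] by blast
    have xa: "x a \<in> Iinf" "prod x A \<in> Iinf" using insert by (auto intro: Iinf.prod_mem)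
    show ?case
    proof
      show "prod y (insert a A) = prod x (insert a A) + eps * (x a * i + prod x A * j + eps * j * i)"
        using insert.hyps by (simp add: i j algebra_simps)
      show "x a * i + prod x A * j + eps * j * i \<in> Iinf"
        using i j xa eps_Iinf by (intro Iinf.add_mem Iinf.mult_mem)
    qed
  qed
  thus ?thesis using near_one_add assms(4) by metis
qed

definition normalised :: "'a \<Rightarrow> 'a" where "normalised z = lam * z / sg"

lemma lam_Iinf: "lam \<in> Iinf"
  by (rule integral_over_root[OF comm_subring_int_adj, of _ "d - 1"])
     (unfold lam(1), use d in \<open>auto simp: Iinf.of_nat_mem\<close>)

lemma lam_sg_power: "(lam / sg) ^ d = 1 / c"
  using lam_nonzero d by (simp add: power_divide lam(2) sg)

lemma inverse_c_eps: "\<exists>i\<in>Iinf. 1 / c = eps * i"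
proof
  show "1 / c = eps * (lam ^ d * eps ^ (d - 1))"
    unfolding lam_sg_power[symmetric] power_divide eps_def power_one_over power_d[of sg] by simp
qed (intro Iinf.mult_mem Iinf.power_mem eps_Iinf lam_Iinf)

text \<open>
  In the coordinate \<open>v = \<lambda>z/\<sigma>\<close> the dynamics reads \<open>v\<^sup>d = d \<epsilon>\<^bsup>d-1\<^esup> v' - 1\<close>.
\<close>
lemma normalised_Iinf:
  assumes "k > 0" "z \<in> Fix k"
  shows "normalised z \<in> Iinf"
proof -
  have "normalised ((f ^^ 0) z) \<in> Iinf"
  proof (rule integral_over_if_cyclic_relation[OF comm_subring_int_adj d assms(1),
        of "of_nat d * eps ^ (d - 1)" _ "- 1" "\<lambda>i. normalised ((f ^^ i) z)"])
    show "normalised ((f ^^ i) z) ^ d = of_nat d * eps ^ (d - 1) * normalised ((f ^^ Suc i) z) + - 1" for i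
    proof -
      define w where "w = (f ^^ i) z"
      have "normalised w = lam / sg * w" by (simp add: normalised_def)
      hence "normalised w ^ d = (lam / sg) ^ d * w ^ d" by (simp only: power_mult_distrib)
      also have "\<dots> = f w / c - 1" unfolding lam_sg_power using c_nonzero by (simp add: f_def field_simps)
      also have "f w / c = of_nat d * eps ^ (d - 1) * normalised (f w)"
      proof -
        have "of_nat d * eps ^ (d - 1) * normalised (f w) = of_nat d * lam / sg ^ d * f w"
          unfolding power_d[of sg] by (simp add: normalised_def eps_def power_one_over ac_simps)
        thus ?thesis using d lam_nonzero by (simp add: sg)
      qed
      finally show ?thesis by (simp add: w_def)
    qed
  qed (use assms in \<open>auto simp: Fix_def intro!: Iinf.mult_mem Iinf.power_mem Iinf.of_nat_mem
        Iinf.uminus_mem Iinf.one_mem eps_Iinf\<close>)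
  thus ?thesis by simp
qed

text \<open>
  The iterate \<open>f\<^sup>k(0)\<close> is \<open>c\<close> to the power \<open>d\<^bsup>k-1\<^esup>\<close> plus lower powers of \<open>c\<close>, and \<open>(\<lambda>/\<sigma>)\<^sup>d = 1/c\<close>.
\<close>
lemma near_one_critical_orbit:
  "near_one ((f ^^ Suc k) 0 * (lam / sg) ^ (d ^ Suc k))"
proof (induction k)
  case 0
  have "(f ^^ Suc 0) 0 * (lam / sg) ^ (d ^ Suc 0) = 1"
    using d c_nonzero by (simp add: f_def power_0_left lam_sg_power)
  thus ?case by (simp add: near_one_1)
next
  case (Suc k)
  define q where "q = (f ^^ Suc k) 0 * (lam / sg) ^ (d ^ Suc k)"
  have "2 ^ 1 \<le> d ^ 1" using d by simp
  also have "d ^ 1 \<le> d ^ Suc k" using d by (intro power_increasing) auto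
  finally have dk: "d ^ Suc k \<ge> 2" by simp
  obtain l where l: "d ^ Suc k = Suc (Suc l)" using dk by (metis add_2_eq_Suc le_Suc_ex)
  have pw: "(lam / sg) ^ (d ^ Suc (Suc k)) = (1 / c) ^ (d ^ Suc k)"
    unfolding power_Suc[of d "Suc k"] power_mult lam_sg_power ..
  have pw': "((lam / sg) ^ (d ^ Suc k)) ^ d = (lam / sg) ^ (d ^ Suc (Suc k))"
    by (simp add: mult.commute flip: power_mult)
  obtain i where i: "i \<in> Iinf" "1 / c = eps * i" using inverse_c_eps by blast
  have "(f ^^ Suc (Suc k)) 0 * (lam / sg) ^ (d ^ Suc (Suc k))
      = q ^ d + c * (1 / c) ^ (d ^ Suc k)"
    unfolding q_def power_mult_distrib pw' pw by (simp add: f_def algebra_simps)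
  also have "c * (1 / c) ^ (d ^ Suc k) = (1 / c) * (1 / c) ^ l"
    unfolding l using c_nonzero by simp
  also have "\<dots> = eps * (i * (eps * i) ^ l)" unfolding i(2) by simp
  finally show ?case
    using Suc i(1) unfolding q_def[symmetric]
    by (auto intro!: near_one_add near_one_power Iinf.mult_mem Iinf.power_mem eps_Iinf)
qed

lemma even_d_times: "even (d * (d - 1))"
  using d by auto

text \<open>
  The product of the fixed points is, up to sign, the constant term \<open>f\<^sup>k(0)\<close> of \<open>f\<^sup>k(z) - z\<close>. The exponent
  \<open>d - 1\<close> removes the sign, as \<open>d(d-1)\<close> is even.
\<close>
lemma near_one_prod_Fix:
  assumes "k > 0"
  shows "near_one (\<Prod>z\<in>Fix k. normalised z ^ (d - 1))"
proof -
  obtain l where l: "k = Suc l" using assms by (cases k) auto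
  have "(f ^^ k) 0 = poly (iter_poly k - [:0, 1:]) 0" by (simp add: poly_iter_poly)
  also have "\<dots> = (\<Prod>z\<in>Fix k. - z)"
    unfolding fixed_point_poly_eq_prod[OF assms] by (simp add: poly_prod)
  finally have "(f ^^ k) 0 * (lam / sg) ^ (d ^ k) = (\<Prod>z\<in>Fix k. - z * (lam / sg))"
    unfolding prod.distrib prod_constant card_Fix[OF assms] by simp
  also have "\<dots> = (\<Prod>z\<in>Fix k. - normalised z)" by (simp add: normalised_def mult.commute)
  finally have "near_one ((\<Prod>z\<in>Fix k. - normalised z) ^ (d - 1))"
    using near_one_power[OF near_one_critical_orbit[of l], of "d - 1"] l by simp
  also have "(\<Prod>z\<in>Fix k. - normalised z) ^ (d - 1) = ((- 1) ^ (d ^ k)) ^ (d - 1) * (\<Prod>z\<in>Fix k. normalised z) ^ (d - 1)"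
    by (simp add: prod_uminus card_Fix[OF assms] power_mult_distrib)
  also have "((- 1 :: 'a) ^ (d ^ k)) ^ (d - 1) = 1"
  proof -
    have "even (d ^ k * (d - 1))" unfolding l using even_d_times by auto
    thus ?thesis unfolding power_mult[symmetric] by (rule neg_one_even_power)
  qed
  finally show ?thesis by (simp add: prod_power_distrib)
qed

text \<open>
  The product over the fixed points of \<open>f\<^sup>m\<close> splits by exact period; the factors belonging to proper
  divisors cancel by induction.
\<close>
lemma near_one_prod_Per:
  "m > 0 \<Longrightarrow> near_one (\<Prod>z\<in>Per m. normalised z ^ (d - 1))"
proof (induction m rule: less_induct)
  case (less m)
  define nu where "nu = (\<lambda>m. \<Prod>z\<in>Per m. normalised z ^ (d - 1))"
  have "near_one (nu m * (\<Prod>j | j dvd m \<and> j < m. nu j))"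
    using near_one_prod_Fix[OF less.prems] less.prems
    by (simp add: prod_Fix divisors_insert nu_def)
  moreover have "near_one (\<Prod>j | j dvd m \<and> j < m. nu j)"
  proof (rule near_one_prod)
    fix j assume "j \<in> {j. j dvd m \<and> j < m}"
    thus "near_one (nu j)" unfolding nu_def using less by (auto intro: dvd_pos_nat)
  qed
  moreover have "nu m \<in> Iinf"
    unfolding nu_def using Per_subset_Fix by (intro Iinf.prod_mem Iinf.power_mem normalised_Iinf[OF less.prems]) auto
  ultimately have "near_one (nu m)" by (rule near_one_cancel)
  thus ?case by (simp only: nu_def)
qed

lemma mult_eq_normalised:
  assumes "C \<in> cycles m" "m > 0"
  shows "cycle_mult C = sg ^ (m * (d - 1)) * (\<Prod>z\<in>C. normalised z ^ (d - 1))"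
proof -
  have "of_nat d * z ^ (d - 1) = sg ^ (d - 1) * normalised z ^ (d - 1)" for z
    using sg_nonzero unfolding normalised_def power_mult_distrib[symmetric] by (simp add: power_mult_distrib lam(1)[simplified])
  thus ?thesis using orbit_fibre(2)[OF assms]
    unfolding cycle_mult_def by (simp add: prod.distrib power_mult[symmetric] mult.commute)
qed

text \<open>
  This makes the power of \<open>\<sigma>\<close> that is split off from the product over all cycles a power of
  \<open>\<sigma>\<^bsup>d(d-1)\<^esup> = t\<close>.
\<close>
lemma d_dvd_card_Per: "m > 0 \<Longrightarrow> d dvd card (Per m)"
proof (induction m rule: less_induct)
  case (less m)
  have "d ^ m = card (Per m) + (\<Sum>j | j dvd m \<and> j < m. card (Per j))"
    using sum_Fix[OF less.prems, of "\<lambda>_. 1 :: nat"] less.prems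
    by (simp add: card_Fix divisors_insert)
  moreover have "d dvd (\<Sum>j | j dvd m \<and> j < m. card (Per j))"
    using less by (intro dvd_sum) (auto intro: dvd_pos_nat)
  moreover have "d dvd d ^ m" using less.prems by simp
  ultimately show ?case
    using dvd_add_left_iff[of d "\<Sum>j | j dvd m \<and> j < m. card (Per j)" "card (Per m)"] by simp
qed

text \<open>
  For large argument only the leading term of a monic polynomial matters.
\<close>
lemma monic_poly_scaled:
  fixes q :: "int poly"
  assumes "lead_coeff q = 1" "\<rho> \<in> Iinf" "u \<in> Iinf" "u \<noteq> 0"
  shows "\<exists>i\<in>Iinf. poly (of_int_poly q) (\<rho> / u) * u ^ degree q = \<rho> ^ degree q + u * i"
proof
  define e where "e = degree q"
  define i where "i = (\<Sum>j<e. of_int (coeff q j) * \<rho> ^ j * u ^ (e - 1 - j))"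
  show "i \<in> Iinf" unfolding i_def
    by (intro Iinf.sum_mem Iinf.mult_mem Iinf.power_mem Iinf.of_int_mem assms)
  have "poly (of_int_poly q) (\<rho> / u) * u ^ e = (\<Sum>j\<le>e. of_int (coeff q j) * (\<rho> / u) ^ j * u ^ e)"
    by (simp add: poly_altdef e_def sum_distrib_right)
  also have "\<dots> = (\<Sum>j<e. of_int (coeff q j) * (\<rho> / u) ^ j * u ^ e) + \<rho> ^ e"
    using assms by (simp add: lessThan_Suc_atMost[symmetric] e_def power_divide)
  also have "(\<Sum>j<e. of_int (coeff q j) * (\<rho> / u) ^ j * u ^ e) = u * i"
    unfolding i_def sum_distrib_left
  proof (intro sum.cong refl)
    fix j assume "j \<in> {..<e}"
    hence "u ^ e = u ^ (Suc (e - 1 - j) + j)" by (intro arg_cong[of _ _ "\<lambda>n. u ^ n"]) auto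
    hence "u ^ e = u * u ^ (e - 1 - j) * u ^ j" unfolding power_add power_Suc .
    thus "of_int (coeff q j) * (\<rho> / u) ^ j * u ^ e = u * (of_int (coeff q j) * \<rho> ^ j * u ^ (e - 1 - j))"
      using assms(4) by (simp add: power_divide)
  qed
  finally show "poly (of_int_poly q) (\<rho> / u) * u ^ degree q = \<rho> ^ degree q + u * i"
    by (simp add: e_def add.commute)
qed

text \<open>
  The power of \<open>\<sigma>\<close> split off from \<open>q(\<omega>\<^sub>C)\<close> leaves a power of the product of \<open>v\<^bsup>d-1\<^esup>\<close> over the cycle, with \<open>v = \<lambda>z/\<sigma>\<close>, up to
  a multiple of \<open>\<epsilon>\<close>; multiplied over all cycles these give a power of the product over \<open>Per m\<close>, which is
  congruent to \<open>1\<close>.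
\<close>
lemma prod_poly_mult_asymptotic:
  fixes q :: "int poly"
  assumes m: "m > 0" and q: "lead_coeff q = 1"
  shows "\<exists>D. near_one ((\<Prod>C\<in>cycles m. poly (of_int_poly q) (cycle_mult C)) * (1 / t) ^ D)"
proof -
  define e where "e = degree q"
  \<comment> \<open>A cycle has \<open>m\<close> points, each contributing \<open>\<sigma>\<^bsup>d-1\<^esup>\<close> to the multiplier.\<close>
  define u where "u = eps ^ (m * (d - 1))"
  define \<rho> where "\<rho> = (\<lambda>C. \<Prod>z\<in>C. normalised z ^ (d - 1))"
  have u: "u \<noteq> 0" "u \<in> Iinf" unfolding u_def
    using sg_nonzero by (auto simp: eps_def intro!: Iinf.power_mem eps_Iinf[unfolded eps_def])
  have mult_eq: "cycle_mult C = \<rho> C / u" if "C \<in> cycles m" for C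
    using mult_eq_normalised[OF that m] by (simp add: \<rho>_def u_def eps_def power_one_over)
  have \<rho>: "\<rho> C \<in> Iinf" if "C \<in> cycles m" for C
  proof -
    have "C \<subseteq> Fix m" using that m orbit_subset_Per Per_subset_Fix by (fastforce simp: cycles_def)
    thus ?thesis unfolding \<rho>_def by (intro Iinf.prod_mem Iinf.power_mem normalised_Iinf[OF m]) auto
  qed
  have "m * (d - 1) > 0" using m d by simp
  hence "u = eps * eps ^ (m * (d - 1) - 1)" unfolding u_def by (metis power_Suc Suc_diff_1)
  hence u_eps: "\<exists>j\<in>Iinf. u * i = eps * j" if "i \<in> Iinf" for i
    using that by (intro bexI[of _ "eps ^ (m * (d - 1) - 1) * i"] Iinf.mult_mem Iinf.power_mem eps_Iinf)
      (auto simp: mult.assoc)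
  have near: "near_one (\<Prod>C\<in>cycles m. poly (of_int_poly q) (cycle_mult C) * u ^ e)"
  proof (rule near_one_prod_perturbed[of _ "\<lambda>C. \<rho> C ^ e"])
    show "near_one (\<Prod>C\<in>cycles m. \<rho> C ^ e)"
      unfolding prod_power_distrib[symmetric] \<rho>_def prod_over_cycles[OF m]
      by (intro near_one_power near_one_prod_Per[OF m, unfolded prod_power_distrib[symmetric]])
    show "\<exists>i\<in>Iinf. poly (of_int_poly q) (cycle_mult C) * u ^ e = \<rho> C ^ e + eps * i" if C: "C \<in> cycles m" for C
    proof -
      obtain i where "i \<in> Iinf" "poly (of_int_poly q) (\<rho> C / u) * u ^ e = \<rho> C ^ e + u * i"
        using monic_poly_scaled[OF q \<rho>[OF C] u(2,1)] by (auto simp: e_def)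
      thus ?thesis using u_eps[of i] mult_eq[OF C] by metis
    qed
  qed (use \<rho> m in \<open>auto simp: finite_cycles intro: Iinf.power_mem\<close>)
  obtain D where D: "card (Per m) = d * D" using d_dvd_card_Per[OF m] by blast
  have "(\<Prod>C\<in>cycles m. u ^ e) = eps ^ (m * (d - 1) * e * card (cycles m))"
    by (simp add: u_def power_mult[symmetric])
  also have "m * (d - 1) * e * card (cycles m) = (d - 1) * e * card (Per m)"
    unfolding card_Per[OF m] by (simp only: ac_simps)
  also have "\<dots> = d * (d - 1) * (e * D)" unfolding D by (simp only: ac_simps)
  finally have "(\<Prod>C\<in>cycles m. u ^ e) = (1 / t) ^ (e * D)"
    by (simp only: power_mult eps_power[unfolded power_mult])
  thus ?thesis using near unfolding prod.distrib by metis
qed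

text \<open>
  Comparing \<open>P(t)\<close> with \<open>t\<^sup>D\<close>: if the degree of \<open>P\<close> were not \<open>D\<close>, a nonzero integer would be a multiple of
  \<open>\<epsilon>\<close>; so the degrees agree and the leading coefficient is congruent to \<open>1\<close>, hence equal to it.
\<close>
lemma monic_if_near_one:
  fixes P :: "int poly"
  assumes near: "near_one (poly (of_int_poly P) t * (1 / t) ^ D)"
  shows "lead_coeff P = 1"
proof -
  define k where "k = degree P"
  obtain i where i: "i \<in> Iinf" "poly (of_int_poly P) t * (1 / t) ^ D = 1 + eps * i"
    using near by (auto simp: near_one_def)
  obtain j where j: "j \<in> Iinf" "1 / t = eps * j" using inverse_t_eps by blast
  have no: "of_int l = eps * x \<Longrightarrow> x \<in> Iinf \<Longrightarrow> l = 0" for l x by (rule int_in_eps_ideal)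
  have P0: "P \<noteq> 0"
  proof
    assume "P = 0"
    hence "of_int 1 = eps * (- i)" using i(2) by (simp add: eq_neg_iff_add_eq_0)
    thus False using no[of 1 "- i"] i(1) by (simp add: Iinf.uminus_mem)
  qed
  have "\<exists>e\<in>Iinf. poly (of_int_poly P) t * (1 / t) ^ k = of_int (lead_coeff P) + eps * e"
  proof -
    obtain l Q where lQ: "reflect_poly P = pCons l Q" by (cases "reflect_poly P")
    hence l: "l = lead_coeff P" by (metis coeff_0_reflect_poly coeff_pCons_0)
    have "of_int_poly (reflect_poly P) = (reflect_poly (of_int_poly P) :: 'a poly)"
      by (intro poly_eqI) (auto simp: coeff_reflect_poly)
    hence "poly (of_int_poly P) t * (1 / t) ^ k = poly (of_int_poly (reflect_poly P)) (1 / t)"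
      using t_nonzero by (simp add: poly_reflect_poly_nz k_def mult.commute inverse_eq_divide)
    also have "\<dots> = of_int l + 1 / t * poly (of_int_poly Q) (1 / t)"
      by (simp add: lQ of_int_hom.map_poly_pCons_hom)
    also have "\<dots> = of_int (lead_coeff P) + eps * (j * poly (of_int_poly Q) (1 / t))"
      unfolding l j(2) by simp
    finally show ?thesis
      by (rule bexI) (intro Iinf.mult_mem Iinf.poly_mem inverse_t_Iinf j(1), simp add: Iinf.of_int_mem)
  qed
  then obtain e where e: "e \<in> Iinf" "poly (of_int_poly P) t * (1 / t) ^ k = of_int (lead_coeff P) + eps * e"
    by blast
  consider "k = D" | "k > D" | "k < D" by linarith
  thus ?thesis
  proof cases
    case 1
    hence "of_int (lead_coeff P - 1) = eps * (i - e)" using i(2) e(2) by (simp add: algebra_simps)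
    thus ?thesis using no[of "lead_coeff P - 1" "i - e"] i(1) e(1) Iinf.diff_mem by simp
  next
    case 2
    then obtain r where r: "k = D + Suc r" using less_imp_Suc_add by auto
    have "of_int (lead_coeff P) + eps * e = (1 + eps * i) * (1 / t) ^ Suc r"
      unfolding e(2)[symmetric] r power_add i(2)[symmetric] by (simp only: ac_simps)
    also have "\<dots> = eps * ((1 + eps * i) * j * (1 / t) ^ r)" unfolding power_Suc by (subst j(2)) (simp only: ac_simps)
    finally have "of_int (lead_coeff P) = eps * ((1 + eps * i) * j * (1 / t) ^ r - e)"
      by (simp add: algebra_simps)
    hence "lead_coeff P = 0"
      by (rule no) (intro Iinf.diff_mem Iinf.mult_mem Iinf.add_mem Iinf.power_mem Iinf.one_mem
                      eps_Iinf inverse_t_Iinf i j e)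
    thus ?thesis using P0 by simp
  next
    case 3
    then obtain r where r: "D = k + Suc r" using less_imp_Suc_add by auto
    have "1 + eps * i = (of_int (lead_coeff P) + eps * e) * (1 / t) ^ Suc r"
      unfolding e(2)[symmetric] i(2)[symmetric] r power_add by (simp only: ac_simps)
    also have "\<dots> = eps * ((of_int (lead_coeff P) + eps * e) * j * (1 / t) ^ r)"
      unfolding power_Suc by (subst j(2)) (simp only: ac_simps)
    finally have "of_int 1 = eps * ((of_int (lead_coeff P) + eps * e) * j * (1 / t) ^ r - i)"
      by (simp add: algebra_simps)
    hence "(1 :: int) = 0"
      by (rule no) (intro Iinf.diff_mem Iinf.mult_mem Iinf.add_mem Iinf.power_mem Iinf.of_int_mem
                      eps_Iinf inverse_t_Iinf i j e)
    thus ?thesis by simp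
  qed
qed

lemma prod_poly_mult_eq_monic:
  fixes q :: "int poly"
  assumes "m > 0" "lead_coeff q = 1"
  shows "\<exists>P :: int poly. (\<Prod>C\<in>cycles m. poly (of_int_poly q) (cycle_mult C)) = poly (of_int_poly P) t
    \<and> lead_coeff P = 1"
proof -
  obtain P where P: "(\<Prod>C\<in>cycles m. poly (of_int_poly q) (cycle_mult C)) = poly (of_int_poly P) t"
    using prod_poly_mult_mem[OF assms(1)] by (auto simp: int_adj_def)
  thus ?thesis using prod_poly_mult_asymptotic[OF assms] monic_if_near_one by metis
qed

end

section \<open>Dynamical units\<close>

context unicritical_dynamics
begin

definition unit_Ic :: "'a \<Rightarrow> bool" where
  "unit_Ic x \<longleftrightarrow> x \<in> Ic \<and> inverse x \<in> Ic \<and> x \<noteq> 0"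

lemma unit_Ic_prod: "(\<And>a. a \<in> A \<Longrightarrow> unit_Ic (h a)) \<Longrightarrow> unit_Ic (prod h A)"
  by (induction A rule: infinite_finite_induct)
     (auto simp: unit_Ic_def intro: Ic.mult_mem Ic.one_mem)

lemma unit_Ic_mult: "unit_Ic x \<Longrightarrow> unit_Ic y \<Longrightarrow> unit_Ic (x * y)"
  by (auto simp: unit_Ic_def intro: Ic.mult_mem)

lemma unit_Ic_inverse: "unit_Ic x \<Longrightarrow> unit_Ic (inverse x)"
  by (auto simp: unit_Ic_def)

lemma unit_Ic_factor:
  assumes "x \<in> Ic" "y \<in> Ic" "x * y = 1"
  shows "unit_Ic x"
proof -
  have "inverse x = y" using assms(3) by (rule inverse_unique)
  thus ?thesis using assms by (auto simp: unit_Ic_def)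
qed

lemma c_Ic: "c \<in> Ic"
  using subset_integral_over[OF comm_subring_int_adj] c_mem by blast

lemma Per_integral: "k > 0 \<Longrightarrow> z \<in> Per k \<Longrightarrow> z \<in> Ic"
  using Fix_integral Per_subset_Fix by blast

lemma iterate_integral: "x \<in> Ic \<Longrightarrow> (f ^^ n) x \<in> Ic"
  by (induction n) (auto simp: f_def intro!: Ic.add_mem Ic.power_mem c_Ic)

text \<open>
  Polynomials with coefficients in a ring send congruent elements to congruent elements.
\<close>
lemma iterate_diff_dvd:
  assumes "x \<in> Ic" "y \<in> Ic"
  shows "\<exists>u\<in>Ic. (f ^^ n) x - (f ^^ n) y = (x - y) * u"
proof (induction n)
  case 0
  show ?case by (intro bexI[of _ 1] Ic.one_mem) simp
next
  case (Suc n)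
  then obtain u where u: "u \<in> Ic" "(f ^^ n) x - (f ^^ n) y = (x - y) * u" by blast
  define v where "v = (\<Sum>i<d. (f ^^ n) y ^ (d - Suc i) * (f ^^ n) x ^ i)"
  have "(f ^^ Suc n) x - (f ^^ Suc n) y = (x - y) * (u * v)"
    unfolding v_def by (simp add: f_def power_diff_sumr2[of "(f ^^ n) x"] u(2) mult.assoc)
  moreover have "v \<in> Ic" unfolding v_def
    by (intro Ic.sum_mem Ic.mult_mem Ic.power_mem iterate_integral assms)
  ultimately show ?case using u(1) Ic.mult_mem by blast
qed

lemma iterate_multiple_diff_dvd:
  assumes "x \<in> Ic"
  shows "\<exists>u\<in>Ic. (f ^^ (a * j)) x - x = ((f ^^ j) x - x) * u"
proof (induction a)
  case 0
  show ?case by (intro bexI[of _ 0] Ic.zero_mem) simp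
next
  case (Suc a)
  then obtain u where u: "u \<in> Ic" "(f ^^ (a * j)) x - x = ((f ^^ j) x - x) * u" by blast
  obtain v where v: "v \<in> Ic" "(f ^^ (a * j)) ((f ^^ j) x) - (f ^^ (a * j)) x = ((f ^^ j) x - x) * v"
    using iterate_diff_dvd[OF iterate_integral[OF assms] assms] by blast
  have "(f ^^ (Suc a * j)) x = (f ^^ (a * j + j)) x" by (simp add: add.commute)
  hence "(f ^^ (Suc a * j)) x - x = ((f ^^ j) x - x) * (u + v)"
    using u(2) v(2) by (simp add: funpow_add algebra_simps funpow_commute[of j "a * j"])
  thus ?case using u(1) v(1) Ic.add_mem by blast
qed

text \<open>
  The value at \<open>x\<close> of the polynomial with roots \<open>Per i\<close>, except that a vanishing factor is left out. For
  \<open>x \<in> Per i\<close> it is the value of the derivative; this makes the factorisations over all divisors below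
  valid whether or not \<open>x\<close> is a root.
\<close>
definition dist_prod :: "nat \<Rightarrow> 'a \<Rightarrow> 'a" where
  "dist_prod i x = (\<Prod>z\<in>Per i. if z = x then 1 else x - z)"

lemma dist_prod_integral: "i > 0 \<Longrightarrow> x \<in> Ic \<Longrightarrow> dist_prod i x \<in> Ic"
  unfolding dist_prod_def using Per_integral
  by (intro Ic.prod_mem) (auto intro: Ic.one_mem Ic.diff_mem)

lemma prod_dist_prod_not_fixed:
  assumes "j > 0" "(f ^^ j) x \<noteq> x"
  shows "(\<Prod>i | i dvd j. dist_prod i x) = (f ^^ j) x - x"
proof -
  have "(\<Prod>i | i dvd j. dist_prod i x) = (\<Prod>z\<in>Fix j. if z = x then 1 else x - z)"
    unfolding dist_prod_def by (rule prod_Fix[OF assms(1), symmetric])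
  also have "\<dots> = (\<Prod>z\<in>Fix j. x - z)"
    using assms(2) by (intro prod.cong) (auto simp: Fix_def)
  also have "\<dots> = poly (iter_poly j - [:0, 1:]) x"
    unfolding fixed_point_poly_eq_prod[OF assms(1)] by (simp add: poly_prod)
  also have "\<dots> = (f ^^ j) x - x" by (simp add: poly_iter_poly)
  finally show ?thesis .
qed

lemma prod_dist_prod_fixed:
  assumes "j > 0" "(f ^^ j) x = x"
  shows "(\<Prod>i | i dvd j. dist_prod i x) = poly (pderiv (iter_poly j)) x - 1"
proof -
  have x: "x \<in> Fix j" using assms by (simp add: Fix_def)
  have "(\<Prod>i | i dvd j. dist_prod i x) = (\<Prod>z\<in>Fix j. if z = x then 1 else x - z)"
    unfolding dist_prod_def by (rule prod_Fix[OF assms(1), symmetric])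
  also have "\<dots> = (\<Prod>z\<in>Fix j - {x}. x - z)"
    unfolding prod.remove[OF finite_Fix[OF assms(1)] x] by simp
  also have "\<dots> = poly (pderiv (\<Prod>z\<in>Fix j. [:- z, 1:])) x"
    unfolding prod.remove[OF finite_Fix[OF assms(1)] x] pderiv_mult
    by (simp add: poly_prod pderiv_pCons)
  also have "\<dots> = poly (pderiv (iter_poly j)) x - 1"
    unfolding fixed_point_poly_eq_prod[OF assms(1), symmetric] by (simp add: pderiv_diff pderiv_pCons)
  finally show ?thesis .
qed

lemma pderiv_iter_poly_add:
  "poly (pderiv (iter_poly (a + b))) z = poly (pderiv (iter_poly a)) ((f ^^ b) z) * poly (pderiv (iter_poly b)) z"
  unfolding poly_pderiv_iter_poly by (induction a) (simp_all add: funpow_add mult_ac)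

lemma pderiv_iter_poly_multiple:
  assumes "(f ^^ k) z = z"
  shows "poly (pderiv (iter_poly (k * l))) z = poly (pderiv (iter_poly k)) z ^ l"
  by (induction l) (simp_all add: pderiv_iter_poly_add[of k] pderiv_iter_poly_add[of _ k] assms
        pderiv_pCons add.commute[of k])

text \<open>
  If neither of \<open>i\<close> and the period \<open>k\<close> of \<open>x\<close> divides the other, let \<open>e = gcd i k\<close>. As \<open>i\<close> and \<open>e\<close> generate the same
  subgroup modulo \<open>k\<close>, each of \<open>f\<^sup>i(x) - x\<close> and \<open>f\<^sup>e(x) - x\<close> divides the other. Their quotient is a
  unit, and it has \<open>dist_prod i x\<close> as a factor.
\<close>
lemma dist_prod_unit:
  assumes k: "k > 0" "x \<in> Per k" and i: "i > 0" "\<not> k dvd i" "\<not> i dvd k"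
  shows "unit_Ic (dist_prod i x)"
proof -
  define e where "e = gcd i k"
  have x: "x \<in> Ic" using Per_integral k by blast
  have e: "e > 0" "e dvd i" "\<not> k dvd e" "\<not> i dvd e"
    using i unfolding e_def by (auto dest: dvd_trans)
  have he: "(f ^^ e) x \<noteq> x" and hi: "(f ^^ i) x \<noteq> x"
    using Per_dvd_iff[OF k(2,1)] e i by auto
  \<comment> \<open>Bezout: some multiple of \<open>i\<close> is congruent to \<open>e\<close> modulo the period.\<close>
  obtain a where a: "[i * a = e] (mod k)" using cong_solve_nat[of i k] i(1) by (auto simp: e_def)
  have "(f ^^ (a * i)) x = (f ^^ (a * i mod k)) x"
    using k by (intro funpow_mod_eq[symmetric]) (simp add: Per_def)
  also have "a * i mod k = e mod k" using a by (simp add: cong_def mult.commute)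
  also have "(f ^^ (e mod k)) x = (f ^^ e) x"
    using k by (intro funpow_mod_eq) (simp add: Per_def)
  finally obtain u where u: "u \<in> Ic" "(f ^^ e) x - x = ((f ^^ i) x - x) * u"
    using iterate_multiple_diff_dvd[OF x, of a i] by auto
  have fin: "finite {l. l dvd i}" using i by simp
  have sub: "{l. l dvd e} \<subseteq> {l. l dvd i}" using e by (auto dest: dvd_trans)
  have "(\<Prod>l | l dvd i. dist_prod l x) =
      (\<Prod>l\<in>{l. l dvd i} - {l. l dvd e}. dist_prod l x) * (\<Prod>l | l dvd e. dist_prod l x)"
    by (rule prod.subset_diff[OF sub fin])
  also have "(\<Prod>l\<in>{l. l dvd i} - {l. l dvd e}. dist_prod l x) =
      dist_prod i x * (\<Prod>l\<in>{l. l dvd i} - {l. l dvd e} - {i}. dist_prod l x)"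
    using fin e by (intro prod.remove) auto
  finally have "(f ^^ i) x - x = dist_prod i x *
      (\<Prod>l\<in>{l. l dvd i} - {l. l dvd e} - {i}. dist_prod l x) * ((f ^^ e) x - x)"
    unfolding prod_dist_prod_not_fixed[OF i(1) hi] prod_dist_prod_not_fixed[OF e(1) he] .
  hence "((f ^^ e) x - x) * 1 = ((f ^^ e) x - x) * (dist_prod i x *
      ((\<Prod>l\<in>{l. l dvd i} - {l. l dvd e} - {i}. dist_prod l x) * u))"
    using u(2) by (simp add: mult_ac)
  hence "dist_prod i x * ((\<Prod>l\<in>{l. l dvd i} - {l. l dvd e} - {i}. dist_prod l x) * u) = 1"
    using he by (metis mult_cancel_left right_minus_eq)
  moreover have "(\<Prod>l\<in>{l. l dvd i} - {l. l dvd e} - {i}. dist_prod l x) * u \<in> Ic"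
    using x u(1) i(1) by (intro Ic.mult_mem Ic.prod_mem dist_prod_integral) (auto intro: dvd_pos_nat)
  ultimately show ?thesis by (intro unit_Ic_factor dist_prod_integral i x)
qed

abbreviation cyc_at :: "nat \<Rightarrow> 'a \<Rightarrow> 'a" where
  "cyc_at r w \<equiv> poly (of_int_poly (cyclotomic r)) w"

lemma prod_cyc_at:
  assumes "r > 0"
  shows "(\<Prod>l | l dvd r. cyc_at l w) = w ^ r - 1"
proof -
  have "(\<Prod>l | l dvd r. cyc_at l w) = poly (of_int_poly (\<Prod>l | l dvd r. cyclotomic l)) w"
    by (simp add: of_int_poly_hom.hom_prod poly_prod)
  also have "\<dots> = w ^ r - 1"
    unfolding prod_cyclotomic[OF assms]
    by (simp add: of_int_poly_hom.hom_minus of_int_poly_hom.hom_power poly_power)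
  finally show ?thesis .
qed

lemma cyc_at_nonzero:
  assumes "k > 0" "x \<in> Per k" "r > 0"
  shows "cyc_at r (poly (pderiv (iter_poly k)) x) \<noteq> 0"
proof
  assume "cyc_at r (poly (pderiv (iter_poly k)) x) = 0"
  hence "(\<Prod>l | l dvd r. cyc_at l (poly (pderiv (iter_poly k)) x)) = 0"
    using assms(3) by (intro prod_zero bexI[of _ r]) auto
  thus False unfolding prod_cyc_at[OF assms(3)]
    using pderiv_iter_poly_not_root_of_unity[OF assms(1) _ assms(3), of x] assms(2) Per_subset_Fix by auto
qed

text \<open>
  At a point of period \<open>k\<close> with multiplier \<open>w\<close>, the dynatomic polynomial of level \<open>k r\<close> is \<open>\<Phi>\<^sub>r(w)\<close> up to a
  unit. Both sides arise by inverting a product over divisors with the same total \<open>w\<^sup>r - 1\<close>: on the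
  left over the divisors of \<open>k r\<close>, on the right over the divisors of \<open>r\<close>. The divisors of \<open>k r\<close> are those
  of \<open>k\<close>, the multiples \<open>k l\<close>, and those incomparable with \<open>k\<close>, which contribute units only.
\<close>
lemma dist_prod_multiple_period:
  assumes k: "k > 0" "x \<in> Per k"
  shows "r > 1 \<Longrightarrow> \<exists>u. unit_Ic u \<and>
    dist_prod (k * r) x = cyc_at r (poly (pderiv (iter_poly k)) x) * u"
proof (induction r rule: less_induct)
  case (less r)
  define w where "w = poly (pderiv (iter_poly k)) x"
  define L where "L = {l. l dvd r \<and> l < r} - {1}"
  define I where "I = {i. i dvd k * r \<and> \<not> i dvd k \<and> \<not> k dvd i}"
  have x: "(f ^^ k) x = x" using k by (simp add: Per_def)
  have xr: "(f ^^ (k * r)) x = x" using Per_dvd_iff[OF k(2,1)] by simp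
  have r0: "r > 0" using less.prems by simp
  have finL: "finite L" using r0 by (simp add: L_def)
  have finI: "finite I" unfolding I_def using k r0 by simp
  have "\<exists>u. \<forall>l\<in>L. unit_Ic (u l) \<and> dist_prod (k * l) x = cyc_at l w * u l"
  proof (rule bchoice, rule ballI)
    fix l assume "l \<in> L"
    hence "l < r" "l > 1" unfolding L_def using r0 by (auto simp: less_Suc_eq_0_disj intro: Nat.gr0I ccontr)
    thus "\<exists>u. unit_Ic u \<and> dist_prod (k * l) x = cyc_at l w * u"
      using less.IH unfolding w_def by blast
  qed
  then obtain u where u: "\<And>l. l \<in> L \<Longrightarrow> unit_Ic (u l)"
    "\<And>l. l \<in> L \<Longrightarrow> dist_prod (k * l) x = cyc_at l w * u l" by blast
  \<comment> \<open>The factor of index \<open>1\<close> cancels against the divisors of \<open>k\<close>, and \<open>L\<close> is covered by induction.\<close>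
  have divisors_r: "{l. l dvd r} = insert 1 (insert r L)"
    using less.prems unfolding L_def by (auto dest: dvd_imp_le)
  have divisors_kr: "{i. i dvd k * r} = {i. i dvd k} \<union> (insert (k * r) ((\<lambda>l. k * l) ` L) \<union> I)"
  proof (intro equalityI subsetI)
    fix i assume i: "i \<in> {i. i dvd k * r}"
    show "i \<in> {i. i dvd k} \<union> (insert (k * r) ((\<lambda>l. k * l) ` L) \<union> I)"
    proof (cases "k dvd i")
      case True
      then obtain l where l: "i = k * l" by blast
      hence "l dvd r" using i k by simp
      hence "l \<in> insert 1 (insert r L)" unfolding divisors_r[symmetric] by simp
      thus ?thesis using l by auto
    next
      case False
      thus ?thesis using i by (auto simp: I_def)
    qed
  next
    fix i assume "i \<in> {i. i dvd k} \<union> (insert (k * r) ((\<lambda>l. k * l) ` L) \<union> I)"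
    thus "i \<in> {i. i dvd k * r}" by (auto simp: I_def L_def)
  qed
  have inj: "inj_on (\<lambda>l. k * l) L" using k by (simp add: inj_on_def)
  have notin: "k * r \<notin> (\<lambda>l. k * l) ` L" using k by (auto simp: L_def)
  have notin': "1 \<notin> insert r L" "r \<notin> L" using less.prems by (auto simp: L_def)
  \<comment> \<open>The divisors \<open>i\<close> of \<open>k * r\<close> are sorted by their position relative to \<open>k\<close>.\<close>
  have "(\<Prod>i | i dvd k * r. dist_prod i x) = (\<Prod>i | i dvd k. dist_prod i x) *
      (dist_prod (k * r) x * (\<Prod>l\<in>L. dist_prod (k * l) x) * (\<Prod>i\<in>I. dist_prod i x))"
  proof -
    have l1: "l = 1" if "k * l dvd k" for l using that k by (metis dvd_mult_cancel1)
    have d1: "{i. i dvd k} \<inter> (insert (k * r) ((\<lambda>l. k * l) ` L) \<union> I) = {}"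
      using l1 less.prems k(1) by (auto simp: L_def I_def)
    have d2: "insert (k * r) ((\<lambda>l. k * l) ` L) \<inter> I = {}" by (auto simp: I_def)
    show ?thesis unfolding divisors_kr
      using finL finI k notin
      by (subst prod.union_disjoint[OF _ _ d1], simp, simp)
         (subst prod.union_disjoint[OF _ _ d2], simp_all add: prod.reindex[OF inj])
  qed
  also have "(\<Prod>i | i dvd k * r. dist_prod i x) = w ^ r - 1"
    using k r0 unfolding prod_dist_prod_fixed[OF _ xr, simplified] w_def
    by (simp add: prod_dist_prod_fixed[OF _ xr] pderiv_iter_poly_multiple[OF x])
  also have "(\<Prod>i | i dvd k. dist_prod i x) = w - 1"
    unfolding prod_dist_prod_fixed[OF k(1) x] w_def ..
  also have "w ^ r - 1 = cyc_at 1 w * (cyc_at r w * (\<Prod>l\<in>L. cyc_at l w))"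
    unfolding prod_cyc_at[OF r0, symmetric] divisors_r using finL notin' by simp
  also have "cyc_at 1 w = w - 1" by (simp add: cyclotomic_1[simplified])
  finally have "(w - 1) * (cyc_at r w * (\<Prod>l\<in>L. cyc_at l w)) = (w - 1) *
      (dist_prod (k * r) x * (\<Prod>l\<in>L. dist_prod (k * l) x) * (\<Prod>i\<in>I. dist_prod i x))" .
  moreover have "w - 1 \<noteq> 0"
    using pderiv_iter_poly_not_root_of_unity[OF k(1), of x 1] k(2) Per_subset_Fix by (auto simp: w_def)
  ultimately have "cyc_at r w * (\<Prod>l\<in>L. cyc_at l w) =
      dist_prod (k * r) x * (\<Prod>l\<in>L. dist_prod (k * l) x) * (\<Prod>i\<in>I. dist_prod i x)" by simp
  also have "(\<Prod>l\<in>L. dist_prod (k * l) x) = (\<Prod>l\<in>L. cyc_at l w) * (\<Prod>l\<in>L. u l)"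
    using u(2) by (simp flip: prod.distrib)
  finally have "(\<Prod>l\<in>L. cyc_at l w) * cyc_at r w = (\<Prod>l\<in>L. cyc_at l w) *
      (dist_prod (k * r) x * ((\<Prod>l\<in>L. u l) * (\<Prod>i\<in>I. dist_prod i x)))" by (simp add: mult_ac)
  moreover have "(\<Prod>l\<in>L. cyc_at l w) \<noteq> 0"
    using finL cyc_at_nonzero[OF k] unfolding w_def L_def by (auto intro: dvd_pos_nat[OF r0])
  ultimately have eq: "cyc_at r w = dist_prod (k * r) x * ((\<Prod>l\<in>L. u l) * (\<Prod>i\<in>I. dist_prod i x))"
    by simp
  have unit: "unit_Ic ((\<Prod>l\<in>L. u l) * (\<Prod>i\<in>I. dist_prod i x))"
  proof (intro unit_Ic_mult unit_Ic_prod u(1))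
    fix i assume "i \<in> I"
    thus "unit_Ic (dist_prod i x)"
      using k r0 by (intro dist_prod_unit[OF k]) (auto simp: I_def intro!: Nat.gr0I)
  qed
  show ?case
  proof (intro exI conjI)
    show "unit_Ic (inverse ((\<Prod>l\<in>L. u l) * (\<Prod>i\<in>I. dist_prod i x)))"
      by (rule unit_Ic_inverse[OF unit])
    show "dist_prod (k * r) x = cyc_at r (poly (pderiv (iter_poly k)) x) *
        inverse ((\<Prod>l\<in>L. u l) * (\<Prod>i\<in>I. dist_prod i x))"
    proof -
      have nz: "(\<Prod>l\<in>L. u l) * (\<Prod>i\<in>I. dist_prod i x) \<noteq> 0" using unit by (simp add: unit_Ic_def)
      show ?thesis unfolding w_def[symmetric] eq mult.assoc[of "dist_prod (k * r) x"] right_inverse[OF nz]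
        by simp
    qed
  qed
qed

end

section \<open>Divisibility by the factors of smaller period\<close>

context unicritical_dynamics
begin

text \<open>
  Up to a sign, the resultant of the \<open>r\<close>-th cyclotomic polynomial and the \<open>m\<close>-th multiplier polynomial.
\<close>
abbreviation res :: "nat \<Rightarrow> nat \<Rightarrow> 'a" where
  "res r m \<equiv> \<Prod>C\<in>cycles m. cyc_at r (cycle_mult C)"

text \<open>
  The resultant of the dynatomic polynomials of levels \<open>n\<close> and \<open>k\<close>, evaluated at the points of period \<open>k\<close>
  instead of those of period \<open>n\<close>; each cycle of length \<open>k\<close> then contributes \<open>k\<close> equal
  cyclotomic values.
\<close>
lemma prod_dist_prod_over_Per:
  assumes n: "n > 0" and k: "k dvd n" "k < n"
  shows "\<exists>u\<in>Ic. (\<Prod>x\<in>Per n. dist_prod k x) = res (n div k) k ^ k * u"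
proof -
  have k0: "k > 0" using k n by (auto intro: dvd_pos_nat)
  define r where "r = n div k"
  have r: "n = k * r" "r > 1" using k n by (auto simp: r_def)
  have "\<forall>y\<in>Per k. \<exists>u. unit_Ic u \<and> dist_prod n y = cyc_at r (cycle_mult (orbit k y)) * u"
    using dist_prod_multiple_period[OF k0 _ r(2)] mult_orbit r(1) by auto
  then obtain u where u: "\<And>y. y \<in> Per k \<Longrightarrow> unit_Ic (u y)"
    "\<And>y. y \<in> Per k \<Longrightarrow> dist_prod n y = cyc_at r (cycle_mult (orbit k y)) * u y" by metis
  have neq: "x \<noteq> y" if "x \<in> Per n" "y \<in> Per k" for x y
    using Per_disjoint[OF n k0] k that by blast
  have "(\<Prod>x\<in>Per n. dist_prod k x) = (\<Prod>x\<in>Per n. \<Prod>y\<in>Per k. x - y)"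
    unfolding dist_prod_def using neq by (intro prod.cong refl) auto
  also have "\<dots> = (\<Prod>y\<in>Per k. \<Prod>x\<in>Per n. (- 1) * (y - x))"
    by (subst prod.swap) simp
  also have "\<dots> = (\<Prod>y\<in>Per k. (- 1) ^ card (Per n) * dist_prod n y)"
    unfolding dist_prod_def prod.distrib using neq by (intro prod.cong refl arg_cong2[of _ _ _ _ "(*)"]) auto
  also have "\<dots> = (\<Prod>y\<in>Per k. cyc_at r (cycle_mult (orbit k y))) * (\<Prod>y\<in>Per k. (- 1) ^ card (Per n) * u y)"
    unfolding prod.distrib[symmetric] by (intro prod.cong refl) (simp add: u(2))
  also have "(\<Prod>y\<in>Per k. cyc_at r (cycle_mult (orbit k y))) = res r k ^ k"
    by (rule prod_Per_orbit[OF k0])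
  finally show ?thesis
    using u(1) unfolding r_def[symmetric]
    by (intro bexI[of _ "\<Prod>y\<in>Per k. (- 1) ^ card (Per n) * u y"])
       (auto simp: unit_Ic_def intro!: Ic.prod_mem Ic.mult_mem Ic.power_mem Ic.uminus_mem Ic.one_mem)
qed

lemma card_multiples_below:
  assumes "k dvd n" "n > (0 :: nat)"
  shows "card {i. 0 < i \<and> i < n \<and> k dvd i} = n div k - 1"
proof -
  have k: "k > 0" using assms by (auto intro: dvd_pos_nat)
  have "{i. 0 < i \<and> i < n \<and> k dvd i} = (\<lambda>l. k * l) ` {1..<n div k}"
  proof (intro equalityI subsetI)
    fix i assume "i \<in> {i. 0 < i \<and> i < n \<and> k dvd i}"
    then obtain l where "i = k * l" "0 < k * l" "k * l < n" by blast
    moreover have "n = k * (n div k)" using assms by simp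
    ultimately have "l \<in> {1..<n div k}" by (metis One_nat_def Suc_leI atLeastLessThan_iff mult_less_cancel1 nat_0_less_mult_iff)
    thus "i \<in> (\<lambda>l. k * l) ` {1..<n div k}" using \<open>i = k * l\<close> by blast
  next
    fix i assume "i \<in> (\<lambda>l. k * l) ` {1..<n div k}"
    then obtain l where "l \<in> {1..<n div k}" "i = k * l" by blast
    hence l: "i = k * l" "1 \<le> l" "l < n div k" by auto
    have "k * l < k * (n div k)" using l(3) k by simp
    thus "i \<in> {i. 0 < i \<and> i < n \<and> k dvd i}" using l k assms by simp
  qed
  moreover have "inj_on (\<lambda>l. k * l) {1..<n div k}" using k by (simp add: inj_on_def)
  ultimately show ?thesis by (simp add: card_image)
qed

text \<open>
  The factors \<open>x - z\<close> of \<open>\<omega> - 1\<close> belong to points \<open>z\<close> of smaller period, to the iterates \<open>f\<^sup>i(x)\<close>, or to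
  other points of period \<open>n\<close>. The period \<open>k\<close> contributes once directly, and once more for each \<open>i\<close> strictly
  between \<open>0\<close> and \<open>n\<close> that is a multiple of \<open>k\<close>: \<open>n/k\<close> times in total.
\<close>
lemma multiplier_minus_one_dvd:
  assumes n: "n > 0" and x: "x \<in> Per n"
  shows "\<exists>u\<in>Ic. cycle_mult (orbit n x) - 1 = (\<Prod>k | k dvd n \<and> k < n. dist_prod k x ^ (n div k)) * u"
proof -
  define K where "K = {k. k dvd n \<and> k < n}"
  define J where "J = {i. 0 < i \<and> i < n}"
  have finK: "finite K" using n by (simp add: K_def)
  have finJ: "finite J" by (simp add: J_def)
  have xI: "x \<in> Ic" using Per_integral[OF n x] .
  have fx: "(f ^^ n) x = x" using x by (simp add: Per_def)
  have not_fixed: "(f ^^ i) x \<noteq> x" if "i \<in> J" for i using that x by (auto simp: J_def Per_def)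
  \<comment> \<open>The iterates of \<open>x\<close> among the points of period \<open>n\<close> are split off.\<close>
  have orb: "dist_prod n x = (\<Prod>z\<in>Per n - orbit n x. x - z) * (\<Prod>i\<in>J. x - (f ^^ i) x)"
  proof -
    have sub: "orbit n x \<subseteq> Per n" by (rule orbit_subset_Per[OF x n])
    have "dist_prod n x = (\<Prod>z\<in>Per n - orbit n x. if z = x then 1 else x - z) *
        (\<Prod>z\<in>orbit n x. if z = x then 1 else x - z)"
      unfolding dist_prod_def by (rule prod.subset_diff[OF sub finite_Per[OF n]])
    also have "(\<Prod>z\<in>Per n - orbit n x. if z = x then 1 else x - z) = (\<Prod>z\<in>Per n - orbit n x. x - z)"
      using self_in_orbit[OF n, of x] by (intro prod.cong) auto
    also have "(\<Prod>z\<in>orbit n x. if z = x then 1 else x - z) =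
        (\<Prod>i<n. if (f ^^ i) x = x then 1 else x - (f ^^ i) x)"
      unfolding orbit_def by (simp add: prod.reindex[OF inj_on_orbit[OF x]])
    also have "{..<n} = insert 0 J" using n by (auto simp: J_def)
    also have "(\<Prod>i\<in>insert 0 J. if (f ^^ i) x = x then 1 else x - (f ^^ i) x) = (\<Prod>i\<in>J. x - (f ^^ i) x)"
      using finJ not_fixed by (subst prod.insert) (auto simp: J_def)
    finally show ?thesis .
  qed
  \<comment> \<open>Periods dividing \<open>i\<close> but not \<open>n\<close> are collected in the first factor, which is only known to be integral.\<close>
  have iter: "x - (f ^^ i) x = - (\<Prod>k\<in>{k. k dvd i} - K. dist_prod k x) *
      (\<Prod>k\<in>{k\<in>K. k dvd i}. dist_prod k x)" if i: "i \<in> J" for i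
  proof -
    have "x - (f ^^ i) x = - (\<Prod>k | k dvd i. dist_prod k x)"
      using prod_dist_prod_not_fixed[OF _ not_fixed[OF i]] i by (simp add: J_def)
    also have "(\<Prod>k | k dvd i. dist_prod k x) =
        (\<Prod>k\<in>{k. k dvd i} - {k\<in>K. k dvd i}. dist_prod k x) * (\<Prod>k\<in>{k\<in>K. k dvd i}. dist_prod k x)"
      using i by (intro prod.subset_diff) (auto simp: J_def)
    also have "{k. k dvd i} - {k\<in>K. k dvd i} = {k. k dvd i} - K" by auto
    finally show ?thesis by simp
  qed
  define v where "v = (\<Prod>z\<in>Per n - orbit n x. x - z) * (\<Prod>i\<in>J. - (\<Prod>k\<in>{k. k dvd i} - K. dist_prod k x))"
  have v: "v \<in> Ic" unfolding v_def
    using Per_integral[OF n] xI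
    by (intro Ic.mult_mem Ic.prod_mem Ic.uminus_mem dist_prod_integral)
       (auto simp: J_def intro: Ic.diff_mem dvd_pos_nat)
  have "(\<Prod>i\<in>J. x - (f ^^ i) x) = (\<Prod>i\<in>J. - (\<Prod>k\<in>{k. k dvd i} - K. dist_prod k x)) *
      (\<Prod>i\<in>J. \<Prod>k\<in>{k\<in>K. k dvd i}. dist_prod k x)"
    unfolding prod.distrib[symmetric] by (intro prod.cong refl iter)
  also have "(\<Prod>i\<in>J. \<Prod>k\<in>{k\<in>K. k dvd i}. dist_prod k x) =
      (\<Prod>k\<in>K. \<Prod>i\<in>{i\<in>J. k dvd i}. dist_prod k x)"
    by (rule prod.swap_restrict[OF finJ finK])
  also have "\<dots> = (\<Prod>k\<in>K. dist_prod k x ^ (n div k - 1))"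
  proof (intro prod.cong refl)
    fix k assume "k \<in> K"
    moreover have "{i\<in>J. k dvd i} = {i. 0 < i \<and> i < n \<and> k dvd i}" by (auto simp: J_def)
    ultimately show "(\<Prod>i\<in>{i\<in>J. k dvd i}. dist_prod k x) = dist_prod k x ^ (n div k - 1)"
      using card_multiples_below[of k n] n by (simp add: K_def)
  qed
  finally have dn: "dist_prod n x = v * (\<Prod>k\<in>K. dist_prod k x ^ (n div k - 1))"
    unfolding orb v_def by (simp only: mult.assoc)
  have "cycle_mult (orbit n x) - 1 = (\<Prod>k | k dvd n. dist_prod k x)"
    using prod_dist_prod_fixed[OF n fx] mult_orbit[OF x] by simp
  also have "\<dots> = dist_prod n x * (\<Prod>k\<in>K. dist_prod k x)"
    unfolding divisors_insert[OF n] K_def[symmetric] using finK by (subst prod.insert) (auto simp: K_def)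
  also have "\<dots> = v * ((\<Prod>k\<in>K. dist_prod k x ^ (n div k - 1)) * (\<Prod>k\<in>K. dist_prod k x))"
    unfolding dn by (simp only: mult.assoc)
  also have "(\<Prod>k\<in>K. dist_prod k x ^ (n div k - 1)) * (\<Prod>k\<in>K. dist_prod k x) =
      (\<Prod>k\<in>K. dist_prod k x ^ (n div k))"
    unfolding prod.distrib[symmetric]
  proof (intro prod.cong refl)
    fix k assume "k \<in> K"
    hence "n div k > 0" using n by (auto simp: K_def elim!: dvdE)
    thus "dist_prod k x ^ (n div k - 1) * dist_prod k x = dist_prod k x ^ (n div k)"
      by (metis Suc_diff_1 power_Suc2)
  qed
  finally show ?thesis using v unfolding K_def by (intro bexI[of _ v]) (simp_all only: mult.commute)
qed

lemma res_power_dvd: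
  assumes n: "n > 0"
  shows "\<exists>u\<in>Ic. res 1 n ^ n = (\<Prod>k | k dvd n \<and> k < n. res (n div k) k) ^ n * u"
proof -
  define K where "K = {k. k dvd n \<and> k < n}"
  have "\<forall>x\<in>Per n. \<exists>u\<in>Ic. cycle_mult (orbit n x) - 1 = (\<Prod>k\<in>K. dist_prod k x ^ (n div k)) * u"
    using multiplier_minus_one_dvd[OF n] by (simp add: K_def)
  then obtain u where u: "\<And>x. x \<in> Per n \<Longrightarrow> u x \<in> Ic"
    "\<And>x. x \<in> Per n \<Longrightarrow> cycle_mult (orbit n x) - 1 = (\<Prod>k\<in>K. dist_prod k x ^ (n div k)) * u x" by metis
  have "\<forall>k\<in>K. \<exists>v\<in>Ic. (\<Prod>x\<in>Per n. dist_prod k x) = res (n div k) k ^ k * v"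
    using prod_dist_prod_over_Per[OF n] by (auto simp: K_def)
  then obtain v where v: "\<And>k. k \<in> K \<Longrightarrow> v k \<in> Ic"
    "\<And>k. k \<in> K \<Longrightarrow> (\<Prod>x\<in>Per n. dist_prod k x) = res (n div k) k ^ k * v k" by metis
  have "res 1 n ^ n = (\<Prod>x\<in>Per n. cycle_mult (orbit n x) - 1)"
    using prod_Per_orbit[OF n, of "\<lambda>C. cycle_mult C - 1"] by (simp add: cyclotomic_1[simplified])
  also have "\<dots> = (\<Prod>x\<in>Per n. \<Prod>k\<in>K. dist_prod k x ^ (n div k)) * (\<Prod>x\<in>Per n. u x)"
    unfolding prod.distrib[symmetric] by (intro prod.cong refl u(2))
  also have "(\<Prod>x\<in>Per n. \<Prod>k\<in>K. dist_prod k x ^ (n div k)) = (\<Prod>k\<in>K. (\<Prod>x\<in>Per n. dist_prod k x) ^ (n div k))"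
    by (subst prod.swap) (simp add: prod_power_distrib)
  also have "\<dots> = (\<Prod>k\<in>K. res (n div k) k ^ n * v k ^ (n div k))"
  proof (intro prod.cong refl)
    fix k assume k: "k \<in> K"
    hence "k * (n div k) = n" by (simp add: K_def)
    thus "(\<Prod>x\<in>Per n. dist_prod k x) ^ (n div k) = res (n div k) k ^ n * v k ^ (n div k)"
      unfolding v(2)[OF k] power_mult_distrib power_mult[symmetric] by simp
  qed
  also have "\<dots> = (\<Prod>k\<in>K. res (n div k) k) ^ n * (\<Prod>k\<in>K. v k ^ (n div k))"
    by (simp add: prod.distrib prod_power_distrib)
  finally show ?thesis unfolding K_def[symmetric]
    using u(1) v(1)
    by (intro bexI[of _ "(\<Prod>k\<in>K. v k ^ (n div k)) * (\<Prod>x\<in>Per n. u x)"])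
       (auto intro!: Ic.mult_mem Ic.prod_mem Ic.power_mem simp: mult.assoc)
qed

lemma monic_t_nonzero: "lead_coeff P = 1 \<Longrightarrow> poly (of_int_poly P) t \<noteq> 0"
  using t_transcendental unfolding int_transcendental_def by (metis leading_coeff_0_iff zero_neq_one)

lemma res_eq_monic:
  assumes "m > 0" "r > 0"
  shows "\<exists>P :: int poly. res r m = poly (of_int_poly P) t \<and> lead_coeff P = 1"
  by (rule prod_poly_mult_eq_monic) (use assms lead_coeff_cyclotomic in auto)

text \<open>
  Divisibility in \<open>\<int>[c]\<close> between polynomials in \<open>t\<close> is divisibility in \<open>\<int>[t]\<close> when the divisor is monic in
  \<open>t\<close>: a nonzero remainder would have smaller degree in \<open>c\<close> than the divisor.
\<close>
lemma quotient_by_monic_in_t: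
  assumes P: "lead_coeff P = 1" and h: "h \<in> int_adj c"
    and eq: "poly (of_int_poly A) t = h * poly (of_int_poly P) t"
  shows "\<exists>Q :: int poly. A = P * Q \<and> h = poly (of_int_poly Q) t"
proof -
  define M where "M = Polynomial.monom (int d ^ d) (d - 1)"
  have degM: "degree M = d - 1" unfolding M_def using d by (simp add: degree_monom_eq)
  obtain Q R where QR: "A = P * Q + R" "R = 0 \<or> degree R < degree P"
    using monic_division[OF P] by blast
  have "poly (of_int_poly Q) t \<in> int_adj t" by (simp add: int_adj_def)
  hence "poly (of_int_poly Q) t \<in> int_adj c" using int_adj_t_subset by blast
  hence "h - poly (of_int_poly Q) t \<in> int_adj c" by (rule Zc.diff_mem[OF h])
  then obtain w where w: "h - poly (of_int_poly Q) t = poly (of_int_poly w) c"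
    by (auto simp: int_adj_def)
  have "poly (of_int_poly R) t = poly (of_int_poly w) c * poly (of_int_poly P) t"
    using eq unfolding QR(1) w[symmetric]
    by (simp add: of_int_poly_hom.hom_add of_int_poly_hom.hom_mult algebra_simps)
  hence "poly (of_int_poly (pcompose R M - w * pcompose P M)) c = 0"
    unfolding t_eval M_def[symmetric] by (simp add: of_int_poly_hom.hom_minus of_int_poly_hom.hom_mult)
  hence eqM: "pcompose R M = w * pcompose P M"
    using c unfolding int_transcendental_def by (metis eq_iff_diff_eq_0)
  have "R = 0"
  proof (rule ccontr)
    assume R: "R \<noteq> 0"
    have PM: "pcompose P M \<noteq> 0" "pcompose R M \<noteq> 0"
      using P R pcompose_eq_0[of P M] pcompose_eq_0[of R M] degM d by auto
    hence "w \<noteq> 0" using eqM by auto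
    have "degree R * (d - 1) = degree w + degree P * (d - 1)"
      using arg_cong[OF eqM, of degree] degree_mult_eq[OF \<open>w \<noteq> 0\<close> PM(1)] by (simp add: degM)
    moreover have "degree R * (d - 1) < degree P * (d - 1)" using QR(2) R d by simp
    ultimately show False by linarith
  qed
  moreover from this have "h * poly (of_int_poly P) t = poly (of_int_poly Q) t * poly (of_int_poly P) t"
    using eq[symmetric] unfolding QR(1) by (simp add: of_int_poly_hom.hom_mult mult.commute)
  hence "h = poly (of_int_poly Q) t" using monic_t_nonzero[OF P] by auto
  ultimately show ?thesis using QR(1) by auto
qed

text \<open>
  Only the \<open>n\<close>-th power of the quotient is visibly integral over \<open>\<int>[c]\<close>; integral closedness gives the
  quotient itself.
\<close>
theorem primitive_quotient_monic:
  assumes n: "n > 0"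
  shows "\<exists>Q :: int poly. lead_coeff Q = 1 \<and>
    res 1 n / (\<Prod>k | k dvd n \<and> k < n. res (n div k) k) = poly (of_int_poly Q) t"
proof -
  define B where "B = (\<Prod>k | k dvd n \<and> k < n. res (n div k) k)"
  have "\<forall>k. k dvd n \<and> k < n \<longrightarrow> (\<exists>P :: int poly. res (n div k) k = poly (of_int_poly P) t \<and> lead_coeff P = 1)"
    using n by (auto intro!: res_eq_monic elim!: dvdE)
  then obtain P where P: "\<And>k. k dvd n \<Longrightarrow> k < n \<Longrightarrow> res (n div k) k = poly (of_int_poly (P k)) t"
    "\<And>k. k dvd n \<Longrightarrow> k < n \<Longrightarrow> lead_coeff (P k :: int poly) = 1" by metis
  define PB where "PB = (\<Prod>k | k dvd n \<and> k < n. P k)"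
  have PB: "lead_coeff PB = 1" unfolding PB_def lead_coeff_prod by (simp add: P(2))
  have B: "B = poly (of_int_poly PB) t"
    unfolding B_def PB_def of_int_poly_hom.hom_prod poly_prod by (intro prod.cong) (auto simp: P(1))
  have B0: "B \<noteq> 0" unfolding B by (rule monic_t_nonzero[OF PB])
  obtain A :: "int poly" where A: "res 1 n = poly (of_int_poly A) t" "lead_coeff A = 1"
    using res_eq_monic[OF n, of 1] by auto
  define h where "h = res 1 n / B"
  obtain u where u: "u \<in> Ic" "res 1 n ^ n = B ^ n * u"
    using res_power_dvd[OF n] unfolding B_def by blast
  have "h ^ n = u" using u(2) B0 by (simp add: h_def power_divide)
  hence "h ^ n \<in> Ic" using u(1) by simp
  hence "h \<in> Ic" using integral_over_root[OF comm_subring_int_adj _ n] by blast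
  moreover have "h \<in> frac_adj c"
  proof -
    have "poly (of_int_poly q) t \<in> frac_adj c" for q
      using int_adj_t_subset int_adj_subset_frac_adj[of c] by (auto simp: int_adj_def)
    thus ?thesis unfolding h_def A(1) B by (intro Qc.divide_mem)
  qed
  ultimately have h: "h \<in> int_adj c" by (intro int_adj_integrally_closed c)
  have "poly (of_int_poly A) t = h * poly (of_int_poly PB) t"
    using B0 by (simp add: h_def flip: A(1) B)
  then obtain Q where Q: "A = PB * Q" "h = poly (of_int_poly Q) t"
    using quotient_by_monic_in_t[OF PB h] by blast
  have "lead_coeff Q = 1" using A(2) PB unfolding Q(1) lead_coeff_mult by simp
  thus ?thesis using Q(2) unfolding h_def B_def by blast
qed

end

section \<open>Dynatomic and multiplier polynomials over the integers\<close>

lemma emb_0: "emb 0 = 0" by (simp add: emb_def)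
lemma emb_1: "emb 1 = 1" by (simp add: emb_def)
lemma emb_add: "emb (p + q) = emb p + emb q" by (simp add: emb_def)
lemma emb_mult: "emb (p * q) = emb p * emb q" by (simp add: emb_def)

lemma emb_inject: "emb p = emb q \<Longrightarrow> p = q"
  by (simp add: emb_def)

lemma emb_eq_0: "emb p = 0 \<Longrightarrow> p = 0"
  by (simp add: emb_def)

lemma emb_of_int: "emb (of_int n) = of_int n"
proof -
  have nat: "emb (of_nat k) = of_nat k" for k by (induction k) (simp_all add: emb_0 emb_1 emb_add)
  have minus: "emb (- p) = - emb p" for p by (simp add: emb_def)
  show ?thesis by (cases n) (simp_all add: nat minus del: of_nat_Suc)
qed

interpretation embh: inj_idom_hom emb
  by unfold_locales (auto simp: emb_0 emb_1 emb_add emb_mult dest: emb_inject emb_eq_0)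

interpretation emb: map_poly_inj_idom_hom emb ..

definition c_elem :: Qc_closure where "c_elem = emb [:0, 1:]"

lemma emb_eq_poly: "emb p = poly (of_int_poly p) c_elem"
proof (induction p)
  case (pCons a p)
  have "emb [:a:] = of_int a"
  proof -
    have "[:a:] = of_int a" by (simp add: of_int_poly)
    thus ?thesis by (simp only: emb_of_int)
  qed
  moreover have "pCons a p = [:a:] + [:0, 1:] * p" by simp
  ultimately have "emb (pCons a p) = of_int a + c_elem * emb p"
    unfolding c_elem_def by (metis emb_add emb_mult)
  thus ?case by (simp add: pCons.IH of_int_hom.map_poly_pCons_hom)
qed (simp add: emb_0)

lemma range_emb: "range emb = int_adj c_elem"
  by (simp add: int_adj_def emb_eq_poly[abs_def])

lemma c_elem_transcendental: "int_transcendental c_elem"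
  unfolding int_transcendental_def emb_eq_poly[symmetric] using emb_eq_0 by blast

lemma lift_poly:
  assumes "\<And>i. coeff p i \<in> int_adj c_elem"
  shows "\<exists>P. map_poly emb P = p"
proof -
  have "map_poly emb (map_poly (inv_into UNIV emb) p) = p"
  proof (rule poly_eqI)
    fix i
    have "inv_into UNIV emb 0 = 0" using inv_f_f[of emb 0] emb_0 emb_inject by (metis injI)
    thus "coeff (map_poly emb (map_poly (inv_into UNIV emb) p)) i = coeff p i"
      using assms[of i] by (simp add: coeff_map_poly emb_0 f_inv_into_f flip: range_emb)
  qed
  thus ?thesis by blast
qed

text \<open>
  Uniqueness of the monic \<open>m\<close>-th root that defines the multiplier polynomial.
\<close>
lemma monic_power_eq:
  fixes p q :: "int poly poly"
  assumes "lead_coeff p = 1" "lead_coeff q = 1" "p ^ m = q ^ m" "m > 0"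
  shows "p = q"
proof -
  have nz: "p \<noteq> 0" "q \<noteq> 0" using assms by auto
  have "q dvd p" using assms pow_divides_pow_iff[of m q p] by simp
  then obtain e where e: "p = q * e" by blast
  have "m * degree p = m * degree q"
    using arg_cong[OF assms(3), of degree] nz by (simp add: degree_power_eq)
  hence "degree e = 0" using assms(4) nz e by (simp add: degree_mult_eq)
  then obtain a where a: "e = [:a:]" by (elim degree_eq_zeroE)
  hence "a = 1" using assms(1,2) unfolding e lead_coeff_mult by simp
  thus ?thesis using e a by simp
qed

lemma alg_closed_poly_eq:
  fixes p :: "'a :: alg_closed_field poly"
  assumes "lead_coeff p = 1"
  shows "size (proots p) = degree p" "poly p x = (\<Prod>a\<in>#proots p. x - a)"
proof -
  have "p \<noteq> 0" using assms by auto
  then obtain A where A: "size A = degree p" "p = Polynomial.smult (lead_coeff p) (\<Prod>a\<in>#A. [:- a, 1:])"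
    using alg_closed_imp_factorization by blast
  hence p: "p = (\<Prod>a\<in>#A. [:- a, 1:])" using assms by simp
  have "proots p = A" unfolding p by (rule proots_prod_linear)
  thus "size (proots p) = degree p" "poly p x = (\<Prod>a\<in>#proots p. x - a)"
    using A(1) by (simp_all, subst p, simp add: poly_prod_mset multiset.map_comp comp_def)
qed

context
  fixes d :: nat
  assumes d: "d \<ge> 2"
begin

interpretation U: unicritical_dynamics d c_elem
  by unfold_locales (fact d, fact c_elem_transcendental)

lemma map_poly_iterate: "map_poly emb (iterate d k) = U.iter_poly k"
proof (induction k)
  case 0
  show ?case by (simp add: iterate_def emb_1 emb_0)
next
  case (Suc k)
  have "iterate d (Suc k) = iterate d k ^ d + [:[:0, 1:]:]"
  proof -
    have "pcompose (p ^ l) q = pcompose p q ^ l" for p q :: "int poly poly" and l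
      by (induction l) (simp_all add: pcompose_mult pcompose_1)
    thus ?thesis by (simp add: iterate_def unicritical_def pcompose_add pcompose_pCons)
  qed
  hence "map_poly emb (iterate d (Suc k)) = U.iter_poly k ^ d + map_poly emb [:[:0, 1:]:]"
    by (simp add: emb.hom_add emb.hom_power Suc)
  also have "map_poly emb [:[:0, 1:]:] = [:c_elem:]" by (simp add: c_elem_def)
  finally show ?case by simp
qed

text \<open>
  The monic polynomials with roots \<open>Per k\<close> have coefficients in \<open>\<int>[c]\<close>, and their product over the divisors
  \<open>k\<close> of \<open>m\<close> is \<open>f\<^sup>m(z) - z\<close>; Moebius inversion turns this into the defining formula.
\<close>
lemma dynatomic_eq:
  assumes "m > 0"
  shows "map_poly emb (dynatomic d m) = (\<Prod>z\<in>U.Per m. [:- z, 1:])"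
proof -
  have "\<forall>k. \<exists>P. k > 0 \<longrightarrow> map_poly emb P = (\<Prod>z\<in>U.Per k. [:- z, 1:])"
    using lift_poly U.Per_poly_coeff by metis
  then obtain G where G: "\<And>k. k > 0 \<Longrightarrow> map_poly emb (G k) = (\<Prod>z\<in>U.Per k. [:- z, 1:])" by metis
  have G0: "G k \<noteq> 0" if "k > 0" for k
  proof
    assume "G k = 0"
    hence "(\<Prod>z\<in>U.Per k. [:- z, 1:]) = 0" using G[OF that] by simp
    thus False using U.finite_Per[OF that] by simp
  qed
  have F: "iterate d k - [:0, 1:] = (\<Prod>j | j dvd k. G j)" if k: "k > 0" for k
  proof -
    have "map_poly emb (iterate d k - [:0, 1:]) = U.iter_poly k - [:0, 1:]"
      by (simp add: emb.hom_minus map_poly_iterate emb_0 emb_1)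
    also have "\<dots> = (\<Prod>j | j dvd k. \<Prod>z\<in>U.Per j. [:- z, 1:])"
      unfolding U.fixed_point_poly_eq_prod[OF k] by (rule U.prod_Fix[OF k])
    also have "\<dots> = (\<Prod>j | j dvd k. map_poly emb (G j))"
      using k by (intro prod.cong) (auto simp: G dvd_pos_nat)
    also have "\<dots> = map_poly emb (\<Prod>j | j dvd k. G j)" by (simp add: emb.hom_prod)
    finally show ?thesis by (rule emb.injectivity)
  qed
  have "(\<Prod>k | k dvd m. to_fract (iterate d k - [:0, 1:]) powi moebius (m div k)) = to_fract (G m)"
  proof (rule prod_moebius_inversion[OF assms])
    fix k assume k: "k dvd m"
    hence k0: "k > 0" using assms by (auto intro: dvd_pos_nat)
    show "to_fract (iterate d k - [:0, 1:]) = (\<Prod>j | j dvd k. to_fract (G j))"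
    proof -
      have "to_fract (\<Prod>j\<in>A. G j) = (\<Prod>j\<in>A. to_fract (G j))" for A
        by (induction A rule: infinite_finite_induct) simp_all
      thus ?thesis unfolding F[OF k0] .
    qed
    show "to_fract (G k) \<noteq> 0" using G0[OF k0] by simp
  qed
  hence "dynatomic d m = G m" unfolding dynatomic_def by simp
  thus ?thesis using G[OF assms] by simp
qed

lemma proots_dynatomic:
  assumes "m > 0"
  shows "proots (map_poly emb (dynatomic d m)) = mset_set (U.Per m)"
  unfolding dynatomic_eq[OF assms] prod_unfold_prod_mset by (rule proots_prod_linear)

lemma multiplier_eq: "z \<in> U.Per m \<Longrightarrow> multiplier d m z = U.cycle_mult (U.orbit m z)"
  by (simp add: multiplier_def map_poly_iterate U.mult_orbit)

lemma multiplier_poly_eq: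
  assumes "m > 0"
  shows "map_poly emb (multiplier_poly d m) = (\<Prod>C\<in>U.cycles m. [:- U.cycle_mult C, 1:])"
proof -
  obtain D where D: "map_poly emb D = (\<Prod>C\<in>U.cycles m. [:- U.cycle_mult C, 1:])"
    using lift_poly[of "\<Prod>C\<in>U.cycles m. [:- U.cycle_mult C, 1:]"]
      U.multiplier_poly_coeff[OF assms] U.int_adj_t_subset by blast
  have "emb (lead_coeff D) = lead_coeff (map_poly emb D)" by simp
  also have "\<dots> = emb 1" unfolding D lead_coeff_prod by (simp add: emb_1)
  finally have lD: "lead_coeff D = 1" by (rule emb_inject)
  have "(\<Prod>\<alpha>\<in>#proots (map_poly emb (dynatomic d m)). [:- multiplier d m \<alpha>, 1:])
      = (\<Prod>z\<in>U.Per m. [:- U.cycle_mult (U.orbit m z), 1:])"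
    unfolding proots_dynatomic[OF assms] prod_unfold_prod_mset[symmetric]
    by (intro prod.cong) (auto simp: multiplier_eq)
  also have "\<dots> = map_poly emb D ^ m"
    unfolding D by (rule U.prod_Per_orbit[OF assms])
  finally have pw: "(\<Prod>\<alpha>\<in>#proots (map_poly emb (dynatomic d m)). [:- multiplier d m \<alpha>, 1:])
      = map_poly emb D ^ m" .
  have "multiplier_poly d m = D"
    unfolding multiplier_poly_def pw
  proof (rule the_equality)
    fix E assume E: "lead_coeff E = 1 \<and> map_poly emb E ^ m = map_poly emb D ^ m"
    hence "map_poly emb (E ^ m) = map_poly emb (D ^ m)" by (simp only: emb.hom_power)
    hence "E ^ m = D ^ m" by (rule emb.injectivity)
    with E lD assms show "E = D" using monic_power_eq[of E D m] by blast
  qed (use lD in simp)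
  thus ?thesis using D by simp
qed

text \<open>
  The resultant is symmetric up to the sign from reversing all differences \<open>\<zeta> - \<omega>\<^sub>C\<close>.
\<close>
lemma Delta_res_eq:
  assumes "n > 0" "m dvd n"
  shows "Delta_res d n m = (- 1) ^ (totient (n div m) * card (U.cycles m)) * U.res (n div m) m"
proof -
  define r where "r = n div m"
  have m: "m > 0" using assms by (auto intro: dvd_pos_nat)
  have r: "r > 0" using assms by (auto simp: r_def elim!: dvdE)
  define \<Phi> :: "Qc_closure poly" where "\<Phi> = of_int_poly (cyclotomic r)"
  have l\<Phi>: "lead_coeff \<Phi> = 1" using lead_coeff_cyclotomic[OF r] by (simp add: \<Phi>_def)
  have deg: "degree \<Phi> = totient r" using degree_cyclotomic[OF r] by (simp add: \<Phi>_def)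
  note \<Phi> = alg_closed_poly_eq[OF l\<Phi>]
  have "Delta_res d n m = (\<Prod>\<alpha>\<in>#proots \<Phi>. \<Prod>C\<in>U.cycles m. \<alpha> - U.cycle_mult C)"
    unfolding Delta_res_def root_resultant_def r_def[symmetric] \<Phi>_def[symmetric] multiplier_poly_eq[OF m]
      l\<Phi> power_one mult_1_left
    by (intro arg_cong[of _ _ prod_mset] image_mset_cong) (simp add: poly_prod)
  also have "\<dots> = (\<Prod>C\<in>U.cycles m. \<Prod>\<alpha>\<in>#proots \<Phi>. \<alpha> - U.cycle_mult C)"
  proof -
    have "(\<Prod>\<alpha>\<in>#A. \<Prod>C\<in>S. g \<alpha> C) = (\<Prod>C\<in>S. \<Prod>\<alpha>\<in>#A. g \<alpha> C)"
      for A and S :: "Qc_closure set set" and g :: "Qc_closure \<Rightarrow> Qc_closure set \<Rightarrow> Qc_closure"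
      by (induction A) (simp_all add: prod.distrib)
    thus ?thesis .
  qed
  also have "\<dots> = (\<Prod>C\<in>U.cycles m. (- 1) ^ totient r * poly \<Phi> (U.cycle_mult C))"
  proof (intro prod.cong refl)
    fix C
    have "(\<Prod>\<alpha>\<in>#A. \<alpha> - x) = (- 1) ^ size A * (\<Prod>\<alpha>\<in>#A. x - \<alpha>)" for A and x :: Qc_closure
      by (induction A) (auto simp: algebra_simps)
    thus "(\<Prod>\<alpha>\<in>#proots \<Phi>. \<alpha> - U.cycle_mult C) = (- 1) ^ totient r * poly \<Phi> (U.cycle_mult C)"
      by (simp add: \<Phi> deg)
  qed
  finally show ?thesis
    by (simp add: prod.distrib power_mult \<Phi>_def r_def)
qed

lemma dyn_degree_eq:
  assumes "m > 0"
  shows "nat (dyn_degree d m) div m = card (U.cycles m)"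
proof -
  have "dyn_degree d m = int (card (U.Per m))"
    unfolding dyn_degree_def
  proof (rule sum_moebius_inversion[OF assms])
    fix k assume "k dvd m"
    hence "k > 0" using assms by (auto intro: dvd_pos_nat)
    thus "int d ^ k = (\<Sum>j | j dvd k. int (card (U.Per j)))"
      using U.sum_Fix[of k "\<lambda>_. 1 :: nat"] U.card_Fix[of k] by (simp flip: of_nat_sum of_nat_power)
  qed
  hence "nat (dyn_degree d m) = m * card (U.cycles m)" unfolding U.card_Per[OF assms] by (simp only: nat_int)
  thus ?thesis using assms by simp
qed

lemma emb_pcompose_monom:
  "emb (pcompose P (Polynomial.monom (int d ^ d) (d - 1))) = poly (of_int_poly P) U.t"
  unfolding emb_eq_poly U.t_eval ..

lemma signed_monic_witness:
  assumes "D = (- 1) ^ e * poly (of_int_poly P) U.t" "lead_coeff P = 1"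
  shows "\<exists>\<Psi> :: int poly. D = emb (pcompose \<Psi> (Polynomial.monom (int d ^ d) (d - 1))) \<and>
    lead_coeff (Polynomial.smult ((- 1) ^ e) \<Psi>) = 1"
proof (intro exI conjI)
  show "D = emb (pcompose (Polynomial.smult ((- 1) ^ e) P) (Polynomial.monom (int d ^ d) (d - 1)))"
    unfolding emb_pcompose_monom assms(1) by (simp add: of_int_hom.map_poly_hom_smult)
  show "lead_coeff (Polynomial.smult ((- 1) ^ e) (Polynomial.smult ((- 1) ^ e) P)) = 1"
    using assms(2) by (simp flip: power_mult_distrib)
qed

lemma Delta_polynomial:
  assumes n: "n > 0" and m: "m dvd n"
  shows "\<exists>\<Psi> :: int poly. Delta d n m = emb (pcompose \<Psi> (Polynomial.monom (int d ^ d) (d - 1))) \<and>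
    lead_coeff (Polynomial.smult ((- 1) ^ sign_exponent d n m) \<Psi>) = 1"
proof (cases "m = n")
  case False
  have m0: "m > 0" and r0: "n div m > 0" using n m by (auto elim!: dvdE)
  obtain P where P: "U.res (n div m) m = poly (of_int_poly P) U.t" "lead_coeff P = 1"
    using U.res_eq_monic[OF m0 r0] by blast
  have "Delta d n m = (- 1) ^ sign_exponent d n m * poly (of_int_poly P) U.t"
    using False by (simp add: Delta_def sign_exponent_def Delta_res_eq[OF n m] dyn_degree_eq[OF m0] P(1))
  thus ?thesis using P(2) by (rule signed_monic_witness)
next
  case True
  define K where "K = {k. k dvd n \<and> k < n}"
  define N where "N = (\<lambda>k. totient (n div k) * card (U.cycles k))"
  have K: "{k. k dvd n \<and> k \<noteq> n} = K" using n by (auto simp: K_def dest: dvd_imp_le)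
  have k0: "k > 0" if "k \<in> K" for k using that n by (auto simp: K_def intro: dvd_pos_nat)
  obtain Q where Q: "lead_coeff Q = 1"
    "U.res 1 n / (\<Prod>k\<in>K. U.res (n div k) k) = poly (of_int_poly Q) U.t"
    using U.primitive_quotient_monic[OF n] unfolding K_def by blast
  have "emb (poly (multiplier_poly d n) 1) = poly (map_poly emb (multiplier_poly d n)) 1"
    by simp
  also have "\<dots> = (\<Prod>C\<in>U.cycles n. (- 1) * (U.cycle_mult C - 1))"
    unfolding multiplier_poly_eq[OF n] by (simp add: poly_prod)
  also have "\<dots> = (- 1) ^ card (U.cycles n) * U.res 1 n"
    unfolding prod.distrib by (simp add: cyclotomic_1[simplified])
  finally have num: "emb (poly (multiplier_poly d n) 1) = (- 1) ^ card (U.cycles n) * U.res 1 n" .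
  have den: "(\<Prod>k | k dvd n \<and> k \<noteq> n. Delta_res d n k) = (- 1) ^ (\<Sum>k\<in>K. N k) * (\<Prod>k\<in>K. U.res (n div k) k)"
    unfolding K power_sum prod.distrib[symmetric]
    by (intro prod.cong refl) (auto simp: K_def N_def Delta_res_eq[OF n])
  have sgn: "sign_exponent d n n = card (U.cycles n) + (\<Sum>k\<in>K. N k)"
    unfolding sign_exponent_def K_def[symmetric] N_def using k0
    by (simp add: dyn_degree_eq n)
  have "x * a / ((- 1) ^ j * b) = x * (- 1) ^ j * (a / b)" for x a b :: Qc_closure and j
    by (cases "even j") auto
  hence "Delta d n n = (- 1) ^ sign_exponent d n n * poly (of_int_poly Q) U.t"
    unfolding Delta_def num den sgn power_add Q(2)[symmetric] by simp
  thus ?thesis using Q(1) unfolding True by (rule signed_monic_witness)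
qed

end

theorem theorem1p1:
  fixes d n m :: nat
  assumes "d \<ge> 2" and "n > 0" and "m dvd n"
  shows "\<exists>\<Psi> :: int poly.
    Delta d n m = emb (pcompose \<Psi> (Polynomial.monom (int d ^ d) (d - 1))) \<and>
    lead_coeff (Polynomial.smult ((- 1) ^ sign_exponent d n m) \<Psi>) = 1"
  using assms by (rule Delta_polynomial)

end
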